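(* Let $\mathcal A(t,X,Y,v)=\langle Y,A(t,v)X\rangle_{\mathbf V}$ and $\mathcal B(t,Y,v)=\langle Y,B(t,v)\rangle_{\mathbf V}$. Suppose that - $\mathcal A,\mathcal B,F$ are of (Fréchet) class $C^2$ with respect to $v$, with $D_{vv}\mathcal A$, $D_{vv}\mathcal B$ uniformly bounded as soon as $X,Y$ are in a bounded set; - $\nabla_vF$ is of class $C^1$ with respect to $X$; - $D_{vv}F(t,\cdot,X)$ is bounded by a positive, continuous, increasing function $X\mapsto k(\|X\|)$; - the operators $A,B$ are such that the state equation and the adjoint equation have solutions $X_v$ and $Y_v$ for any $v\in L^\infty(0,T;E)$, with $v\mapsto X_v$ and $v\mapsto Y_v$ locally Lipschitz (from $L^\infty(0,T;E)$ to $L^\infty(0,T;\mathbf V)$). Then: 1. For any $v\in L^\infty(0,T;E)$ there exists $\theta^\star>0$ such that for any $\theta>\theta^\star$ the (nonlinear) evolution system $$\partial_tX_{v'}(t)+A(t,v')X_{v'}(t)=B(t,v'),\qquad v'(t)=\mathcal V_\theta\big(t,v(t),X_{v'}(t),Y_v(t)\big),\qquad X_{v'}(0)=X_0$$ has a solution, where $Y_v$ is the adjoint state corresponding to the control $v$. 2. There exists a sequence $(\theta_k)_{k\in\mathbb N}$ such that the algorithm (a) initialization $v^0\in L^\infty(0,T;E)$, (b) $v^{k+1}(t)=\mathcal V_{\theta_k}\big(t,v^k(t),X_{v^{k+1}}(t),Y_{v^k}(t)\big)$ is monotonic (i.e. $J(v^{k+1})\le J(v^k)$ for all $k$) and satisfies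 $$J(v^{k+1})-J(v^k)\le-\theta_k\,\|v^{k+1}-v^k\|^2_{L^2([0,T])}.$$ 3. With the notation of item 2, if $v^{k+1}(t)=v^k(t)$ for all $t\in[0,T]$ (i.e. the algorithm stops), then $v^k$ is a critical point of $J$: $\nabla_vJ(v^k)=0$.
   Context: Setting. $T>0$; $E$, $\mathcal H$, $\mathbf V$ are Hilbert spaces, $\mathbf V$ densely included in $\mathcal H$, with scalar products $\cdot_E$ on $E$ and $\langle\cdot,\cdot\rangle_{\mathbf V}$ on $\mathbf V$; $\|v\|$ is the norm of $E$ for $v\in E$, and $\|X\|$ is the norm of $\mathbf V$ for $X\in\mathbf V$. For $(t,v)\in\mathbb R\times E$, $A(t,v)$ is a possibly unbounded linear operator on $\mathcal H$ such that for almost all $t\in[0,T]$ the domain of $A(t,v)^{1/2}$ includes $\mathbf V$; for $X,Y\in\mathbf V$ the real pairing $\langle Y,A(t,v)X\rangle_{\mathbf V}$ (linear in $X$ and in $Y$) is assumed well defined, and $A^*(t,v)$ denotes the adjoint of $A(t,v)$ with respect to this pairing. $B(t,v)$ is an inhomogeneous term for which $\langle Y,B(t,v)\rangle_{\mathbf V}$ is defined for $Y\in\mathbf V$. The functions $F:\mathbb R\times E\times\mathbf V\to\mathbb R$ and $G:\mathbf V\to\mathbb R$ are differentiable. $\nabla_x$ denotes the gradient with respect to $x$, and $D_x$, $D_{xx}$ denote first and second Fréchet derivatives. State equation: for a control $v:[0,T]\to E$, $X_v(t)\in\mathbf V$ is the solution of $\partial_tX_v+A(t,v(t))X_v=B(t,v(t))$,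 $X_v(0)=X_0$ (with $X_0$ fixed). Cost: $J(v)=\int_0^TF(t,v(t),X_v(t))\,dt+G(X_v(T))$, the integral being assumed to exist. Adjoint equation: $Y_v$ is the solution of $\partial_tY_v-A^*(t,v(t))Y_v+\nabla_XF(t,v(t),X_v(t))=0$, $Y_v(T)=\nabla_XG(X_v(T))$. Standing concavity assumptions: for all $X,X'\in\mathbf V$, $G(X')-G(X)\le\langle\nabla_XG(X),X'-X\rangle_{\mathbf V}$; and for all $t\in\mathbb R$, $v\in E$, $X,X'\in\mathbf V$, $F(t,v,X')-F(t,v,X)\le\langle\nabla_XF(t,v,X),X'-X\rangle_{\mathbf V}$. Definition of $\Delta$: for $v,v'\in E$, $$\Delta(v',v;t,X,Y)=\int_0^1\Big[-\nabla_w\big(\langle Y,A(t,w)X\rangle_{\mathbf V}-\langle Y,B(t,w)\rangle_{\mathbf V}\big)\Big|_{w=v+\lambda(v'-v)}+\nabla_vF\big(t,v+\lambda(v'-v),X\big)\Big]\,d\lambda\in E.$$ Definition of $\mathcal V_\theta$: $\mathcal V_\theta(t,v,X,Y)\in E$ denotes the unique solution $v'$ of $\Delta(v',v;t,X,Y)=-\theta(v'-v)$, for $\theta>0$ large enough (depending on bounds on $t,v,X,Y$) that this solution exists and is unique; the statements about $\theta>\theta^\star$ and $\theta_k$ include that $\mathcal V_\theta$ is so defined at the points where it is used. The update (b) is implicit: $v^{k+1}$ and $X_{v^{k+1}}$ are determined together as a solution of the nonlinear evolution system of item 1 with $v=v^k$, $v'=v^{k+1}$, $\theta=\theta_k$.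 $\|\cdot\|_{L^2([0,T])}$ is the norm of $L^2(0,T;E)$.
   Formalization: Added: on [0,T], ∇_v𝒜 and ∇_vℬ are measurable in t, D_v𝒜 and D_vℬ are bounded for X,Y,v in bounded sets, and D_X∇_vF is bounded for v,X in bounded sets; without uniformity in t item 1 can fail (ℬ=b(t)vY, b in L¹ but not L²). *)

theory Defs
  imports "HOL-Analysis.Analysis" "HOL-Probability.Essential_Supremum"
begin

section \<open>Gradients and Frechet derivatives\<close>

definition gradient :: "('a::real_inner \<Rightarrow> real) \<Rightarrow> 'a \<Rightarrow> 'a"
  where "gradient f x = (THE g. GDERIV f x :> g)"

definition fderiv :: "('a::real_normed_vector \<Rightarrow> 'b::real_normed_vector) \<Rightarrow> 'a \<Rightarrow> ('a \<Rightarrow>\<^sub>L 'b)"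
  where "fderiv f x = Blinfun (frechet_derivative f (at x))"

definition class_C1 :: "('a::real_normed_vector \<Rightarrow> 'b::real_normed_vector) \<Rightarrow> bool"
  where "class_C1 f \<longleftrightarrow> (\<forall>x. f differentiable (at x)) \<and> continuous_on UNIV (fderiv f)"

definition class_C2 :: "('a::real_normed_vector \<Rightarrow> 'b::real_normed_vector) \<Rightarrow> bool"
  where "class_C2 f \<longleftrightarrow> class_C1 f \<and> class_C1 (fderiv f)"


section \<open>Unbounded operators\<close>

text \<open>A linear operator defined on a linear subspace of \<open>'h\<close> is represented by its graph, so that
  its domain is \<^const>\<open>Domain\<close> and composition (on the natural domain) is relational composition.\<close>

definition linear_operator :: "('h::real_vector \<times> 'h) set \<Rightarrow> bool"
  where "linear_operator A \<longleftrightarrow> subspace A \<and> single_valued A"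

definition operator_sqrt :: "('h::real_vector \<times> 'h) set \<Rightarrow> ('h \<times> 'h) set \<Rightarrow> bool"
  where "operator_sqrt A S \<longleftrightarrow> linear_operator S \<and> S O S = A"


section \<open>Lebesgue spaces over the time interval\<close>

text \<open>The spaces are not assumed separable; measurability is therefore Bochner's strong
  measurability, i.e. being an almost everywhere limit of simple functions. Functions are not
  identified with their classes modulo null sets.\<close>

abbreviation time_measure :: "real \<Rightarrow> real measure"
  where "time_measure T \<equiv> lebesgue_on {0..T}"

definition strongly_measurable :: "real \<Rightarrow> (real \<Rightarrow> 'a::real_normed_vector) \<Rightarrow> bool"
  where "strongly_measurable T f \<longleftrightarrow>
    (\<exists>s. (\<forall>i. simple_function (time_measure T) (s i)) \<and>
         (AE t in time_measure T. (\<lambda>i. s i t) \<longlonglongrightarrow> f t))"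

definition Linf :: "real \<Rightarrow> (real \<Rightarrow> 'a::real_normed_vector) set"
  where "Linf T = {f. strongly_measurable T f \<and> (\<exists>M. AE t in time_measure T. norm (f t) \<le> M)}"

definition Linf_norm :: "real \<Rightarrow> (real \<Rightarrow> 'a::real_normed_vector) \<Rightarrow> real"
  where "Linf_norm T f = real_of_ereal (esssup (time_measure T) (\<lambda>t. ereal (norm (f t))))"

definition L2_norm :: "real \<Rightarrow> (real \<Rightarrow> 'a::real_normed_vector) \<Rightarrow> real"
  where "L2_norm T f = sqrt (LINT t|time_measure T. (norm (f t))\<^sup>2)"

definition Linf_locally_lipschitz ::
  "real \<Rightarrow> ((real \<Rightarrow> 'a::real_normed_vector) \<Rightarrow> (real \<Rightarrow> 'b::real_normed_vector)) \<Rightarrow> bool"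
  where "Linf_locally_lipschitz T \<Phi> \<longleftrightarrow>
    (\<forall>v\<in>Linf T. \<Phi> v \<in> Linf T) \<and>
    (\<forall>u\<in>Linf T. \<exists>r>0. \<exists>L. \<forall>v\<in>Linf T. \<forall>w\<in>Linf T.
        Linf_norm T (\<lambda>t. v t - u t) < r \<longrightarrow> Linf_norm T (\<lambda>t. w t - u t) < r \<longrightarrow>
        Linf_norm T (\<lambda>t. \<Phi> v t - \<Phi> w t) \<le> L * Linf_norm T (\<lambda>t. v t - w t))"

text \<open>\<open>g\<close> is the gradient, for the scalar product of \<open>L\<^sup>2(0,T;E)\<close>, of the functional \<open>J\<close> on
  \<open>L\<^sup>\<infinity>(0,T;E)\<close> at \<open>v\<close>; differentiability is in the sense of Frechet.\<close>

definition has_control_gradient ::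
  "real \<Rightarrow> ((real \<Rightarrow> 'e::real_inner) \<Rightarrow> real) \<Rightarrow> (real \<Rightarrow> 'e) \<Rightarrow> (real \<Rightarrow> 'e) \<Rightarrow> bool"
  where "has_control_gradient T J v g \<longleftrightarrow>
    (\<forall>\<epsilon>>0. \<exists>\<delta>>0. \<forall>h\<in>Linf T. Linf_norm T h < \<delta> \<longrightarrow>
       \<bar>J (\<lambda>t. v t + h t) - J v - (LINT t|time_measure T. g t \<bullet> h t)\<bar> \<le> \<epsilon> * Linf_norm T h)"


section \<open>State and adjoint equations\<close>

definition absolutely_continuous_on :: "real set \<Rightarrow> (real \<Rightarrow> 'a::real_normed_vector) \<Rightarrow> bool"
  where "absolutely_continuous_on I f \<longleftrightarrow>
    (\<forall>\<epsilon>>0. \<exists>\<delta>>0. \<forall>d S. d division_of S \<and> S \<subseteq> I \<and> (\<Sum>K\<in>d. Sup K - Inf K) < \<delta> \<longrightarrow>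
       (\<Sum>K\<in>d. norm (f (Sup K) - f (Inf K))) < \<epsilon>)"

text \<open>Throughout, \<open>\<A> t X Y v\<close> and \<open>\<B> t Y v\<close> are the values of the pairings
  \<open>\<langle>Y, A(t,v) X\<rangle>\<close> and \<open>\<langle>Y, B(t,v)\<rangle>\<close> in \<open>V\<close>. Solutions are absolutely continuous curves in \<open>V\<close>
  satisfying the equation almost everywhere; since \<open>A(t,v) X(t)\<close>, \<open>B(t,v)\<close> are only given through
  their pairings, the equation is an identity of pairings with every element \<open>Z\<close> of \<open>V\<close>.\<close>

definition state_solution ::
  "real \<Rightarrow> (real \<Rightarrow> 'v \<Rightarrow> 'v \<Rightarrow> 'e \<Rightarrow> real) \<Rightarrow> (real \<Rightarrow> 'v \<Rightarrow> 'e \<Rightarrow> real) \<Rightarrow>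
   'v::real_inner \<Rightarrow> (real \<Rightarrow> 'e) \<Rightarrow> (real \<Rightarrow> 'v) \<Rightarrow> bool"
  where "state_solution T \<A> \<B> X0 v X \<longleftrightarrow>
    absolutely_continuous_on {0..T} X \<and> X 0 = X0 \<and>
    (AE t in time_measure T. \<exists>X'. (X has_vector_derivative X') (at t within {0..T}) \<and>
       (\<forall>Z. Z \<bullet> X' + \<A> t (X t) Z (v t) = \<B> t Z (v t)))"

text \<open>In the adjoint equation \<open>\<langle>Z, A\<^sup>*(t,v) Y\<rangle> = \<langle>Y, A(t,v) Z\<rangle>\<close>.\<close>

definition adjoint_solution ::
  "real \<Rightarrow> (real \<Rightarrow> 'v \<Rightarrow> 'v \<Rightarrow> 'e \<Rightarrow> real) \<Rightarrow> (real \<Rightarrow> 'e \<Rightarrow> 'v \<Rightarrow> real) \<Rightarrow> ('v \<Rightarrow> real) \<Rightarrow>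
   (real \<Rightarrow> 'e) \<Rightarrow> (real \<Rightarrow> 'v::real_inner) \<Rightarrow> (real \<Rightarrow> 'v) \<Rightarrow> bool"
  where "adjoint_solution T \<A> F G v X Y \<longleftrightarrow>
    absolutely_continuous_on {0..T} Y \<and> Y T = gradient G (X T) \<and>
    (AE t in time_measure T. \<exists>Y'. (Y has_vector_derivative Y') (at t within {0..T}) \<and>
       (\<forall>Z. Z \<bullet> Y' - \<A> t Z (Y t) (v t) + Z \<bullet> gradient (\<lambda>x. F t (v t) x) (X t) = 0))"

text \<open>The argument \<open>X\<close> of the cost is the solution operator, mapping a control to its state.\<close>

definition cost ::
  "real \<Rightarrow> (real \<Rightarrow> 'e \<Rightarrow> 'v \<Rightarrow> real) \<Rightarrow> ('v \<Rightarrow> real) \<Rightarrow>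
   ((real \<Rightarrow> 'e) \<Rightarrow> (real \<Rightarrow> 'v)) \<Rightarrow> (real \<Rightarrow> 'e) \<Rightarrow> real"
  where "cost T F G X v = (LINT t|time_measure T. F t (v t) (X v t)) + G (X v T)"


section \<open>The monotonic algorithm\<close>

definition Delta ::
  "(real \<Rightarrow> 'v \<Rightarrow> 'v \<Rightarrow> 'e::{real_inner, complete_space} \<Rightarrow> real) \<Rightarrow> (real \<Rightarrow> 'v \<Rightarrow> 'e \<Rightarrow> real) \<Rightarrow>
   (real \<Rightarrow> 'e \<Rightarrow> 'v \<Rightarrow> real) \<Rightarrow> 'e \<Rightarrow> 'e \<Rightarrow> real \<Rightarrow> 'v \<Rightarrow> 'v \<Rightarrow> 'e"
  where "Delta \<A> \<B> F v' v t X Y =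
    integral {0..1} (\<lambda>l. - gradient (\<lambda>w. \<A> t X Y w - \<B> t Y w) (v + l *\<^sub>R (v' - v))
                         + gradient (\<lambda>w. F t w X) (v + l *\<^sub>R (v' - v)))"

text \<open>\<open>is_update \<A> \<B> F \<theta> t v X Y v'\<close> says that \<open>\<V>\<^sub>\<theta>(t,v,X,Y)\<close> is defined and equal to \<open>v'\<close>.\<close>

definition is_update ::
  "(real \<Rightarrow> 'v \<Rightarrow> 'v \<Rightarrow> 'e::{real_inner, complete_space} \<Rightarrow> real) \<Rightarrow> (real \<Rightarrow> 'v \<Rightarrow> 'e \<Rightarrow> real) \<Rightarrow>
   (real \<Rightarrow> 'e \<Rightarrow> 'v \<Rightarrow> real) \<Rightarrow> real \<Rightarrow> real \<Rightarrow> 'e \<Rightarrow> 'v \<Rightarrow> 'v \<Rightarrow> 'e \<Rightarrow> bool"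
  where "is_update \<A> \<B> F \<theta> t v X Y v' \<longleftrightarrow>
    (\<exists>!u. Delta \<A> \<B> F u v t X Y = - (\<theta> *\<^sub>R (u - v))) \<and>
    v' = (THE u. Delta \<A> \<B> F u v t X Y = - (\<theta> *\<^sub>R (u - v)))"

definition algorithm_run ::
  "real \<Rightarrow> (real \<Rightarrow> 'v \<Rightarrow> 'v \<Rightarrow> 'e::{real_inner, complete_space} \<Rightarrow> real) \<Rightarrow>
   (real \<Rightarrow> 'v \<Rightarrow> 'e \<Rightarrow> real) \<Rightarrow> (real \<Rightarrow> 'e \<Rightarrow> 'v \<Rightarrow> real) \<Rightarrow>
   ((real \<Rightarrow> 'e) \<Rightarrow> (real \<Rightarrow> 'v)) \<Rightarrow> ((real \<Rightarrow> 'e) \<Rightarrow> (real \<Rightarrow> 'v)) \<Rightarrow>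
   (nat \<Rightarrow> real) \<Rightarrow> (real \<Rightarrow> 'e) \<Rightarrow> (nat \<Rightarrow> real \<Rightarrow> 'e) \<Rightarrow> bool"
  where "algorithm_run T \<A> \<B> F X Y \<theta> v0 v \<longleftrightarrow>
    v 0 = v0 \<and> (\<forall>k. v k \<in> Linf T) \<and>
    (\<forall>k. AE t in time_measure T.
       is_update \<A> \<B> F (\<theta> k) t (v k t) (X (v (Suc k)) t) (Y (v k) t) (v (Suc k) t))"

end

theory Submission
  imports Defs
begin

text \<open>
  The proof rests on one inequality. Write \<open>h(t,x,y,w) = F(t,w,x) - \<langle>y, A(t,w) x\<rangle> + \<langle>y, B(t,w)\<rangle>\<close> for the
  Hamiltonian. For any two controls \<open>v\<close> and \<open>v'\<close>, testing the two state equations against \<open>Y\<^sub>v\<close> and the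
  adjoint equation against \<open>X\<^sub>v\<^sub>' - X\<^sub>v\<close> computes the derivative of \<open>\<langle>Y\<^sub>v, X\<^sub>v\<^sub>' - X\<^sub>v\<rangle>\<close>. This function
  vanishes at \<open>0\<close>, and at \<open>T\<close> it dominates \<open>G(X\<^sub>v\<^sub>'(T)) - G(X\<^sub>v(T))\<close> because \<open>G\<close> is concave. In its
  derivative the term \<open>-\<langle>\<nabla>\<^sub>X F(t,v,X\<^sub>v), X\<^sub>v\<^sub>' - X\<^sub>v\<rangle>\<close> absorbs the variation of \<open>F\<close> in the state, because
  \<open>F\<close> is concave in the state. What is left is the variation of \<open>h\<close> in the control at the mixed point
  \<open>(X\<^sub>v\<^sub>', Y\<^sub>v)\<close>, and this is \<open>\<langle>v' - v, \<Delta>(v',v;t,X\<^sub>v\<^sub>',Y\<^sub>v)\<rangle>\<close> since \<open>\<Delta>\<close> is the average of \<open>\<nabla>\<^sub>w h\<close> on the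
  segment from \<open>v\<close> to \<open>v'\<close>. Hence \<open>J(v') - J(v) \<le> \<integral> \<langle>v' - v, \<Delta>(v',v;t,X\<^sub>v\<^sub>',Y\<^sub>v)\<rangle> dt\<close>, which is
  \<open>cost_difference_le\<close>.

  If \<open>v'\<close> is an update of \<open>v\<close> then \<open>\<Delta> = -\<theta> (v' - v)\<close>, and the inequality becomes the announced decrease,
  for every \<open>\<theta>\<close> (\<open>update_decreases_cost\<close>).

  An update is a fixed point of \<open>u \<mapsto> v - \<Delta>(u,v;t,X\<^sub>u,Y\<^sub>v)/\<theta>\<close>. On bounded sets \<open>\<Delta>\<close> is bounded and
  Lipschitz, and \<open>u \<mapsto> X\<^sub>u\<close> is Lipschitz near \<open>v\<close>; for large \<open>\<theta>\<close> this map is therefore a contraction of a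
  small ball of \<open>L\<^sup>\<infinity>\<close> around \<open>v\<close>. State and update are obtained together, as the evolution system of the
  statement demands. The second derivatives in the control are bounded
  uniformly in the control, so \<open>\<Delta>\<close> is globally Lipschitz in \<open>u\<close> at fixed \<open>x\<close>, \<open>y\<close>; this makes the solution
  of the pointwise equation unique (\<open>exists_update\<close>). The algorithm is then run by choosing the \<open>\<theta>\<^sub>k\<close> along
  the iteration (\<open>exists_run\<close>).

  If the algorithm stops at \<open>v\<close>, then \<open>\<Delta>(v,v;t,X\<^sub>v,Y\<^sub>v) = \<nabla>\<^sub>w h(t,X\<^sub>v,Y\<^sub>v,v) = 0\<close>. The inequality for the
  pair \<open>(v, v + k)\<close> bounds \<open>J(v + k) - J(v)\<close> from above by \<open>O(\<parallel>k\<parallel>\<^sup>2)\<close>, and for the pair \<open>(v + k, v)\<close> it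
  gives the same bound from below, since \<open>\<Delta>\<close> is Lipschitz and \<open>X\<close>, \<open>Y\<close> are locally Lipschitz. So the
  gradient of \<open>J\<close> vanishes at \<open>v\<close> (\<open>stationary_is_critical\<close>).

  The analytic preparations are the Riesz representation theorem, which provides gradients; the
  fundamental theorem of calculus for absolutely continuous functions, which integrates the derivative
  of \<open>\<langle>Y\<^sub>v, X\<^sub>v\<^sub>' - X\<^sub>v\<rangle>\<close>; a characterization of strong measurability by separable range and measurable
  distances, from which limits and superpositions of strongly measurable functions are controlled; and
  the continuity in time of \<open>\<nabla>\<^sub>w F\<close>, which supplies both its measurability and its boundedness.
\<close>

section \<open>Gradients in a Hilbert space\<close>

text \<open>The functional \<open>\<parallel>x\<parallel>\<^sup>2 - 2 f x\<close> is bounded below. By the parallelogram identity its minimizing sequences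
  are Cauchy, and the first order condition at the minimizer \<open>g\<close> reads \<open>f h = g \<bullet> h\<close>.\<close>

lemma riesz_representation:
  fixes f :: "'a::{real_inner, complete_space} \<Rightarrow> real"
  assumes "bounded_linear f"
  shows "\<exists>g. \<forall>x. f x = g \<bullet> x"
proof -
  interpret bounded_linear f by fact
  obtain K where K: "\<And>x. \<bar>f x\<bar> \<le> norm x * K" using bounded by auto
  define q where "q x = (norm x)\<^sup>2 - 2 * f x" for x
  have low: "- K\<^sup>2 \<le> q x" for x
  proof -
    have "0 \<le> (norm x - K)\<^sup>2" by simp
    then show ?thesis using K[of x] unfolding q_def by (simp add: power2_diff)
  qed
  define m where "m = Inf (range q)"
  have bb: "bdd_below (range q)" using low by (auto intro!: bdd_belowI)
  have m: "m \<le> q x" for x unfolding m_def by (rule cInf_lower[OF _ bb]) auto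
  have "\<exists>x. q x < m + inverse (real (Suc n))" for n
    using cInf_lessD[of "range q" "m + inverse (real (Suc n))"] by (auto simp: m_def)
  then obtain x where x: "\<And>n. q (x n) < m + inverse (real (Suc n))" by metis
  have par: "(norm (a - b))\<^sup>2 \<le> 2 * q a + 2 * q b - 4 * m" for a b
  proof -
    have "q ((1/2) *\<^sub>R (a + b)) = (norm (a + b))\<^sup>2 / 4 - (f a + f b)"
      unfolding q_def scaleR add norm_scaleR by (simp add: field_simps power2_eq_square)
    moreover have "(norm (a + b))\<^sup>2 + (norm (a - b))\<^sup>2 = 2 * (norm a)\<^sup>2 + 2 * (norm b)\<^sup>2"
      by (simp add: power2_norm_eq_inner algebra_simps inner_commute)
    ultimately show ?thesis using m[of "(1/2) *\<^sub>R (a + b)"] by (simp add: q_def)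
  qed
  have "Cauchy x"
  proof (rule metric_CauchyI)
    fix e :: real assume e: "e > 0"
    obtain N where N: "inverse (real (Suc N)) < e\<^sup>2 / 4" using reals_Archimedean[of "e\<^sup>2/4"] e by auto
    have "dist (x i) (x j) < e" if "i \<ge> N" "j \<ge> N" for i j
    proof -
      have "inverse (real (Suc i)) \<le> inverse (real (Suc N))" "inverse (real (Suc j)) \<le> inverse (real (Suc N))"
        using that by (auto intro!: le_imp_inverse_le)
      then have "(norm (x i - x j))\<^sup>2 < e\<^sup>2"
        using par[of "x i" "x j"] x[of i] x[of j] N by argo
      then show ?thesis using e by (simp add: dist_norm power_less_imp_less_base)
    qed
    then show "\<exists>N. \<forall>i\<ge>N. \<forall>j\<ge>N. dist (x i) (x j) < e" by blast
  qed
  then obtain g where g: "x \<longlonglongrightarrow> g" using Cauchy_convergent_iff convergent_def by blast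
  have "(\<lambda>n. q (x n)) \<longlonglongrightarrow> q g" unfolding q_def by (intro tendsto_intros g tendsto)
  moreover have "(\<lambda>n. m + inverse (real (Suc n))) \<longlonglongrightarrow> m"
    using tendsto_add[OF tendsto_const LIMSEQ_inverse_real_of_nat, of m] by simp
  ultimately have "q g \<le> m" by (rule LIMSEQ_le) (use x less_imp_le in blast)
  have "f h = g \<bullet> h" for h
  proof -
    have nn: "0 \<le> 2 * s * (g \<bullet> h - f h) + s\<^sup>2 * (norm h)\<^sup>2" for s
    proof -
      have "q (g + s *\<^sub>R h) = q g + 2 * s * (g \<bullet> h - f h) + s\<^sup>2 * (norm h)\<^sup>2"
        unfolding q_def power2_norm_eq_inner add scaleR
        by (simp add: algebra_simps inner_commute power2_eq_square)
      then show ?thesis using m[of "g + s *\<^sub>R h"] \<open>q g \<le> m\<close> by simp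
    qed
    show ?thesis
    proof (rule ccontr)
      assume ne: "f h \<noteq> g \<bullet> h"
      define d where "d = g \<bullet> h - f h"
      define w where "w = (norm h)\<^sup>2 + 1"
      define s where "s = - d / w"
      have w: "w > 0" by (simp add: w_def add_nonneg_pos)
      have "2 * s * d + s\<^sup>2 * (norm h)\<^sup>2 \<le> 2 * s * d + s\<^sup>2 * w"
        by (simp add: w_def mult_left_mono)
      also have "s\<^sup>2 * w = - s * d"
        using w by (simp add: s_def power2_eq_square)
      also have "2 * s * d + - s * d = s * d" by simp
      also have "s * d = - (d\<^sup>2 / w)" by (simp add: s_def power2_eq_square)
      also have "\<dots> < 0" using w ne by (simp add: d_def)
      finally show False using nn[of s] by (simp add: d_def)
    qed
  qed
  then show ?thesis by blast
qed

text \<open>Makes the definite description in \<^const>\<open>gradient\<close> usable; \<open>gderiv_gradient\<close> complements it with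
  existence, which is the Riesz representation of the derivative.\<close>

lemma gradient_eqI: "GDERIV f x :> g \<Longrightarrow> gradient f x = g"
  unfolding gradient_def
proof (rule the_equality)
  fix h assume "GDERIV f x :> g" "GDERIV f x :> h"
  then have "(\<lambda>y. y \<bullet> g) = (\<lambda>y. y \<bullet> h)"
    unfolding gderiv_def by (rule has_derivative_unique)
  then have "(h - g) \<bullet> g = (h - g) \<bullet> h" by metis
  then have "(h - g) \<bullet> (h - g) = 0" by (simp add: inner_diff_right)
  then show "h = g" by simp
qed

lemma gderiv_gradient:
  fixes f :: "'a::{real_inner, complete_space} \<Rightarrow> real"
  assumes "f differentiable (at x)"
  shows "GDERIV f x :> gradient f x"
proof -
  obtain f' where f': "(f has_derivative f') (at x)" using assms differentiable_def by blast
  obtain g where "f' = (\<lambda>h. h \<bullet> g)"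
    using riesz_representation[OF has_derivative_bounded_linear[OF f']] by (auto simp: inner_commute)
  then have "GDERIV f x :> g" using f' by (simp add: gderiv_def)
  then show ?thesis using gradient_eqI by metis
qed

lemma GDERIV_cmult: "GDERIV f x :> d \<Longrightarrow> GDERIV (\<lambda>w. c * f w) x :> c *\<^sub>R d"
  using GDERIV_mult[OF GDERIV_const[of c]] by simp

lemma has_derivative_fderiv:
  assumes "f differentiable (at x)"
  shows "(f has_derivative blinfun_apply (fderiv f x)) (at x)"
  using assms unfolding fderiv_def
  by (metis bounded_linear_Blinfun_apply frechet_derivative_works has_derivative_bounded_linear)

lemma inner_gradient_eq_fderiv:
  fixes f :: "'a::{real_inner, complete_space} \<Rightarrow> real"
  assumes "f differentiable (at x)"
  shows "h \<bullet> gradient f x = blinfun_apply (fderiv f x) h"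
  using has_derivative_unique[OF gderiv_gradient[OF assms, unfolded gderiv_def] has_derivative_fderiv[OF assms]]
  by metis

text \<open>Norm bounds of vectors given only through their inner products are obtained by testing the vector
  against itself.\<close>

lemma norm_le_if_inner_le:
  fixes g :: "'a::real_inner"
  assumes "g \<bullet> g \<le> c * norm g" "0 \<le> c"
  shows "norm g \<le> c"
  using assms by (cases "g = 0") (auto simp: power2_norm_eq_inner[symmetric] power2_eq_square)

lemma norm_gradient_le_fderiv:
  fixes f :: "'a::{real_inner, complete_space} \<Rightarrow> real"
  assumes "f differentiable (at x)"
  shows "norm (gradient f x) \<le> norm (fderiv f x)"
  using norm_blinfun[of "fderiv f x" "gradient f x"]
  by (intro norm_le_if_inner_le) (auto simp: inner_gradient_eq_fderiv[OF assms])

lemma norm_gradient_diff_le_fderiv: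
  fixes f :: "'a::{real_inner, complete_space} \<Rightarrow> real"
  assumes "f differentiable (at x)" "f differentiable (at y)"
  shows "norm (gradient f x - gradient f y) \<le> norm (fderiv f x - fderiv f y)"
proof (rule norm_le_if_inner_le)
  let ?g = "gradient f x - gradient f y"
  have "?g \<bullet> ?g = blinfun_apply (fderiv f x - fderiv f y) ?g"
    by (simp add: inner_diff_right inner_gradient_eq_fderiv assms blinfun.diff_left)
  then show "?g \<bullet> ?g \<le> norm (fderiv f x - fderiv f y) * norm ?g"
    using norm_blinfun[of "fderiv f x - fderiv f y" ?g] by simp
qed simp

lemma class_C1_lipschitz:
  assumes "class_C1 f" "convex S" "\<And>x. x \<in> S \<Longrightarrow> norm (fderiv f x) \<le> M" "x \<in> S" "y \<in> S"
  shows "norm (f x - f y) \<le> M * norm (x - y)"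
proof (rule differentiable_bound[OF \<open>convex S\<close> _ _ assms(4,5)])
  show "(f has_derivative blinfun_apply (fderiv f z)) (at z within S)" for z
    using assms(1) has_derivative_fderiv has_derivative_at_withinI unfolding class_C1_def by blast
  show "onorm (blinfun_apply (fderiv f z)) \<le> M" if "z \<in> S" for z
    using assms(3)[OF that] by (simp add: norm_blinfun.rep_eq)
qed

text \<open>The Riesz isomorphism is isometric, so the second Frechet derivative of \<open>f\<close> bounds the Lipschitz
  constant of the gradient as well.\<close>

lemma gradient_lipschitz:
  fixes f :: "'a::{real_inner, complete_space} \<Rightarrow> real"
  assumes "class_C2 f" "\<And>x. norm (fderiv (fderiv f) x) \<le> M"
  shows "norm (gradient f x - gradient f y) \<le> M * norm (x - y)"
proof -
  have "norm (gradient f x - gradient f y) \<le> norm (fderiv f x - fderiv f y)"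
    using assms(1) by (intro norm_gradient_diff_le_fderiv) (auto simp: class_C2_def class_C1_def)
  also have "\<dots> \<le> M * norm (x - y)"
    using assms by (intro class_C1_lipschitz[where S=UNIV]) (auto simp: class_C2_def)
  finally show ?thesis .
qed

lemma differentiable_partial:
  fixes F :: "real \<Rightarrow> 'e::real_normed_vector \<Rightarrow> 'v::real_normed_vector \<Rightarrow> real"
  assumes "(\<lambda>(t, v, x). F t v x) differentiable (at (t, v, x))"
  shows "(\<lambda>(s, w). F s w x) differentiable (at (t, v))"
proof -
  obtain D where D: "((\<lambda>(t, v, x). F t v x) has_derivative D) (at (t, v, x))"
    using assms differentiable_def by blast
  have p: "((\<lambda>p. (fst p, snd p, x)) has_derivative (\<lambda>p. (fst p, snd p, 0))) (at (t, v))"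
    by (auto intro!: derivative_eq_intros)
  have "((\<lambda>p. F (fst p) (snd p) x) has_derivative (\<lambda>p. D (fst p, snd p, 0))) (at (t, v))"
    using has_derivative_compose[OF p, of "\<lambda>(t, v, x). F t v x" D] D by simp
  then show ?thesis unfolding split_def differentiable_def by blast
qed

section \<open>Integrals of continuous Hilbert space valued functions\<close>

text \<open>The weak integral exists by the Riesz representation theorem. Testing the error of a fine Riemann sum
  against itself reduces its norm to scalar integrals, so the weak integral is also the strong one. The
  sort \<open>{real_inner, complete_space}\<close> is not contained in \<^class>\<open>banach\<close>, hence the scalar detour.\<close>

lemma integrable_continuous_hilbert:
  fixes f :: "real \<Rightarrow> 'a::{real_inner, complete_space}"
  assumes f: "continuous_on {a..b} f"
  shows "f integrable_on {a..b}"
proof -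
  have int: "(\<lambda>x. f x \<bullet> h) integrable_on {a..b}" for h
    by (intro integrable_continuous_interval continuous_intros f)
  define L where "L h = integral {a..b} (\<lambda>x. f x \<bullet> h)" for h
  obtain B where B: "\<And>x. x \<in> {a..b} \<Longrightarrow> norm (f x) \<le> B"
    using compact_imp_bounded[OF compact_continuous_image[OF f compact_Icc]]
    unfolding bounded_iff by (metis imageI)
  have "bounded_linear L"
  proof (rule bounded_linear_intro[where K="B * measure lborel (cbox a b)"])
    show "L (x + y) = L x + L y" for x y
      unfolding L_def by (simp add: inner_add_right integral_add int)
    show "L (r *\<^sub>R x) = r *\<^sub>R L x" for r x
      unfolding L_def by simp
    show "norm (L h) \<le> norm h * (B * measure lborel (cbox a b))" for h
    proof (cases "a \<le> b")
      case True
      then have "0 \<le> B" using order_trans[OF norm_ge_zero B[of a]] by simp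
      have "norm (L h) \<le> (B * norm h) * measure lborel (cbox a b)" unfolding L_def
      proof (rule has_integral_bound[where f="\<lambda>x. f x \<bullet> h"])
        show "((\<lambda>x. f x \<bullet> h) has_integral integral {a..b} (\<lambda>x. f x \<bullet> h)) (cbox a b)"
          using integrable_integral[OF int] by simp
        show "norm (f x \<bullet> h) \<le> B * norm h" if "x \<in> cbox a b" for x
          using Cauchy_Schwarz_ineq2[of "f x" h] B[of x] that
          by (simp) (meson mult_right_mono norm_ge_zero order_trans)
      qed (use \<open>0 \<le> B\<close> in auto)
      then show ?thesis by (simp add: mult_ac)
    qed (auto simp: L_def)
  qed
  then obtain g where g: "\<And>h. L h = g \<bullet> h" using riesz_representation by blast
  have "(f has_integral g) (cbox a b)"
    unfolding has_integral
  proof (intro allI impI)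
    fix e :: real assume e: "e > 0"
    \<comment> \<open>Scaled so that the total error over the interval stays below \<open>e\<close>, also for an interval of length \<open>0\<close>.\<close>
    define e' where "e' = e / (2 * (measure lborel (cbox a b) + 1))"
    define c where "c = measure lborel (cbox a b)"
    have c: "0 \<le> c" by (simp add: c_def)
    have e': "e' > 0" "e' * measure lborel (cbox a b) < e"
      unfolding e'_def c_def[symmetric] using c e by (auto simp: divide_simps distrib_left) (smt (verit, best) mult_nonneg_nonneg)
    obtain d where d: "d > 0" "\<And>x y. x \<in> {a..b} \<Longrightarrow> y \<in> {a..b} \<Longrightarrow> dist x y < d \<Longrightarrow> dist (f x) (f y) < e'"
      using compact_uniformly_continuous[OF f compact_Icc] e'(1) unfolding uniformly_continuous_on_def by metis
    have "norm ((\<Sum>(x, k)\<in>p. measure lborel k *\<^sub>R f x) - g) < e"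
      if p: "p tagged_division_of cbox a b" and fine: "(\<lambda>x. ball x d) fine p" for p
    proof -
      define s where "s = (\<Sum>(x, k)\<in>p. measure lborel k *\<^sub>R f x) - g"
      have Ls: "g \<bullet> s = (\<Sum>(x, k)\<in>p. integral k (\<lambda>y. f y \<bullet> s))"
        using integral_combine_tagged_division_topdown[OF _ p, of "\<lambda>y. f y \<bullet> s"] int[of s] g[of s]
        by (simp add: L_def)
      have "s \<bullet> s = (\<Sum>(x, k)\<in>p. measure lborel k *\<^sub>R (f x \<bullet> s) - integral k (\<lambda>y. f y \<bullet> s))"
        unfolding split_def sum_subtractf using Ls
        by (subst (1) s_def) (simp add: inner_diff_left inner_sum_left split_def)
      also have "\<dots> \<le> (\<Sum>(x, k)\<in>p. (e' * norm s) * measure lborel k)"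
      proof (rule sum_mono, unfold split_paired_all prod.case)
        fix x k assume xk: "(x, k) \<in> p"
        obtain u v where k: "k = cbox u v" using p xk by blast
        have sub: "k \<subseteq> cbox a b" "x \<in> k" "k \<subseteq> ball x d"
          using p xk fine by (auto simp: fine_def)
        have i1: "(\<lambda>y. f y \<bullet> s) integrable_on cbox u v"
          using integrable_subinterval_real[OF int[of s], of u v] sub k by auto
        have "((\<lambda>y. f x \<bullet> s - f y \<bullet> s) has_integral measure lborel k *\<^sub>R (f x \<bullet> s) - integral k (\<lambda>y. f y \<bullet> s)) (cbox u v)"
          using has_integral_diff[OF has_integral_const[of "f x \<bullet> s" u v] integrable_integral[OF i1]]
          unfolding k .
        then have "norm (measure lborel k *\<^sub>R (f x \<bullet> s) - integral k (\<lambda>y. f y \<bullet> s)) \<le> (e' * norm s) * measure lborel (cbox u v)"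
        proof (rule has_integral_bound[rotated])
          fix y assume y: "y \<in> cbox u v"
          have "norm (f x - f y) \<le> e'"
            using d(2)[of x y] y sub k
            by (auto simp: dist_norm subset_iff intro!: less_imp_le)
          then show "norm (f x \<bullet> s - f y \<bullet> s) \<le> e' * norm s"
            unfolding inner_diff_left[symmetric] real_norm_def
            using Cauchy_Schwarz_ineq2[of "f x - f y" s] by (meson mult_right_mono norm_ge_zero order_trans)
        qed (use e' in simp)
        then show "measure lborel k *\<^sub>R (f x \<bullet> s) - integral k (\<lambda>y. f y \<bullet> s) \<le> (e' * norm s) * measure lborel k"
          using k by simp
      qed
      also have "\<dots> = (e' * measure lborel (cbox a b)) * norm s"
        unfolding additive_content_tagged_division[OF p, symmetric]
        by (simp add: sum_distrib_left sum_distrib_right split_def mult_ac)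
      finally have "norm s \<le> e' * measure lborel (cbox a b)"
        by (rule norm_le_if_inner_le) (use e' in simp)
      then show ?thesis using e' by (simp add: s_def)
    qed
    then show "\<exists>\<gamma>. gauge \<gamma> \<and> (\<forall>\<D>. \<D> tagged_division_of cbox a b \<and> \<gamma> fine \<D> \<longrightarrow>
        norm ((\<Sum>(x, k)\<in>\<D>. measure lborel k *\<^sub>R f x) - g) < e)"
      using d(1) by (intro exI[of _ "\<lambda>x. ball x d"]) auto
  qed
  then show ?thesis by (auto simp: integrable_on_def)
qed

text \<open>Proved for the partial sums up to \<open>k/n\<close>, by induction on \<open>k\<close>. It is the scalar case of
  \<open>riemann_sums_tendsto\<close>, whose purpose is to present \<open>\<Delta>\<close> as a pointwise limit of finite sums of strongly
  measurable functions.\<close>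

lemma riemann_sum_error_real:
  fixes h :: "real \<Rightarrow> real"
  assumes h: "continuous_on {0..1} h" and n: "n > 0"
    and e: "\<And>x y. x \<in> {0..1} \<Longrightarrow> y \<in> {0..1} \<Longrightarrow> \<bar>x - y\<bar> \<le> 1 / real n \<Longrightarrow> \<bar>h x - h y\<bar> \<le> e"
  shows "\<bar>(\<Sum>i<n. (1 / real n) * h (real i / real n)) - integral {0..1} h\<bar> \<le> e"
proof -
  have int: "h integrable_on {a..b}" if "0 \<le> a" "b \<le> 1" for a b
    by (rule integrable_continuous_interval[OF continuous_on_subset[OF h]]) (use that in auto)
  have "\<bar>(\<Sum>i<k. (1 / real n) * h (real i / real n)) - integral {0..real k / real n} h\<bar> \<le> e * (real k / real n)"
    if "k \<le> n" for k
    using that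
  proof (induction k)
    case (Suc k)
    let ?a = "real k / real n" and ?b = "real (Suc k) / real n"
    have ab: "0 \<le> ?a" "?a \<le> ?b" "?b \<le> 1" "?b - ?a = 1 / real n"
      using Suc.prems n by (auto simp: divide_simps)
    have split: "integral {0..?b} h = integral {0..?a} h + integral {?a..?b} h"
      by (rule Henstock_Kurzweil_Integration.integral_combine[symmetric]) (use ab int[of 0 ?b] in auto)
    have "\<bar>(1 / real n) * h ?a - integral {?a..?b} h\<bar> \<le> e * (?b - ?a)"
    proof -
      have "((\<lambda>y. h ?a - h y) has_integral (?b - ?a) *\<^sub>R h ?a - integral {?a..?b} h) {?a..?b}"
        by (intro has_integral_diff has_integral_const_real[THEN has_integral_eq_rhs] integrable_integral int)
          (use ab in auto)
      moreover have "norm (h ?a - h y) \<le> e" if "y \<in> {?a..?b}" for y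
      proof -
        have y: "?a \<le> y" "y \<le> ?b" using that by simp_all
        have "?a \<in> {0..1}" "y \<in> {0..1}" "\<bar>?a - y\<bar> \<le> 1 / real n"
          unfolding atLeastAtMost_iff using y ab by linarith+
        then show ?thesis unfolding real_norm_def by (rule e)
      qed
      moreover have "0 \<le> e" using e[of 0 0] by simp
      ultimately have "norm ((?b - ?a) *\<^sub>R h ?a - integral {?a..?b} h) \<le> e * measure lborel {?a..?b}"
        by (intro has_integral_bound_real[where f="\<lambda>y. h ?a - h y"]) auto
      then show ?thesis unfolding content_real[OF ab(2)] ab(4) by simp
    qed
    then have "\<bar>(\<Sum>i<Suc k. (1 / real n) * h (real i / real n)) - integral {0..?b} h\<bar> \<le> e * ?a + e * (?b - ?a)"
      using Suc unfolding split by simp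
    then show ?case by (simp add: algebra_simps)
  qed simp
  from this[of n] show ?thesis using n by simp
qed

lemma riemann_sums_tendsto:
  fixes f :: "real \<Rightarrow> 'a::{real_inner, complete_space}"
  assumes f: "continuous_on {0..1} f"
  shows "(\<lambda>n. \<Sum>i<Suc n. (1 / real (Suc n)) *\<^sub>R f (real i / real (Suc n))) \<longlonglongrightarrow> integral {0..1} f"
proof (rule metric_LIMSEQ_I)
  fix e :: real assume e: "e > 0"
  obtain d where d: "d > 0" "\<And>x y. x \<in> {0..1} \<Longrightarrow> y \<in> {0..1} \<Longrightarrow> dist x y < d \<Longrightarrow> dist (f x) (f y) < e / 2"
    using compact_uniformly_continuous[OF f compact_Icc] half_gt_zero[OF e]
    unfolding uniformly_continuous_on_def by metis
  obtain N where N: "inverse (real (Suc N)) < d" using reals_Archimedean[OF d(1)] by blast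
  have "dist (\<Sum>i<Suc n. (1 / real (Suc n)) *\<^sub>R f (real i / real (Suc n))) (integral {0..1} f) < e" if "n \<ge> N" for n
  proof -
    define s where "s = (\<Sum>i<Suc n. (1 / real (Suc n)) *\<^sub>R f (real i / real (Suc n))) - integral {0..1} f"
    have nd: "1 / real (Suc n) < d"
    proof -
      have "inverse (real (Suc n)) \<le> inverse (real (Suc N))" using that by (intro le_imp_inverse_le) auto
      then show ?thesis using N unfolding inverse_eq_divide by linarith
    qed
    have "integral {0..1} f \<bullet> s = integral {0..1} (\<lambda>l. f l \<bullet> s)"
      using has_integral_linear[OF integrable_integral[OF integrable_continuous_hilbert[OF f]] bounded_linear_inner_left[of s]]
      by (simp add: o_def integral_unique)
    then have "s \<bullet> s = (\<Sum>i<Suc n. (1 / real (Suc n)) * (f (real i / real (Suc n)) \<bullet> s)) - integral {0..1} (\<lambda>l. f l \<bullet> s)"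
      by (subst (1) s_def) (simp add: inner_diff_left inner_sum_left inner_add_left)
    also have "\<bar>\<dots>\<bar> \<le> e / 2 * norm s"
    proof (rule riemann_sum_error_real)
      show "continuous_on {0..1} (\<lambda>l. f l \<bullet> s)" by (intro continuous_intros f)
      fix x y :: real assume xy: "x \<in> {0..1}" "y \<in> {0..1}" "\<bar>x - y\<bar> \<le> 1 / real (Suc n)"
      have "norm (f x - f y) \<le> e / 2" using d(2)[OF xy(1,2)] xy(3) nd by (simp add: dist_norm)
      then show "\<bar>f x \<bullet> s - f y \<bullet> s\<bar> \<le> e / 2 * norm s"
        unfolding inner_diff_left[symmetric]
        using Cauchy_Schwarz_ineq2[of "f x - f y" s] by (meson mult_right_mono norm_ge_zero order_trans)
    qed simp
    finally have "s \<bullet> s \<le> e / 2 * norm s" by simp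
    then have "norm s \<le> e / 2" by (rule norm_le_if_inner_le) (use e in simp)
    then show ?thesis using e by (simp add: dist_norm s_def)
  qed
  then show "\<exists>N. \<forall>n\<ge>N. dist (\<Sum>i<Suc n. (1 / real (Suc n)) *\<^sub>R f (real i / real (Suc n))) (integral {0..1} f) < e"
    by blast
qed

section \<open>Gradients along segments and in dependence on a parameter\<close>

lemma norm_segment_le:
  fixes v v' :: "'a::real_normed_vector"
  assumes "l \<in> {0..1}" "norm v \<le> R" "norm v' \<le> R"
  shows "norm (v + l *\<^sub>R (v' - v)) \<le> R"
proof -
  have "(1 - l) *\<^sub>R v + l *\<^sub>R v' \<in> cball 0 R"
    by (rule convexD_alt[OF convex_cball]) (use assms in auto)
  then show ?thesis by (simp add: algebra_simps)
qed

lemma has_integral_gradient_segment: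
  fixes f :: "'a::{real_inner, complete_space} \<Rightarrow> real"
  assumes "\<And>x. f differentiable (at x)"
  shows "((\<lambda>l. (w - v) \<bullet> gradient f (v + l *\<^sub>R (w - v))) has_integral f w - f v) {0..1}"
proof -
  have "((\<lambda>l. f (v + l *\<^sub>R (w - v))) has_vector_derivative (w - v) \<bullet> gradient f (v + l *\<^sub>R (w - v))) (at l within {0..1})" for l
  proof -
    have 1: "((\<lambda>l. v + l *\<^sub>R (w - v)) has_derivative (\<lambda>l. l *\<^sub>R (w - v))) (at l within {0..1})"
      by (auto intro!: derivative_eq_intros)
    have 2: "(f has_derivative (\<lambda>h. h \<bullet> gradient f (v + l *\<^sub>R (w - v)))) (at (v + l *\<^sub>R (w - v)))"
      using gderiv_gradient[OF assms] by (simp add: gderiv_def)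
    show ?thesis
      using has_derivative_compose[OF 1 2] by (simp add: has_vector_derivative_def)
  qed
  from fundamental_theorem_of_calculus[OF zero_le_one this] show ?thesis by simp
qed

lemma first_order_remainder:
  fixes f :: "'a::{real_inner, complete_space} \<Rightarrow> real"
  assumes f: "\<And>x. f differentiable (at x)" and K: "0 \<le> K"
    and lip: "\<And>x y. norm (gradient f x - gradient f y) \<le> K * norm (x - y)"
  shows "\<bar>f (v + h) - f v - h \<bullet> gradient f v\<bar> \<le> K * (norm h)\<^sup>2"
proof -
  have "((\<lambda>l. h \<bullet> gradient f (v + l *\<^sub>R h) - h \<bullet> gradient f v) has_integral (f (v + h) - f v) - h \<bullet> gradient f v) {0..1}"
    using has_integral_diff[OF has_integral_gradient_segment[OF f, of "v + h" v] has_integral_const_real[of "h \<bullet> gradient f v" 0 1]]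
    by simp
  then have "norm ((f (v + h) - f v) - h \<bullet> gradient f v) \<le> K * (norm h)\<^sup>2 * measure lborel {0..1::real}"
  proof (rule has_integral_bound_real[rotated 2])
    fix l :: real assume "l \<in> {0..1} - {}"
    then have l: "l \<in> {0..1}" by simp
    have "\<bar>h \<bullet> (gradient f (v + l *\<^sub>R h) - gradient f v)\<bar> \<le> norm h * norm (gradient f (v + l *\<^sub>R h) - gradient f v)"
      by (rule Cauchy_Schwarz_ineq2)
    also have "\<dots> \<le> norm h * (K * norm h)"
    proof (rule mult_left_mono)
      have "norm (gradient f (v + l *\<^sub>R h) - gradient f v) \<le> K * norm (l *\<^sub>R h)"
        using lip[of "v + l *\<^sub>R h" v] by simp
      also have "\<dots> \<le> K * norm h" using l K by (intro mult_left_mono) (auto simp: mult_left_le_one_le)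
      finally show "norm (gradient f (v + l *\<^sub>R h) - gradient f v) \<le> K * norm h" .
    qed simp
    finally show "norm (h \<bullet> gradient f (v + l *\<^sub>R h) - h \<bullet> gradient f v) \<le> K * (norm h)\<^sup>2"
      by (simp add: inner_diff_right power2_eq_square mult_ac)
  qed (use K in simp_all)
  then show ?thesis by simp
qed

text \<open>If the gradients of \<open>f s\<close> are \<open>K\<close>-Lipschitz uniformly in \<open>s\<close>, the increment of \<open>f s\<close> over a step \<open>h\<close>
  determines its gradient up to \<open>K \<parallel>h\<parallel>\<close>. Joint differentiability at the one point \<open>(t, v)\<close> compares the
  increments of \<open>f s\<close> and \<open>f t\<close> over steps of the same order as \<open>s - t\<close>, uniformly in the direction of \<open>h\<close>.
  This gives convergence of the gradients in norm.\<close>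

lemma gradient_tendsto_parameter:
  fixes f :: "real \<Rightarrow> 'a::{real_inner, complete_space} \<Rightarrow> real"
  assumes joint: "(\<lambda>(s, w). f s w) differentiable (at (t, v))"
    and f: "\<And>s w. f s differentiable (at w)" and K: "0 \<le> K"
    and lip: "\<And>s w w'. s \<in> S \<Longrightarrow> norm (gradient (f s) w - gradient (f s) w') \<le> K * norm (w - w')"
  shows "((\<lambda>s. gradient (f s) v) \<longlongrightarrow> gradient (f t) v) (at t within S)"
  unfolding tendsto_iff eventually_at
proof (intro allI impI)
  fix \<epsilon> :: real assume \<epsilon>: "0 < \<epsilon>"
  obtain D where D: "((\<lambda>(s, w). f s w) has_derivative D) (at (t, v))"
    using joint differentiable_def by blast
  then interpret D: bounded_linear D by (rule has_derivative_bounded_linear)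
  have pair: "((\<lambda>w. (t, w)) has_derivative (\<lambda>h. (0, h))) (at v)"
    by (auto intro!: derivative_eq_intros)
  have "(f t has_derivative (\<lambda>h. D (0, h))) (at v)"
    using has_derivative_compose[OF pair D] by simp
  moreover have "(f t has_derivative (\<lambda>h. h \<bullet> gradient (f t) v)) (at v)"
    using gderiv_gradient[OF f] by (simp add: gderiv_def)
  ultimately have "(\<lambda>h. D (0, h)) = (\<lambda>h. h \<bullet> gradient (f t) v)"
    by (rule has_derivative_unique)
  then have D0: "D (0, h) = h \<bullet> gradient (f t) v" for h by (rule fun_cong)
  have "\<epsilon> / 6 > 0" using \<epsilon> by simp
  with D obtain \<delta> where \<delta>: "\<delta> > 0" "\<And>s w. norm (s - t, w - v) < \<delta> \<Longrightarrow>
      \<bar>f s w - f t v - D (s - t, w - v)\<bar> \<le> \<epsilon> / 6 * norm (s - t, w - v)"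
    unfolding has_derivative_at_alt by (fastforce simp: split_paired_all)
  \<comment> \<open>The length of the test step: within the radius of the differentiability estimate together with \<open>\<bar>s - t\<bar> \<le> c\<close>, and so short that the remainder \<open>K c\<^sup>2\<close> costs less than \<open>\<epsilon> c / 2\<close>.\<close>
  define c where "c = min (\<delta> / 3) (\<epsilon> / (2 * (K + 1)))"
  have c: "c > 0" "2 * c < \<delta>" "K * c < \<epsilon> / 2"
  proof -
    show "c > 0" using \<delta> \<epsilon> K by (simp add: c_def)
    have "c \<le> \<delta> / 3" unfolding c_def by (rule min.cobounded1)
    then show "2 * c < \<delta>" using \<delta>(1) by simp
    have "K * c \<le> K * (\<epsilon> / (2 * (K + 1)))" using K unfolding c_def by (intro mult_left_mono min.cobounded2)
    also have "\<dots> < \<epsilon> / 2" using K \<epsilon> by (simp add: divide_simps)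
    finally show "K * c < \<epsilon> / 2" .
  qed
  have "dist (gradient (f s) v) (gradient (f t) v) < \<epsilon>" if s: "s \<in> S" "dist s t < c" for s
  proof -
    define g where "g = gradient (f s) v - gradient (f t) v"
    \<comment> \<open>The step in the direction of the difference \<open>g\<close> to be estimated, so that \<open>h \<bullet> g = c \<parallel>g\<parallel>\<close>.\<close>
    define h where "h = c *\<^sub>R sgn g"
    have nh: "norm h \<le> c" using c by (simp add: h_def norm_sgn)
    have ns: "norm (s - t) \<le> c" using s by (simp add: dist_norm)
    have np: "norm (s - t, h) \<le> 2 * c" using norm_Pair_le[of "s - t" h] nh ns by linarith
    have 1: "\<bar>f s (v + h) - f t v - D (s - t, h)\<bar> \<le> \<epsilon> / 6 * (2 * c)"
      by (rule order_trans[OF _ mult_left_mono[OF np]]) (use \<delta>(2)[of s "v + h"] np c \<epsilon> in auto)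
    have 2: "\<bar>f s v - f t v - D (s - t, 0)\<bar> \<le> \<epsilon> / 6 * c"
      by (rule order_trans[OF _ mult_left_mono[OF ns]]) (use \<delta>(2)[of s v] ns c \<epsilon> in \<open>auto simp: norm_Pair\<close>)
    have 3: "\<bar>f s (v + h) - f s v - h \<bullet> gradient (f s) v\<bar> \<le> K * c\<^sup>2"
      by (rule order_trans[OF first_order_remainder[OF f K lip[OF s(1)]]])
        (use K nh in \<open>auto intro!: mult_left_mono power_mono\<close>)
    have "D (s - t, h) = D (s - t, 0) + h \<bullet> gradient (f t) v"
      using D.add[of "(s - t, 0)" "(0, h)"] D0[of h] by simp
    with 1 2 3 have "\<bar>h \<bullet> g\<bar> \<le> \<epsilon> / 2 * c + K * c\<^sup>2"
      unfolding g_def inner_diff_right by linarith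
    moreover have "h \<bullet> g = c * norm g"
      by (cases "g = 0") (simp_all add: h_def sgn_div_norm power2_norm_eq_inner[symmetric] power2_eq_square)
    ultimately have "c * norm g \<le> c * (\<epsilon> / 2 + K * c)"
      using c by (simp add: algebra_simps power2_eq_square)
    then have "norm g \<le> \<epsilon> / 2 + K * c" using c by simp
    then show ?thesis using c by (simp add: g_def dist_norm)
  qed
  then show "\<exists>d>0. \<forall>s\<in>S. s \<noteq> t \<and> dist s t < d \<longrightarrow> dist (gradient (f s) v) (gradient (f t) v) < \<epsilon>"
    using c(1) by blast
qed

section \<open>Absolutely continuous curves\<close>

lemma absolutely_continuous_on_imp_continuous_on:
  fixes f :: "real \<Rightarrow> 'a::real_normed_vector"
  assumes "absolutely_continuous_on {a..b} f"
  shows "continuous_on {a..b} f"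
  unfolding continuous_on_iff
proof (intro ballI allI impI)
  fix x e :: real assume x: "x \<in> {a..b}" and e: "0 < e"
  obtain d where d: "d > 0" "\<And>D S. D division_of S \<Longrightarrow> S \<subseteq> {a..b} \<Longrightarrow> (\<Sum>K\<in>D. Sup K - Inf K) < d \<Longrightarrow>
      (\<Sum>K\<in>D. norm (f (Sup K) - f (Inf K))) < e"
    using assms e unfolding absolutely_continuous_on_def by metis
  have le: "norm (f v - f u) < e" if "u \<in> {a..b}" "v \<in> {a..b}" "u \<le> v" "v - u < d" for u v
    using d(2)[of "{cbox u v}" "cbox u v"] division_of_self[of u v] that by simp
  have "dist (f y) (f x) < e" if "y \<in> {a..b}" "dist y x < d" for y
    using le[of x y] le[of y x] x that by (cases "x \<le> y") (auto simp: dist_norm norm_minus_commute)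
  then show "\<exists>d>0. \<forall>y\<in>{a..b}. dist y x < d \<longrightarrow> dist (f y) (f x) < e"
    using d(1) by blast
qed

lemma absolutely_continuous_on_diff:
  assumes "absolutely_continuous_on I f" "absolutely_continuous_on I g"
  shows "absolutely_continuous_on I (\<lambda>t. f t - g t)"
  unfolding absolutely_continuous_on_def
proof (intro allI impI)
  fix e :: real assume e: "0 < e"
  obtain d1 where d1: "d1 > 0" "\<And>D S. D division_of S \<Longrightarrow> S \<subseteq> I \<Longrightarrow> (\<Sum>K\<in>D. Sup K - Inf K) < d1 \<Longrightarrow>
      (\<Sum>K\<in>D. norm (f (Sup K) - f (Inf K))) < e / 2"
    using assms(1) half_gt_zero[OF e] unfolding absolutely_continuous_on_def by metis
  obtain d2 where d2: "d2 > 0" "\<And>D S. D division_of S \<Longrightarrow> S \<subseteq> I \<Longrightarrow> (\<Sum>K\<in>D. Sup K - Inf K) < d2 \<Longrightarrow>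
      (\<Sum>K\<in>D. norm (g (Sup K) - g (Inf K))) < e / 2"
    using assms(2) half_gt_zero[OF e] unfolding absolutely_continuous_on_def by metis
  have d12: "min d1 d2 > 0" using d1 d2 by simp
  have "(\<Sum>K\<in>D. norm (f (Sup K) - g (Sup K) - (f (Inf K) - g (Inf K)))) < e"
    if "D division_of S \<and> S \<subseteq> I \<and> (\<Sum>K\<in>D. Sup K - Inf K) < min d1 d2" for D S
  proof -
    have "(\<Sum>K\<in>D. norm (f (Sup K) - g (Sup K) - (f (Inf K) - g (Inf K))))
        \<le> (\<Sum>K\<in>D. norm (f (Sup K) - f (Inf K)) + norm (g (Sup K) - g (Inf K)))"
    proof (rule sum_mono)
      fix K
      show "norm (f (Sup K) - g (Sup K) - (f (Inf K) - g (Inf K)))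
          \<le> norm (f (Sup K) - f (Inf K)) + norm (g (Sup K) - g (Inf K))"
        using norm_triangle_ineq4[of "f (Sup K) - f (Inf K)" "g (Sup K) - g (Inf K)"]
        by (simp add: algebra_simps)
    qed
    also have "\<dots> < e"
      using d1(2)[of D S] d2(2)[of D S] that unfolding sum.distrib by linarith
    finally show ?thesis .
  qed
  then show "\<exists>\<delta>>0. \<forall>D S. D division_of S \<and> S \<subseteq> I \<and> (\<Sum>K\<in>D. Sup K - Inf K) < \<delta> \<longrightarrow>
       (\<Sum>K\<in>D. norm (f (Sup K) - g (Sup K) - (f (Inf K) - g (Inf K)))) < e"
    using d12 by blast
qed

lemma absolutely_continuous_on_inner:
  fixes f g :: "real \<Rightarrow> 'a::real_inner"
  assumes f: "absolutely_continuous_on {a..b} f" and g: "absolutely_continuous_on {a..b} g"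
  shows "absolutely_continuous_on {a..b} (\<lambda>t. f t \<bullet> g t)"
proof -
  have "bounded (f ` {a..b})" "bounded (g ` {a..b})"
    using f g by (auto intro!: compact_imp_bounded compact_continuous_image absolutely_continuous_on_imp_continuous_on)
  then obtain B1 B2 where B: "B1 > 0" "\<And>t. t \<in> {a..b} \<Longrightarrow> norm (f t) \<le> B1"
     "B2 > 0" "\<And>t. t \<in> {a..b} \<Longrightarrow> norm (g t) \<le> B2"
    unfolding bounded_pos by (metis imageI)
  show ?thesis
    unfolding absolutely_continuous_on_def
  proof (intro allI impI)
    fix e :: real assume e: "0 < e"
    have e2: "e / (2 * B2) > 0" "e / (2 * B1) > 0" using e B by auto
    obtain d1 where d1: "d1 > 0" "\<And>D S. D division_of S \<Longrightarrow> S \<subseteq> {a..b} \<Longrightarrow> (\<Sum>K\<in>D. Sup K - Inf K) < d1 \<Longrightarrow>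
        (\<Sum>K\<in>D. norm (f (Sup K) - f (Inf K))) < e / (2 * B2)"
      using f e2(1) unfolding absolutely_continuous_on_def by metis
    obtain d2 where d2: "d2 > 0" "\<And>D S. D division_of S \<Longrightarrow> S \<subseteq> {a..b} \<Longrightarrow> (\<Sum>K\<in>D. Sup K - Inf K) < d2 \<Longrightarrow>
        (\<Sum>K\<in>D. norm (g (Sup K) - g (Inf K))) < e / (2 * B1)"
      using g e2(2) unfolding absolutely_continuous_on_def by metis
    have d12: "min d1 d2 > 0" using d1 d2 by simp
    have "(\<Sum>K\<in>D. norm (f (Sup K) \<bullet> g (Sup K) - f (Inf K) \<bullet> g (Inf K))) < e"
      if D: "D division_of S \<and> S \<subseteq> {a..b} \<and> (\<Sum>K\<in>D. Sup K - Inf K) < min d1 d2" for D S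
    proof -
      have "(\<Sum>K\<in>D. norm (f (Sup K) \<bullet> g (Sup K) - f (Inf K) \<bullet> g (Inf K)))
          \<le> (\<Sum>K\<in>D. norm (f (Sup K) - f (Inf K)) * B2 + B1 * norm (g (Sup K) - g (Inf K)))"
      proof (rule sum_mono)
        fix K assume K: "K \<in> D"
        then obtain u v where "K = {u..v}" "u \<le> v" "K \<subseteq> {a..b}"
          using D by (metis atLeastatMost_empty_iff2 box_real(2) division_ofD(2,3,4) order_trans)
        then have in': "Sup K \<in> {a..b}" "Inf K \<in> {a..b}" by auto
        have "f (Sup K) \<bullet> g (Sup K) - f (Inf K) \<bullet> g (Inf K)
            = (f (Sup K) - f (Inf K)) \<bullet> g (Sup K) + f (Inf K) \<bullet> (g (Sup K) - g (Inf K))"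
          by (simp add: algebra_simps)
        also have "norm \<dots> \<le> norm (f (Sup K) - f (Inf K)) * norm (g (Sup K)) + norm (f (Inf K)) * norm (g (Sup K) - g (Inf K))"
          unfolding real_norm_def by (rule order_trans[OF abs_triangle_ineq]) (intro add_mono Cauchy_Schwarz_ineq2)
        also have "\<dots> \<le> norm (f (Sup K) - f (Inf K)) * B2 + B1 * norm (g (Sup K) - g (Inf K))"
          using B in' by (intro add_mono mult_left_mono mult_right_mono) auto
        finally show "norm (f (Sup K) \<bullet> g (Sup K) - f (Inf K) \<bullet> g (Inf K)) \<le> \<dots>" .
      qed
      also have "\<dots> = (\<Sum>K\<in>D. norm (f (Sup K) - f (Inf K))) * B2 + B1 * (\<Sum>K\<in>D. norm (g (Sup K) - g (Inf K)))"
        by (simp add: sum.distrib sum_distrib_left sum_distrib_right)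
      also have "\<dots> < e / (2 * B2) * B2 + B1 * (e / (2 * B1))"
        using d1(2)[of D S] d2(2)[of D S] D B by (intro add_strict_mono mult_strict_right_mono mult_strict_left_mono) auto
      also have "\<dots> = e" using B by simp
      finally show ?thesis .
    qed
    then show "\<exists>\<delta>>0. \<forall>D S. D division_of S \<and> S \<subseteq> {a..b} \<and> (\<Sum>K\<in>D. Sup K - Inf K) < \<delta> \<longrightarrow>
         (\<Sum>K\<in>D. norm (f (Sup K) \<bullet> g (Sup K) - f (Inf K) \<bullet> g (Inf K))) < e"
      using d12 by blast
  qed
qed

text \<open>In a Riemann sum of a fine tagged division, the intervals whose tag lies outside the null set are
  treated by differentiability at the tag. The others lie in an open set of small measure around \<open>N\<close>, so
  their total length is small and absolute continuity bounds the variation of \<open>f\<close> over them.\<close>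

lemma fundamental_theorem_of_calculus_absolutely_continuous:
  fixes f :: "real \<Rightarrow> 'a::real_normed_vector"
  assumes ab: "a \<le> b" and ac: "absolutely_continuous_on {a..b} f" and N: "negligible N"
    and der: "\<And>x. x \<in> {a..b} - N \<Longrightarrow> (f has_vector_derivative f' x) (at x within {a..b})"
  shows "(f' has_integral f b - f a) {a..b}"
proof -
  \<comment> \<open>Changing the integrand on the null set removes the uncontrolled terms from the Riemann sums.\<close>
  define g where "g x = (if x \<in> N then 0 else f' x)" for x
  have "(g has_integral f b - f a) {a..b}"
    unfolding has_integral_real
  proof (intro allI impI)
    fix e :: real assume e: "e > 0"
    define c where "c = e / (2 * (b - a + 1))"
    have c: "c > 0" "c * (b - a) \<le> e / 2"
      using e ab by (auto simp: c_def divide_simps)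
    have "\<forall>x\<in>{a..b} - N. \<exists>d. d > 0 \<and> (\<forall>y\<in>{a..b}. \<bar>y - x\<bar> < d \<longrightarrow>
        norm (f y - f x - (y - x) *\<^sub>R f' x) \<le> c * \<bar>y - x\<bar>)"
    proof
      fix x assume "x \<in> {a..b} - N"
      from der[OF this, unfolded has_vector_derivative_def has_derivative_within_alt real_norm_def] c(1)
      show "\<exists>d. d > 0 \<and> (\<forall>y\<in>{a..b}. \<bar>y - x\<bar> < d \<longrightarrow> norm (f y - f x - (y - x) *\<^sub>R f' x) \<le> c * \<bar>y - x\<bar>)"
        by (elim conjE allE[of _ c]) simp
    qed
    then obtain d where dd: "\<forall>x\<in>{a..b} - N. d x > 0 \<and> (\<forall>y\<in>{a..b}. \<bar>y - x\<bar> < d x \<longrightarrow>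
        norm (f y - f x - (y - x) *\<^sub>R f' x) \<le> c * \<bar>y - x\<bar>)"
      unfolding bchoice_iff by blast
    have d: "\<And>x. x \<in> {a..b} - N \<Longrightarrow> d x > 0"
      "\<And>x y. x \<in> {a..b} - N \<Longrightarrow> y \<in> {a..b} \<Longrightarrow> \<bar>y - x\<bar> < d x \<Longrightarrow>
         norm (f y - f x - (y - x) *\<^sub>R f' x) \<le> c * \<bar>y - x\<bar>"
      using dd by blast+
    obtain \<delta> where \<delta>: "\<delta> > 0" "\<And>D S. D division_of S \<Longrightarrow> S \<subseteq> {a..b} \<Longrightarrow> (\<Sum>K\<in>D. Sup K - Inf K) < \<delta> \<Longrightarrow>
        (\<Sum>K\<in>D. norm (f (Sup K) - f (Inf K))) < e / 2"
      using ac half_gt_zero[OF e] unfolding absolutely_continuous_on_def by metis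
    have Nl: "N \<in> null_sets lebesgue" using N by (simp add: negligible_iff_null_sets)
    then obtain U where U: "open U" "N \<subseteq> U" "U - N \<in> lmeasurable" "emeasure lebesgue (U - N) < ennreal \<delta>"
      using sets_lebesgue_outer_open[of N \<delta>] \<delta>(1) null_setsD2[OF Nl] by metis
    have "emeasure lebesgue U \<le> emeasure lebesgue (U - N) + emeasure lebesgue N"
      by (rule order_trans[OF emeasure_mono emeasure_subadditive]) (use U Nl in auto)
    also have "emeasure lebesgue N = 0" using Nl by auto
    finally have emU: "emeasure lebesgue U < ennreal \<delta>" using U(4) by simp
    have Ul: "U \<in> lmeasurable"
      using less_trans[OF emU ennreal_less_top] U(1) by (intro fmeasurableI) auto
    have mU: "measure lebesgue U < \<delta>"
      using emU Ul \<delta>(1) by (simp add: emeasure_eq_measure2 ennreal_less_iff)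
    obtain r where r: "\<And>x. x \<in> N \<Longrightarrow> r x > 0 \<and> ball x (r x) \<subseteq> U"
      using U(1,2) unfolding open_contains_ball by (metis subset_iff)
    define \<gamma> where "\<gamma> x = (if x \<in> N then ball x (r x) else if x \<in> {a..b} then ball x (d x) else UNIV)" for x
    have "gauge \<gamma>" unfolding gauge_def \<gamma>_def using r d(1) by auto
    moreover have "norm ((\<Sum>(x, k)\<in>p. measure lborel k *\<^sub>R g x) - (f b - f a)) < e"
      if p: "p tagged_division_of {a..b}" and fine: "\<gamma> fine p" for p
    proof -
      define q where "q = {z \<in> p. fst z \<in> N}"
      define \<Delta> where "\<Delta> z = measure lborel (snd z) *\<^sub>R g (fst z) - (f (Sup (snd z)) - f (Inf (snd z)))" for z
      have fin: "finite p" "finite q" using p by (auto simp: q_def)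
      have P: "\<exists>u v. k = {u..v} \<and> a \<le> u \<and> u \<le> x \<and> x \<le> v \<and> v \<le> b" if xk: "(x, k) \<in> p" for x k
      proof -
        obtain u v where k: "k = cbox u v" using tagged_division_ofD(4)[OF p xk] by blast
        then show ?thesis using tagged_division_ofD(2,3)[OF p xk] by auto
      qed
      have "(\<Sum>(x, k)\<in>p. measure lborel k *\<^sub>R g x) - (f b - f a) = (\<Sum>z\<in>p. \<Delta> z)"
        unfolding additive_tagged_division_1[OF ab p, symmetric] \<Delta>_def split_def by (rule sum_subtractf[symmetric])
      also have "\<dots> = (\<Sum>z\<in>p - q. \<Delta> z) + (\<Sum>z\<in>q. \<Delta> z)"
        by (rule sum.subset_diff) (auto simp: q_def fin)
      also have "norm \<dots> \<le> (\<Sum>z\<in>p - q. norm (\<Delta> z)) + (\<Sum>z\<in>q. norm (\<Delta> z))"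
        by (intro order_trans[OF norm_triangle_ineq] add_mono norm_sum)
      also have "\<dots> < e"
      proof -
        have "(\<Sum>z\<in>p - q. norm (\<Delta> z)) \<le> (\<Sum>z\<in>p - q. c * measure lborel (snd z))"
        proof (rule sum_mono)
          fix z assume z: "z \<in> p - q"
          obtain x k where xk: "z = (x, k)" by fastforce
          obtain u v where uv: "k = {u..v}" "a \<le> u" "u \<le> x" "x \<le> v" "v \<le> b" using P z xk by blast
          have uv': "u \<le> v" using uv by simp
          have xN: "x \<notin> N" "x \<in> {a..b}" using z xk uv by (auto simp: q_def)
          have "k \<subseteq> \<gamma> x" using fine z xk unfolding fine_def by blast
          then have "k \<subseteq> ball x (d x)" using xN by (simp add: \<gamma>_def)
          moreover have "u \<in> k" "v \<in> k" unfolding uv(1) using uv' by simp_all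
          ultimately have "u \<in> ball x (d x)" "v \<in> ball x (d x)" by blast+
          then have dx: "\<bar>u - x\<bar> < d x" "\<bar>v - x\<bar> < d x"
            unfolding mem_ball dist_real_def by linarith+
          have xx: "x \<in> {a..b} - N" "u \<in> {a..b}" "v \<in> {a..b}" using xN uv by auto
          have 1: "norm (f u - f x - (u - x) *\<^sub>R f' x) \<le> c * \<bar>u - x\<bar>" "norm (f v - f x - (v - x) *\<^sub>R f' x) \<le> c * \<bar>v - x\<bar>"
            by (rule d(2)[OF xx(1,2) dx(1)], rule d(2)[OF xx(1,3) dx(2)])
          have "\<Delta> z = (f u - f x - (u - x) *\<^sub>R f' x) - (f v - f x - (v - x) *\<^sub>R f' x)"
            unfolding \<Delta>_def xk fst_conv snd_conv uv(1) g_def if_not_P[OF xN(1)]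
              cSup_atLeastAtMost[OF uv'] cInf_atLeastAtMost[OF uv'] content_real[OF uv']
            by (simp add: algebra_simps)
          also have "norm \<dots> \<le> c * \<bar>u - x\<bar> + c * \<bar>v - x\<bar>"
            by (rule order_trans[OF norm_triangle_ineq4 add_mono[OF 1]])
          also have "\<dots> = c * measure lborel (snd z)" using uv uv' xk by (simp add: algebra_simps)
          finally show "norm (\<Delta> z) \<le> c * measure lborel (snd z)" .
        qed
        also have "\<dots> \<le> (\<Sum>z\<in>p. c * measure lborel (snd z))"
          using c fin by (intro sum_mono2) auto
        also have "\<dots> = c * (b - a)"
          using additive_content_tagged_division[of p a b] p ab by (simp add: sum_distrib_left[symmetric] split_def)
        also have "\<dots> \<le> e / 2" by (rule c)
        finally have A: "(\<Sum>z\<in>p - q. norm (\<Delta> z)) \<le> e / 2" .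
        have q: "q tagged_partial_division_of {a..b}"
          using tagged_partial_division_subset[of p "{a..b}" q] p by (auto simp: tagged_division_of_def q_def)
        note qd = partial_division_of_tagged_division[OF q]
        have "(\<Sum>z\<in>q. norm (\<Delta> z)) = (\<Sum>(x, k)\<in>q. if k = {} then 0 else norm (f (Sup k) - f (Inf k)))"
        proof (rule sum.cong[OF refl], unfold split_paired_all prod.case)
          fix x k assume "(x, k) \<in> q"
          then have "x \<in> N" "k \<noteq> {}" using P[of x k] by (auto simp: q_def)
          then show "norm (\<Delta> (x, k)) = (if k = {} then 0 else norm (f (Sup k) - f (Inf k)))"
            by (simp add: \<Delta>_def g_def norm_minus_commute)
        qed
        also have "\<dots> = (\<Sum>k\<in>snd ` q. if k = {} then 0 else norm (f (Sup k) - f (Inf k)))"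
          by (rule sum.over_tagged_division_lemma[OF tagged_partial_division_of_Union_self[OF q]])
            (auto simp: not_less order_antisym)
        also have "\<dots> = (\<Sum>k\<in>snd ` q. norm (f (Sup k) - f (Inf k)))"
        proof (rule sum.cong[OF refl])
          fix k assume "k \<in> snd ` q"
          then have "k \<noteq> {}" using tagged_partial_division_ofD(2)[OF q] by fastforce
          then show "(if k = {} then 0 else norm (f (Sup k) - f (Inf k))) = norm (f (Sup k) - f (Inf k))"
            by simp
        qed
        also have "\<dots> < e / 2"
        proof (rule \<delta>(2)[OF qd])
          show "\<Union> (snd ` q) \<subseteq> {a..b}" using tagged_partial_division_ofD(3)[OF q] by force
          have "(\<Sum>K\<in>snd ` q. Sup K - Inf K) = (\<Sum>K\<in>snd ` q. measure lebesgue K)"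
          proof (rule sum.cong[OF refl])
            fix K assume "K \<in> snd ` q"
            then obtain z where z: "z \<in> q" "K = snd z" by blast
            then have "(fst z, K) \<in> p" by (simp add: q_def)
            from P[OF this] obtain u v where uv: "K = {u..v}" "u \<le> fst z" "fst z \<le> v" by blast
            from uv(2,3) have "u \<le> v" by simp
            then show "Sup K - Inf K = measure lebesgue K" unfolding uv(1) by simp
          qed
          also have "\<dots> = measure lebesgue (\<Union> (snd ` q))"
            by (rule content_division[OF qd])
          also have "\<dots> \<le> measure lebesgue U"
          proof (rule measure_mono_fmeasurable)
            show "\<Union> (snd ` q) \<subseteq> U"
            proof
              fix y assume "y \<in> \<Union> (snd ` q)"
              then obtain z where z: "z \<in> q" "y \<in> snd z" by blast
              then have zp: "(fst z, snd z) \<in> p" "fst z \<in> N" by (simp_all add: q_def)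
              then have "snd z \<subseteq> \<gamma> (fst z)" using fine unfolding fine_def by blast
              then show "y \<in> U" using r[OF zp(2)] zp(2) z(2) unfolding \<gamma>_def by auto
            qed
            show "\<Union> (snd ` q) \<in> sets lebesgue" using lmeasurable_division[OF qd] by blast
          qed (rule Ul)
          finally show "(\<Sum>K\<in>snd ` q. Sup K - Inf K) < \<delta>" using mU by simp
        qed
        finally show ?thesis using A by simp
      qed
      finally show ?thesis .
    qed
    ultimately show "\<exists>\<gamma>. gauge \<gamma> \<and> (\<forall>p. p tagged_division_of {a..b} \<and> \<gamma> fine p \<longrightarrow>
        norm ((\<Sum>(x, k)\<in>p. measure lborel k *\<^sub>R g x) - (f b - f a)) < e)"
      by (intro exI[of _ \<gamma>] conjI allI impI) simp_all
  qed
  then show ?thesis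
    by (rule has_integral_spike[OF N, rotated]) (simp add: g_def)
qed

section \<open>Strong measurability\<close>

lemma AE_time_negligible:
  assumes "AE t in time_measure T. P t"
  obtains N where "negligible N" "\<And>t. t \<in> {0..T} - N \<Longrightarrow> P t"
proof -
  have "AE t in lebesgue. t \<in> {0..T} \<longrightarrow> P t"
    using assms by (subst (asm) AE_restrict_space_iff) auto
  then obtain N where "N \<in> null_sets lebesgue" "{t \<in> space lebesgue. \<not> (t \<in> {0..T} \<longrightarrow> P t)} \<subseteq> N"
    by (auto elim: AE_E3 simp: eventually_ae_filter)
  then show ?thesis
    by (intro that[of N]) (auto simp: negligible_iff_null_sets)
qed

text \<open>Completeness of Lebesgue measure on the time interval.\<close>

lemma borel_measurable_AE_eq:
  fixes f g :: "real \<Rightarrow> real"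
  assumes "f \<in> borel_measurable (time_measure T)" "AE t in time_measure T. f t = g t"
  shows "g \<in> borel_measurable (time_measure T)"
proof -
  have "(\<lambda>t. if t \<in> {0..T} then f t else 0) \<in> borel_measurable lebesgue"
    using assms(1) by (subst borel_measurable_if) simp
  moreover have "AE t in lebesgue. (if t \<in> {0..T} then f t else 0) = (if t \<in> {0..T} then g t else 0)"
    using assms(2) by (subst (asm) AE_restrict_space_iff) (auto elim: eventually_mono)
  ultimately have "(\<lambda>t. if t \<in> {0..T} then g t else 0) \<in> borel_measurable lebesgue"
    by (rule borel_measurable_AE)
  then show ?thesis by (subst (asm) borel_measurable_if) simp
qed

lemma borel_measurable_AE_limit:
  fixes f :: "nat \<Rightarrow> real \<Rightarrow> real"
  assumes "\<And>n. f n \<in> borel_measurable (time_measure T)"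
    and "AE t in time_measure T. (\<lambda>n. f n t) \<longlonglongrightarrow> g t"
  shows "g \<in> borel_measurable (time_measure T)"
proof (rule borel_measurable_AE_eq)
  show "(\<lambda>t. lim (\<lambda>n. f n t)) \<in> borel_measurable (time_measure T)"
    by (rule borel_measurable_lim_metric) (rule assms)
  show "AE t in time_measure T. lim (\<lambda>n. f n t) = g t"
    using assms(2) by (rule eventually_mono) (rule limI)
qed

lemma integrable_time_bounded:
  assumes "AE t in time_measure T. \<bar>f t\<bar> \<le> (C::real)" "f \<in> borel_measurable (time_measure T)"
  shows "integrable (time_measure T) f"
  using finite_measure.integrable_const_bound[OF finite_measure_lebesgue_on, of "{0..T}" f C] assms by simp

lemma strongly_measurable_norm_diff:
  fixes f :: "real \<Rightarrow> 'a::real_normed_vector"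
  assumes "strongly_measurable T f"
  shows "(\<lambda>t. norm (f t - c)) \<in> borel_measurable (time_measure T)"
proof -
  obtain s where s: "\<And>i. simple_function (time_measure T) (s i)"
    "AE t in time_measure T. (\<lambda>i. s i t) \<longlonglongrightarrow> f t"
    using assms by (auto simp: strongly_measurable_def)
  show ?thesis
  proof (rule borel_measurable_AE_limit)
    show "(\<lambda>t. norm (s i t - c)) \<in> borel_measurable (time_measure T)" for i
      using simple_function_compose1[OF s(1)[of i], of "\<lambda>x. norm (x - c)"]
      by (rule borel_measurable_simple_function)
    show "AE t in time_measure T. (\<lambda>i. norm (s i t - c)) \<longlonglongrightarrow> norm (f t - c)"
      using s(2) by (rule eventually_mono) (intro tendsto_intros)
  qed
qed

lemma strongly_measurable_separable:
  fixes f :: "real \<Rightarrow> 'a::real_normed_vector"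
  assumes "strongly_measurable T f"
  shows "\<exists>D. countable D \<and> (AE t in time_measure T. f t \<in> closure D)"
proof -
  obtain s where s: "\<And>i. simple_function (time_measure T) (s i)"
    "AE t in time_measure T. (\<lambda>i. s i t) \<longlonglongrightarrow> f t"
    using assms by (auto simp: strongly_measurable_def)
  let ?D = "\<Union>i. s i ` space (time_measure T)"
  have "countable ?D"
    by (rule countable_UN[OF _ countable_finite[OF simple_functionD(1)[OF s(1)]]]) simp
  moreover have "AE t in time_measure T. f t \<in> closure ?D"
    using s(2) AE_space
  proof eventually_elim
    fix t assume "(\<lambda>i. s i t) \<longlonglongrightarrow> f t" "t \<in> space (time_measure T)"
    then show "f t \<in> closure ?D"
      unfolding closure_sequential by (intro exI[of _ "\<lambda>i. s i t"]) blast
  qed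
  ultimately show ?thesis by blast
qed

text \<open>With \<open>strongly_measurable_norm_diff\<close> and \<open>strongly_measurable_separable\<close> this characterizes strong
  measurability in the manner of Pettis: the range is essentially separable and all distances to fixed
  points are measurable. The \<open>n\<close>-th simple function picks a point of the dense sequence that is nearest
  to \<open>f t\<close> among the first \<open>n + 1\<close> points.\<close>

lemma strongly_measurableI:
  fixes f :: "real \<Rightarrow> 'a::real_normed_vector"
  assumes D: "countable D" "AE t in time_measure T. f t \<in> closure D"
    and m: "\<And>c. c \<in> D \<Longrightarrow> (\<lambda>t. norm (f t - c)) \<in> borel_measurable (time_measure T)"
  shows "strongly_measurable T f"
proof (cases "D = {}")
  case True
  then have "AE t in time_measure T. (\<lambda>i. 0) \<longlonglongrightarrow> f t"
    using D(2) by (auto elim: eventually_mono)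
  then show ?thesis
    unfolding strongly_measurable_def by (intro exI[of _ "\<lambda>i t. 0"]) auto
next
  case False
  define d where "d = from_nat_into D"
  have dD: "range d = D" using D(1) False by (simp add: d_def range_from_nat_into)
  have md: "(\<lambda>t. norm (f t - d i)) \<in> borel_measurable (time_measure T)" for i
    using m[of "d i"] dD by blast
  \<comment> \<open>The distance of \<open>f t\<close> to the first \<open>n + 1\<close> points, and a measurable choice \<open>s\<close> of a point attaining it.\<close>
  define \<delta> where "\<delta> = rec_nat (\<lambda>t. norm (f t - d 0)) (\<lambda>n r t. min (r t) (norm (f t - d (Suc n))))"
  have \<delta>: "\<delta> 0 = (\<lambda>t. norm (f t - d 0))" "\<And>n. \<delta> (Suc n) = (\<lambda>t. min (\<delta> n t) (norm (f t - d (Suc n))))"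
    by (simp_all add: \<delta>_def)
  define s where "s = rec_nat (\<lambda>t. d 0) (\<lambda>n r t. if norm (f t - d (Suc n)) < \<delta> n t then d (Suc n) else r t)"
  have s: "s 0 = (\<lambda>t. d 0)" "\<And>n. s (Suc n) = (\<lambda>t. if norm (f t - d (Suc n)) < \<delta> n t then d (Suc n) else s n t)"
    unfolding s_def by simp_all
  have m\<delta>: "\<delta> n \<in> borel_measurable (time_measure T)" for n
    by (induction n) (auto simp: \<delta> md intro!: borel_measurable_min)
  have simple: "simple_function (time_measure T) (s n)" for n
  proof (induction n)
    case (Suc n)
    show ?case unfolding s
    proof (rule simple_function_If)
      show "{t \<in> space (time_measure T). norm (f t - d (Suc n)) < \<delta> n t} \<in> sets (time_measure T)"
        by (rule borel_measurable_less[OF md m\<delta>])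
    qed (auto intro: Suc)
  qed (simp add: s)
  have attained: "norm (f t - s n t) = \<delta> n t" for n t
    by (induction n) (auto simp: s \<delta> min_def)
  have \<delta>_le: "\<delta> n t \<le> norm (f t - d i)" if "i \<le> n" for i n t
    using that by (induction n) (auto simp: \<delta> le_Suc_eq)
  have "AE t in time_measure T. (\<lambda>n. s n t) \<longlonglongrightarrow> f t"
    using D(2)
  proof eventually_elim
    fix t assume ft: "f t \<in> closure D"
    show "(\<lambda>n. s n t) \<longlonglongrightarrow> f t"
    proof (rule metric_LIMSEQ_I)
      fix e :: real assume "e > 0"
      then obtain y where "y \<in> D" "dist y (f t) < e" using ft by (auto simp: closure_approachable)
      then obtain i where i: "norm (f t - d i) < e" using dD by (auto simp: dist_norm norm_minus_commute)
      have "dist (s n t) (f t) < e" if "n \<ge> i" for n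
        using \<delta>_le[OF that, of t] attained[of t n] i by (simp add: dist_norm norm_minus_commute)
      then show "\<exists>n0. \<forall>n\<ge>n0. dist (s n t) (f t) < e" by blast
    qed
  qed
  with simple show ?thesis unfolding strongly_measurable_def by blast
qed

text \<open>Both conditions of the characterization pass to limits, while the definition by simple functions
  would require a diagonal argument.\<close>

lemma strongly_measurable_AE_limit:
  fixes f :: "nat \<Rightarrow> real \<Rightarrow> 'a::real_normed_vector"
  assumes f: "\<And>n. strongly_measurable T (f n)"
    and lim: "AE t in time_measure T. (\<lambda>n. f n t) \<longlonglongrightarrow> g t"
  shows "strongly_measurable T g"
proof -
  have "\<forall>n. \<exists>D. countable D \<and> (AE t in time_measure T. f n t \<in> closure D)"
    using strongly_measurable_separable[OF f] by blast
  then obtain D where D: "\<And>n. countable (D n)" "\<And>n. AE t in time_measure T. f n t \<in> closure (D n)"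
    by metis
  have "AE t in time_measure T. \<forall>n. f n t \<in> closure (D n)"
    using D(2) by (simp add: AE_all_countable)
  with lim have cl: "AE t in time_measure T. g t \<in> closure (\<Union>n. D n)"
  proof eventually_elim
    fix t assume t: "(\<lambda>n. f n t) \<longlonglongrightarrow> g t" "\<forall>n. f n t \<in> closure (D n)"
    have "f n t \<in> closure (\<Union>n. D n)" for n
      using t(2) closure_mono[of "D n" "\<Union>n. D n"] by blast
    then show "g t \<in> closure (\<Union>n. D n)"
      using closed_sequentially[OF closed_closure _ t(1)] by blast
  qed
  show ?thesis
  proof (rule strongly_measurableI[OF _ cl])
    show "countable (\<Union>n. D n)" using D(1) by simp
    show "(\<lambda>t. norm (g t - c)) \<in> borel_measurable (time_measure T)" for c
    proof (rule borel_measurable_AE_limit)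
      show "(\<lambda>t. norm (f n t - c)) \<in> borel_measurable (time_measure T)" for n
        by (rule strongly_measurable_norm_diff[OF f])
      show "AE t in time_measure T. (\<lambda>n. norm (f n t - c)) \<longlonglongrightarrow> norm (g t - c)"
        using lim by (rule eventually_mono) (intro tendsto_intros)
    qed
  qed
qed

lemma strongly_measurable_continuous:
  assumes "continuous_on {0..T} f"
  shows "strongly_measurable T f"
proof (rule strongly_measurableI)
  show "countable (f ` ({0..T} \<inter> \<rat> \<union> {0, T}))" by (auto simp: countable_rat)
  show "AE t in time_measure T. f t \<in> closure (f ` ({0..T} \<inter> \<rat> \<union> {0, T}))"
  proof (rule AE_I2)
    fix t assume t: "t \<in> space (time_measure T)"
    have "{0..T} \<subseteq> closure ({0..T} \<inter> \<rat> \<union> {0, T})"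
    proof
      fix x assume x: "x \<in> {0..T}"
      show "x \<in> closure ({0..T} \<inter> \<rat> \<union> {0, T})"
        unfolding closure_approachable
      proof (intro allI impI)
        fix e :: real assume e: "e > 0"
        show "\<exists>y\<in>{0..T} \<inter> \<rat> \<union> {0, T}. dist y x < e"
        proof (cases "x = T")
          case False
          then have "x < min (x + e) T" using x e by auto
          then obtain q where "q \<in> \<rat>" "x < q" "q < min (x + e) T" using Rats_dense_in_real by blast
          then show ?thesis using x by (intro bexI[of _ q]) (auto simp: dist_real_def)
        qed (use e in auto)
      qed
    qed
    moreover have "f ` closure ({0..T} \<inter> \<rat> \<union> {0, T}) \<subseteq> closure (f ` ({0..T} \<inter> \<rat> \<union> {0, T}))"
    proof (rule image_closure_subset[OF _ closed_closure closure_subset])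
      have "closure ({0..T} \<inter> \<rat> \<union> {0, T}) \<subseteq> {0..T}"
        using t by (intro closure_minimal) auto
      then show "continuous_on (closure ({0..T} \<inter> \<rat> \<union> {0, T})) f"
        using assms continuous_on_subset by blast
    qed
    ultimately show "f t \<in> closure (f ` ({0..T} \<inter> \<rat> \<union> {0, T}))"
      using t unfolding space_restrict_space space_completion space_lborel by blast
  qed
  show "(\<lambda>t. norm (f t - c)) \<in> borel_measurable (time_measure T)" for c
    by (intro continuous_imp_measurable_on_sets_lebesgue continuous_intros assms) simp
qed

lemma strongly_measurable_compose2:
  fixes f :: "real \<Rightarrow> 'a::real_normed_vector" and g :: "real \<Rightarrow> 'b::real_normed_vector"
    and h :: "'a \<Rightarrow> 'b \<Rightarrow> 'c::real_normed_vector"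
  assumes "strongly_measurable T f" "strongly_measurable T g"
    and h: "continuous_on UNIV (\<lambda>(x, y). h x y)"
  shows "strongly_measurable T (\<lambda>t. h (f t) (g t))"
proof -
  obtain r where r: "\<And>i. simple_function (time_measure T) (r i)"
    "AE t in time_measure T. (\<lambda>i. r i t) \<longlonglongrightarrow> f t"
    using assms(1) by (auto simp: strongly_measurable_def)
  obtain s where s: "\<And>i. simple_function (time_measure T) (s i)"
    "AE t in time_measure T. (\<lambda>i. s i t) \<longlonglongrightarrow> g t"
    using assms(2) by (auto simp: strongly_measurable_def)
  have "AE t in time_measure T. (\<lambda>i. h (r i t) (s i t)) \<longlonglongrightarrow> h (f t) (g t)"
    using r(2) s(2)
  proof eventually_elim
    fix t assume "(\<lambda>i. r i t) \<longlonglongrightarrow> f t" "(\<lambda>i. s i t) \<longlonglongrightarrow> g t"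
    then have "(\<lambda>i. (r i t, s i t)) \<longlonglongrightarrow> (f t, g t)" by (rule tendsto_Pair)
    from continuous_on_tendsto_compose[OF h this]
    show "(\<lambda>i. h (r i t) (s i t)) \<longlonglongrightarrow> h (f t) (g t)" by simp
  qed
  then show ?thesis
    unfolding strongly_measurable_def
    using simple_function_compose2[OF r(1) s(1), of h] by (intro exI[of _ "\<lambda>i t. h (r i t) (s i t)"]) blast
qed

lemma strongly_measurable_const: "strongly_measurable T (\<lambda>t. c)"
  by (rule strongly_measurable_continuous) simp

lemma strongly_measurable_add:
  "strongly_measurable T f \<Longrightarrow> strongly_measurable T g \<Longrightarrow> strongly_measurable T (\<lambda>t. f t + g t)"
  by (rule strongly_measurable_compose2[where h="(+)"]) (auto simp: split_def intro!: continuous_intros)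

lemma strongly_measurable_diff:
  "strongly_measurable T f \<Longrightarrow> strongly_measurable T g \<Longrightarrow> strongly_measurable T (\<lambda>t. f t - g t)"
  by (rule strongly_measurable_compose2[where h="(-)"]) (auto simp: split_def intro!: continuous_intros)

lemma strongly_measurable_scaleR:
  "strongly_measurable T f \<Longrightarrow> strongly_measurable T (\<lambda>t. c *\<^sub>R f t)"
  by (rule strongly_measurable_compose2[where h="\<lambda>x y. c *\<^sub>R x" and g=f]) (auto simp: split_def intro!: continuous_intros)

lemma strongly_measurable_Pair:
  "strongly_measurable T f \<Longrightarrow> strongly_measurable T g \<Longrightarrow> strongly_measurable T (\<lambda>t. (f t, g t))"
  by (rule strongly_measurable_compose2[where h=Pair]) (auto simp: split_def intro!: continuous_intros)

text \<open>For a simple function in place of \<open>p\<close> the superposition is one of finitely many functions \<open>g t q\<close> on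
  each piece; the general case is a limit, by continuity of \<open>g t\<close>.\<close>

lemma strongly_measurable_caratheodory:
  fixes g :: "real \<Rightarrow> 'p::real_normed_vector \<Rightarrow> 'a::real_normed_vector"
  assumes g: "\<And>p. strongly_measurable T (\<lambda>t. g t p)"
    and cont: "\<And>t. t \<in> {0..T} \<Longrightarrow> continuous_on UNIV (g t)"
    and p: "strongly_measurable T p"
  shows "strongly_measurable T (\<lambda>t. g t (p t))"
proof -
  obtain s where s: "\<And>i. simple_function (time_measure T) (s i)"
    "AE t in time_measure T. (\<lambda>i. s i t) \<longlonglongrightarrow> p t"
    using p by (auto simp: strongly_measurable_def)
  show ?thesis
  proof (rule strongly_measurable_AE_limit)
    show "AE t in time_measure T. (\<lambda>i. g t (s i t)) \<longlonglongrightarrow> g t (p t)"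
      using s(2) AE_space
    proof eventually_elim
      fix t assume "(\<lambda>i. s i t) \<longlonglongrightarrow> p t" "t \<in> space (time_measure T)"
      then show "(\<lambda>i. g t (s i t)) \<longlonglongrightarrow> g t (p t)"
        using continuous_on_tendsto_compose[OF cont[of t]] by simp
    qed
    fix i
    let ?I = "s i ` space (time_measure T)"
    have fin: "finite ?I" using s(1)[of i] by (rule simple_functionD)
    have "\<forall>q. \<exists>D. countable D \<and> (AE t in time_measure T. g t q \<in> closure D)"
      using strongly_measurable_separable[OF g] by blast
    then obtain D where D: "\<And>q. countable (D q)" "\<And>q. AE t in time_measure T. g t q \<in> closure (D q)"
      by metis
    show "strongly_measurable T (\<lambda>t. g t (s i t))"
    proof (rule strongly_measurableI)
      show "countable (\<Union>q\<in>?I. D q)" by (rule countable_UN[OF countable_finite[OF fin] D(1)])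
      have "AE t in time_measure T. \<forall>q\<in>?I. g t q \<in> closure (D q)"
        by (subst AE_ball_countable[OF countable_finite[OF fin]]) (blast intro: D(2))
      then show "AE t in time_measure T. g t (s i t) \<in> closure (\<Union>q\<in>?I. D q)"
        using AE_space
      proof eventually_elim
        fix t assume t: "\<forall>q\<in>?I. g t q \<in> closure (D q)" "t \<in> space (time_measure T)"
        have "D (s i t) \<subseteq> (\<Union>q\<in>?I. D q)" using t(2) by blast
        then show "g t (s i t) \<in> closure (\<Union>q\<in>?I. D q)" using t closure_mono by blast
      qed
      show "(\<lambda>t. norm (g t (s i t) - c)) \<in> borel_measurable (time_measure T)" for c
      proof (rule measurable_compose_countable'[where f="\<lambda>q t. norm (g t q - c)" and g="s i" and I="?I"])
        show "(\<lambda>t. norm (g t q - c)) \<in> borel_measurable (time_measure T)" for q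
          by (rule strongly_measurable_norm_diff[OF g])
        show "s i \<in> measurable (time_measure T) (count_space ?I)"
          unfolding measurable_count_space_eq2[OF fin] using simple_functionD(2)[OF s(1)] by blast
      qed (use fin countable_finite in auto)
    qed
  qed
qed

section \<open>Essentially bounded functions\<close>

lemma AE_time_ex:
  assumes "T > 0" "AE t in time_measure T. P t"
  shows "\<exists>t\<in>{0..T}. P t"
proof (rule ccontr)
  assume "\<not> ?thesis"
  then have "AE t in time_measure T. \<not> P t" by (intro AE_I2) auto
  then have "AE t in time_measure T. False"
    using assms(2) by eventually_elim auto
  then have "emeasure (time_measure T) (space (time_measure T)) = 0"
    unfolding ae_filter_eq_bot_iff[symmetric] trivial_limit_def .
  then show False using \<open>T > 0\<close> by (simp add: emeasure_restrict_space)
qed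

text \<open>For members of \<^const>\<open>Linf\<close> and \<open>T > 0\<close> the essential supremum is finite and nonnegative, so that its
  conversion to a real number in \<^const>\<open>Linf_norm\<close> is harmless.\<close>

lemma
  assumes T: "T > 0" and f: "f \<in> Linf T"
  shows AE_Linf_norm: "AE t in time_measure T. norm (f t) \<le> Linf_norm T f"
    and Linf_norm_le: "(AE t in time_measure T. norm (f t) \<le> C) \<Longrightarrow> Linf_norm T f \<le> C"
    and Linf_norm_nonneg: "0 \<le> Linf_norm T f"
proof -
  let ?\<phi> = "\<lambda>t. ereal (norm (f t))"
  have "(\<lambda>t. norm (f t)) \<in> borel_measurable (time_measure T)"
    using strongly_measurable_norm_diff[of T f 0] f by (simp add: Linf_def)
  then have meas: "?\<phi> \<in> borel_measurable (time_measure T)" by measurable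
  obtain B where "AE t in time_measure T. norm (f t) \<le> B" using f by (auto simp: Linf_def)
  then have "esssup (time_measure T) ?\<phi> \<le> ereal B" by (intro esssup_I meas) simp
  moreover have ae: "AE t in time_measure T. ?\<phi> t \<le> esssup (time_measure T) ?\<phi>" by (rule esssup_AE)
  then obtain t where "ereal (norm (f t)) \<le> esssup (time_measure T) ?\<phi>" using AE_time_ex[OF T] by blast
  then have "0 \<le> esssup (time_measure T) ?\<phi>" by (rule order_trans[rotated]) simp
  ultimately have eq: "esssup (time_measure T) ?\<phi> = ereal (Linf_norm T f)" and nn: "0 \<le> Linf_norm T f"
    unfolding Linf_norm_def by (cases "esssup (time_measure T) ?\<phi>"; simp)+
  show "0 \<le> Linf_norm T f" by (rule nn)
  show "AE t in time_measure T. norm (f t) \<le> Linf_norm T f" using ae by (simp add: eq)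
  show "Linf_norm T f \<le> C" if "AE t in time_measure T. norm (f t) \<le> C"
    using esssup_I[OF meas, of "ereal C"] that by (simp add: eq)
qed

lemma LinfI:
  "strongly_measurable T f \<Longrightarrow> AE t in time_measure T. norm (f t) \<le> M \<Longrightarrow> f \<in> Linf T"
  by (auto simp: Linf_def)

lemma LinfD: "f \<in> Linf T \<Longrightarrow> strongly_measurable T f"
  by (simp add: Linf_def)

lemma Linf_add: "f \<in> Linf T \<Longrightarrow> g \<in> Linf T \<Longrightarrow> (\<lambda>t. f t + g t) \<in> Linf T"
proof -
  assume fg: "f \<in> Linf T" "g \<in> Linf T"
  then obtain A B where AB: "AE t in time_measure T. norm (f t) \<le> A" "AE t in time_measure T. norm (g t) \<le> B"
    by (auto simp: Linf_def)
  have "AE t in time_measure T. norm (f t + g t) \<le> A + B"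
    using AB by eventually_elim (metis norm_triangle_mono)
  then show ?thesis using fg by (intro LinfI strongly_measurable_add) (auto dest: LinfD)
qed

lemma Linf_diff: "f \<in> Linf T \<Longrightarrow> g \<in> Linf T \<Longrightarrow> (\<lambda>t. f t - g t) \<in> Linf T"
proof -
  assume fg: "f \<in> Linf T" "g \<in> Linf T"
  then obtain A B where AB: "AE t in time_measure T. norm (f t) \<le> A" "AE t in time_measure T. norm (g t) \<le> B"
    by (auto simp: Linf_def)
  have "AE t in time_measure T. norm (f t - g t) \<le> A + B"
    using AB by eventually_elim (metis add_mono norm_triangle_ineq4 order_trans)
  then show ?thesis using fg by (intro LinfI strongly_measurable_diff) (auto dest: LinfD)
qed

text \<open>Completeness of \<open>L\<^sup>\<infinity>\<close> for sequences with geometrically decreasing steps; the limit is constructed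
  pointwise because functions are not identified almost everywhere.\<close>

lemma Linf_geometric_limit:
  fixes u :: "nat \<Rightarrow> real \<Rightarrow> 'a::{real_normed_vector, complete_space}"
  assumes T: "T > 0" and u: "\<And>n. u n \<in> Linf T"
    and step: "\<And>n. Linf_norm T (\<lambda>t. u (Suc n) t - u n t) \<le> c * (1/2) ^ n"
  obtains v where "v \<in> Linf T" "\<And>n. Linf_norm T (\<lambda>t. v t - u n t) \<le> 2 * c * (1/2) ^ n"
proof -
  have "AE t in time_measure T. norm (u (Suc n) t - u n t) \<le> c * (1/2) ^ n" for n
    using AE_Linf_norm[OF T Linf_diff[OF u u], of "Suc n" n] by eventually_elim (use step[of n] in linarith)
  then have ae: "AE t in time_measure T. \<forall>n. norm (u (Suc n) t - u n t) \<le> c * (1/2) ^ n"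
    by (simp add: AE_all_countable)
  define v where "v t = lim (\<lambda>n. u n t)" for t
  have main: "AE t in time_measure T. (\<lambda>n. u n t) \<longlonglongrightarrow> v t \<and> (\<forall>n. norm (v t - u n t) \<le> 2 * c * (1/2) ^ n)"
    using ae
  proof eventually_elim
    fix t assume t: "\<forall>n. norm (u (Suc n) t - u n t) \<le> c * (1/2) ^ n"
    have c: "0 \<le> c" using t[rule_format, of 0] norm_ge_zero[of "u (Suc 0) t - u 0 t"] by (simp del: norm_ge_zero)
    have tail: "norm (u (n + k) t - u n t) \<le> 2 * c * (1/2) ^ n * (1 - (1/2) ^ k)" for n k
    proof (induction k)
      case (Suc k)
      have "norm (u (n + Suc k) t - u n t) \<le> norm (u (Suc (n + k)) t - u (n + k) t) + norm (u (n + k) t - u n t)"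
        using norm_triangle_ineq[of "u (Suc (n + k)) t - u (n + k) t" "u (n + k) t - u n t"] by simp
      also have "\<dots> \<le> c * (1/2) ^ (n + k) + 2 * c * (1/2) ^ n * (1 - (1/2) ^ k)"
        using t Suc by (intro add_mono) auto
      also have "\<dots> = 2 * c * (1/2) ^ n * (1 - (1/2) ^ Suc k)" by (simp add: power_add algebra_simps)
      finally show ?case .
    qed simp
    have tail': "norm (u m t - u n t) \<le> 2 * c * (1/2) ^ n" if "n \<le> m" for m n
    proof -
      have "norm (u m t - u n t) \<le> 2 * c * (1/2) ^ n * (1 - (1/2) ^ (m - n))"
        using tail[of n "m - n"] that by simp
      also have "\<dots> \<le> 2 * c * (1/2) ^ n * 1" using c by (intro mult_left_mono) auto
      finally show ?thesis by simp
    qed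
    have small: "(\<lambda>n. 2 * c * (1/2) ^ n) \<longlonglongrightarrow> 0"
      by (intro tendsto_mult_right_zero LIMSEQ_power_zero) simp
    have "Cauchy (\<lambda>n. u n t)"
    proof (rule metric_CauchyI)
      fix e :: real assume "e > 0"
      then obtain N where N: "2 * c * (1/2) ^ N < e / 2"
        using order_tendstoD(2)[OF small, of "e/2"] by (auto simp: eventually_sequentially)
      have "dist (u m t) (u n t) < e" if "m \<ge> N" "n \<ge> N" for m n
        using tail'[OF that(1)] tail'[OF that(2)] N dist_triangle2[of "u m t" "u n t" "u N t"]
        by (simp add: dist_norm)
      then show "\<exists>M. \<forall>m\<ge>M. \<forall>n\<ge>M. dist (u m t) (u n t) < e" by blast
    qed
    then have lim: "(\<lambda>n. u n t) \<longlonglongrightarrow> v t"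
      unfolding v_def Cauchy_convergent_iff convergent_LIMSEQ_iff .
    moreover have "norm (v t - u n t) \<le> 2 * c * (1/2) ^ n" for n
    proof (rule LIMSEQ_le_const2)
      show "(\<lambda>m. norm (u m t - u n t)) \<longlonglongrightarrow> norm (v t - u n t)" by (intro tendsto_intros lim)
      show "\<exists>N. \<forall>m\<ge>N. norm (u m t - u n t) \<le> 2 * c * (1/2) ^ n" using tail' by blast
    qed
    ultimately show "(\<lambda>n. u n t) \<longlonglongrightarrow> v t \<and> (\<forall>n. norm (v t - u n t) \<le> 2 * c * (1/2) ^ n)" by blast
  qed
  have vm: "strongly_measurable T v"
    by (rule strongly_measurable_AE_limit[of T u]) (use main LinfD[OF u] in \<open>auto elim: eventually_mono\<close>)
  have "AE t in time_measure T. norm (v t - u 0 t) \<le> 2 * c * (1/2) ^ 0"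
    using main by (rule eventually_mono) blast
  then have "(\<lambda>t. v t - u 0 t) \<in> Linf T"
    by (rule LinfI[OF strongly_measurable_diff[OF vm LinfD[OF u]]])
  from Linf_add[OF this u[of 0]] have v: "v \<in> Linf T" by simp
  have "Linf_norm T (\<lambda>t. v t - u n t) \<le> 2 * c * (1/2) ^ n" for n
  proof (rule Linf_norm_le[OF T Linf_diff[OF v u]])
    show "AE t in time_measure T. norm (v t - u n t) \<le> 2 * c * (1/2) ^ n"
      using main by (rule eventually_mono) blast
  qed
  with v show ?thesis by (rule that)
qed

text \<open>Banach's fixed point theorem on a closed ball of \<open>L\<^sup>\<infinity>\<close>, with a fixed point up to a null set.\<close>

lemma Linf_contraction_fixpoint:
  fixes v :: "real \<Rightarrow> 'a::{real_normed_vector, complete_space}"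
  assumes T: "T > 0" and v: "v \<in> Linf T" and \<rho>: "\<rho> \<ge> 0"
    and self: "\<And>u. u \<in> Linf T \<Longrightarrow> Linf_norm T (\<lambda>t. u t - v t) \<le> \<rho> \<Longrightarrow>
        \<Phi> u \<in> Linf T \<and> Linf_norm T (\<lambda>t. \<Phi> u t - v t) \<le> \<rho>"
    and contr: "\<And>u w. u \<in> Linf T \<Longrightarrow> w \<in> Linf T \<Longrightarrow>
        Linf_norm T (\<lambda>t. u t - v t) \<le> \<rho> \<Longrightarrow> Linf_norm T (\<lambda>t. w t - v t) \<le> \<rho> \<Longrightarrow>
        Linf_norm T (\<lambda>t. \<Phi> u t - \<Phi> w t) \<le> 1/2 * Linf_norm T (\<lambda>t. u t - w t)"
  obtains u where "u \<in> Linf T" "Linf_norm T (\<lambda>t. u t - v t) \<le> \<rho>" "AE t in time_measure T. u t = \<Phi> u t"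
proof -
  define w where "w n = (\<Phi> ^^ n) v" for n
  have w0: "w 0 = v" and wS: "w (Suc n) = \<Phi> (w n)" for n by (simp_all add: w_def)
  have tri: "Linf_norm T (\<lambda>t. a t - c t) \<le> Linf_norm T (\<lambda>t. a t - b t) + Linf_norm T (\<lambda>t. b t - c t)"
    if "a \<in> Linf T" "b \<in> Linf T" "c \<in> Linf T" for a b c :: "real \<Rightarrow> 'a"
  proof (rule Linf_norm_le[OF T Linf_diff[OF that(1,3)]])
    show "AE t in time_measure T. norm (a t - c t) \<le> Linf_norm T (\<lambda>t. a t - b t) + Linf_norm T (\<lambda>t. b t - c t)"
      using AE_Linf_norm[OF T Linf_diff[OF that(1,2)]] AE_Linf_norm[OF T Linf_diff[OF that(2,3)]]
    proof eventually_elim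
      fix t assume "norm (a t - b t) \<le> Linf_norm T (\<lambda>t. a t - b t)" "norm (b t - c t) \<le> Linf_norm T (\<lambda>t. b t - c t)"
      then show "norm (a t - c t) \<le> Linf_norm T (\<lambda>t. a t - b t) + Linf_norm T (\<lambda>t. b t - c t)"
        using norm_triangle_ineq[of "a t - b t" "b t - c t"] by simp
    qed
  qed
  have "Linf_norm T (\<lambda>t. v t - v t) \<le> 0"
    by (rule Linf_norm_le[OF T Linf_diff[OF v v]]) simp
  then have w: "w n \<in> Linf T \<and> Linf_norm T (\<lambda>t. w n t - v t) \<le> \<rho>" for n
    by (induction n) (use v \<rho> self in \<open>auto simp: w0 wS\<close>)
  have step: "Linf_norm T (\<lambda>t. w (Suc n) t - w n t) \<le> Linf_norm T (\<lambda>t. w 1 t - w 0 t) * (1/2) ^ n" for n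
  proof (induction n)
    case (Suc n)
    have "Linf_norm T (\<lambda>t. w (Suc (Suc n)) t - w (Suc n) t) \<le> 1/2 * Linf_norm T (\<lambda>t. w (Suc n) t - w n t)"
      using contr[of "w (Suc n)" "w n"] w[of "Suc n"] w[of n] unfolding wS by blast
    then show ?case using Suc by simp
  qed simp
  define c where "c = Linf_norm T (\<lambda>t. w 1 t - w 0 t)"
  obtain u where u: "u \<in> Linf T" "\<And>n. Linf_norm T (\<lambda>t. u t - w n t) \<le> 2 * c * (1/2) ^ n"
    using Linf_geometric_limit[of T w c, OF T] w step unfolding c_def by blast
  have small: "(\<lambda>n. K * (1/2) ^ n) \<longlonglongrightarrow> 0" for K :: real
    by (intro tendsto_mult_right_zero LIMSEQ_power_zero) simp
  have u\<rho>: "Linf_norm T (\<lambda>t. u t - v t) \<le> \<rho>"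
  proof (rule LIMSEQ_le_const)
    show "(\<lambda>n. 2 * c * (1/2) ^ n + \<rho>) \<longlonglongrightarrow> \<rho>" using tendsto_add[OF small tendsto_const] by simp
    show "\<exists>N. \<forall>n\<ge>N. Linf_norm T (\<lambda>t. u t - v t) \<le> 2 * c * (1/2) ^ n + \<rho>"
      using tri[OF u(1) _ v] w u(2) by (meson add_mono order_trans)
  qed
  have \<Phi>u: "\<Phi> u \<in> Linf T" using self[OF u(1) u\<rho>] by blast
  have "Linf_norm T (\<lambda>t. u t - \<Phi> u t) \<le> 0"
  proof (rule LIMSEQ_le_const)
    show "(\<lambda>n. 2 * c * (1/2) ^ n) \<longlonglongrightarrow> 0" by (rule small)
    have "Linf_norm T (\<lambda>t. u t - \<Phi> u t) \<le> 2 * c * (1/2) ^ n" for n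
    proof -
      have "Linf_norm T (\<lambda>t. u t - \<Phi> u t)
          \<le> Linf_norm T (\<lambda>t. u t - w (Suc n) t) + Linf_norm T (\<lambda>t. w (Suc n) t - \<Phi> u t)"
        by (rule tri) (use u w \<Phi>u in auto)
      also have "Linf_norm T (\<lambda>t. w (Suc n) t - \<Phi> u t) \<le> 1/2 * Linf_norm T (\<lambda>t. w n t - u t)"
        unfolding wS by (rule contr) (use u u\<rho> w in auto)
      also have "Linf_norm T (\<lambda>t. w n t - u t) = Linf_norm T (\<lambda>t. u t - w n t)"
        by (simp add: Linf_norm_def norm_minus_commute)
      finally show ?thesis using u(2)[of n] u(2)[of "Suc n"] by simp
    qed
    then show "\<exists>N. \<forall>n\<ge>N. Linf_norm T (\<lambda>t. u t - \<Phi> u t) \<le> 2 * c * (1/2) ^ n" by blast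
  qed
  have "AE t in time_measure T. u t = \<Phi> u t"
    using AE_Linf_norm[OF T Linf_diff[OF u(1) \<Phi>u]]
  proof eventually_elim
    fix t assume "norm (u t - \<Phi> u t) \<le> Linf_norm T (\<lambda>t. u t - \<Phi> u t)"
    with \<open>Linf_norm T (\<lambda>t. u t - \<Phi> u t) \<le> 0\<close> have "norm (u t - \<Phi> u t) \<le> 0" by linarith
    then show "u t = \<Phi> u t" by simp
  qed
  with u(1) u\<rho> show ?thesis by (rule that)
qed

lemma Linf_locally_lipschitzE:
  assumes lip: "Linf_locally_lipschitz T \<Phi>" and T: "T > 0" and u: "u \<in> Linf T"
  obtains r L where "r > 0" "0 \<le> L"
    "\<And>v w. v \<in> Linf T \<Longrightarrow> w \<in> Linf T \<Longrightarrow> Linf_norm T (\<lambda>t. v t - u t) < r \<Longrightarrow> Linf_norm T (\<lambda>t. w t - u t) < r \<Longrightarrow>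
       AE t in time_measure T. norm (\<Phi> v t - \<Phi> w t) \<le> L * Linf_norm T (\<lambda>t. v t - w t)"
proof -
  obtain r L where r: "r > 0" and L: "\<And>v w. v \<in> Linf T \<Longrightarrow> w \<in> Linf T \<Longrightarrow>
        Linf_norm T (\<lambda>t. v t - u t) < r \<Longrightarrow> Linf_norm T (\<lambda>t. w t - u t) < r \<Longrightarrow>
        Linf_norm T (\<lambda>t. \<Phi> v t - \<Phi> w t) \<le> L * Linf_norm T (\<lambda>t. v t - w t)"
    using lip u unfolding Linf_locally_lipschitz_def by blast
  show ?thesis
  proof (rule that[of r "\<bar>L\<bar>"])
    fix v w assume vw: "v \<in> Linf T" "w \<in> Linf T" "Linf_norm T (\<lambda>t. v t - u t) < r" "Linf_norm T (\<lambda>t. w t - u t) < r"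
    have "(\<lambda>t. \<Phi> v t - \<Phi> w t) \<in> Linf T"
      using lip vw(1,2) by (intro Linf_diff) (auto simp: Linf_locally_lipschitz_def)
    moreover have "L * Linf_norm T (\<lambda>t. v t - w t) \<le> \<bar>L\<bar> * Linf_norm T (\<lambda>t. v t - w t)"
      using Linf_norm_nonneg[OF T Linf_diff[OF vw(1,2)]] by (intro mult_right_mono) auto
    ultimately show "AE t in time_measure T. norm (\<Phi> v t - \<Phi> w t) \<le> \<bar>L\<bar> * Linf_norm T (\<lambda>t. v t - w t)"
      using AE_Linf_norm[OF T, of "\<lambda>t. \<Phi> v t - \<Phi> w t"] L[OF vw]
      by (auto elim!: eventually_mono)
  qed (use r in auto)
qed

section \<open>The Hamiltonian and its gradient in the control\<close>

text \<open>Turns the bounds of the pairings on bounded sets into boundedness of these linear maps, from which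
  their Lipschitz continuity on bounded sets follows.\<close>

lemma linear_bound_from_ball:
  fixes g :: "'a::real_normed_vector \<Rightarrow> 'b::real_normed_vector"
  assumes g: "\<And>c z. g (c *\<^sub>R z) = c *\<^sub>R g z" and M: "\<And>z. norm z \<le> 1 \<Longrightarrow> norm (g z) \<le> M"
  shows "norm (g z) \<le> M * norm z"
proof -
  have "g z = norm z *\<^sub>R g (sgn z)" unfolding g[symmetric] by (cases "z = 0") (simp_all add: sgn_div_norm)
  moreover have "norm (g (sgn z)) \<le> M" by (rule M) (simp add: norm_sgn)
  ultimately show ?thesis by (simp add: mult.commute[of M] mult_left_mono)
qed

text \<open>The part of the hypotheses that concerns \<open>\<A>\<close>, \<open>\<B>\<close>, \<open>F\<close> pointwise in time, without the evolution
  equations.\<close>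

locale control_pairings =
  fixes T :: real
    and \<A> :: "real \<Rightarrow> 'v::{real_inner, complete_space} \<Rightarrow> 'v \<Rightarrow> 'e::{real_inner, complete_space} \<Rightarrow> real"
    and \<B> :: "real \<Rightarrow> 'v \<Rightarrow> 'e \<Rightarrow> real"
    and F :: "real \<Rightarrow> 'e \<Rightarrow> 'v \<Rightarrow> real"
  assumes bilinear_\<A>: "\<And>t v. bilinear (\<lambda>x y. \<A> t x y v)"
    and linear_\<B>: "\<And>t v. linear (\<lambda>y. \<B> t y v)"
    and F_differentiable: "\<And>p. (\<lambda>(t, v, x). F t v x) differentiable (at p)"
    and C2_\<A>: "\<And>t x y. class_C2 (\<lambda>v. \<A> t x y v)"
    and C2_\<B>: "\<And>t y. class_C2 (\<lambda>v. \<B> t y v)"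
    and C2_F: "\<And>t x. class_C2 (\<lambda>v. F t v x)"
    and second_derivatives_bounded:
      "\<And>R. \<exists>M. \<forall>t\<in>{0..T}. \<forall>x y v. norm x \<le> R \<longrightarrow> norm y \<le> R \<longrightarrow>
           norm (fderiv (fderiv (\<lambda>w. \<A> t x y w)) v) \<le> M \<and>
           norm (fderiv (fderiv (\<lambda>w. \<B> t y w)) v) \<le> M"
    and C1_gradient_F: "\<And>t v. class_C1 (\<lambda>x. gradient (\<lambda>w. F t w x) v)"
    and second_derivative_F_bounded:
      "\<exists>k::real \<Rightarrow> real. mono_on {0..} k \<and>
           (\<forall>t\<in>{0..T}. \<forall>v x. norm (fderiv (fderiv (\<lambda>w. F t w x)) v) \<le> k (norm x))"
    and measurable_gradient_\<A>: "\<And>x y v. strongly_measurable T (\<lambda>t. gradient (\<lambda>w. \<A> t x y w) v)"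
    and measurable_gradient_\<B>: "\<And>y v. strongly_measurable T (\<lambda>t. gradient (\<lambda>w. \<B> t y w) v)"
    and first_derivatives_bounded:
      "\<And>R. \<exists>M. \<forall>t\<in>{0..T}. \<forall>x y v. norm x \<le> R \<longrightarrow> norm y \<le> R \<longrightarrow> norm v \<le> R \<longrightarrow>
           norm (fderiv (\<lambda>w. \<A> t x y w) v) \<le> M \<and> norm (fderiv (\<lambda>w. \<B> t y w) v) \<le> M \<and>
           norm (fderiv (\<lambda>z. gradient (\<lambda>w. F t w z) v) x) \<le> M"
begin

definition hamiltonian :: "real \<Rightarrow> 'v \<Rightarrow> 'v \<Rightarrow> 'e \<Rightarrow> real"
  where "hamiltonian t x y w = F t w x - \<A> t x y w + \<B> t y w"

text \<open>The gradient of the Hamiltonian in the control, written as the integrand in \<^const>\<open>Delta\<close>.\<close>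

definition slope :: "real \<Rightarrow> 'v \<Rightarrow> 'v \<Rightarrow> 'e \<Rightarrow> 'e"
  where "slope t x y w = - gradient (\<lambda>w. \<A> t x y w - \<B> t y w) w + gradient (\<lambda>w. F t w x) w"

lemma differentiable_\<A>: "\<A> t x y differentiable (at v)"
  using C2_\<A>[of t x y] by (simp add: class_C2_def class_C1_def)

lemma differentiable_\<B>: "\<B> t y differentiable (at v)"
  using C2_\<B>[of t y] by (simp add: class_C2_def class_C1_def)

lemma differentiable_F: "(\<lambda>w. F t w x) differentiable (at v)"
  using C2_F[of t x] by (simp add: class_C2_def class_C1_def)

lemma slope_split:
  "slope t x y w = gradient (\<B> t y) w - gradient (\<A> t x y) w + gradient (\<lambda>w. F t w x) w"
proof -
  have "gradient (\<lambda>w. \<A> t x y w - \<B> t y w) w = gradient (\<A> t x y) w - gradient (\<B> t y) w"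
    by (intro gradient_eqI GDERIV_diff gderiv_gradient differentiable_\<A> differentiable_\<B>)
  then show ?thesis by (simp add: slope_def)
qed

lemma differentiable_hamiltonian: "hamiltonian t x y differentiable (at w)"
  unfolding hamiltonian_def[abs_def]
  by (intro differentiable_add differentiable_diff differentiable_F differentiable_\<A> differentiable_\<B>)

lemma gradient_hamiltonian: "gradient (hamiltonian t x y) w = slope t x y w"
  unfolding hamiltonian_def[abs_def] slope_split
  by (rule gradient_eqI, rule GDERIV_subst,
      rule GDERIV_add[OF GDERIV_diff[OF gderiv_gradient[OF differentiable_F] gderiv_gradient[OF differentiable_\<A>]] gderiv_gradient[OF differentiable_\<B>]])
    simp

lemma gradient_\<A>_diff_left: "gradient (\<A> t (x - x') y) w = gradient (\<A> t x y) w - gradient (\<A> t x' y) w"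
proof -
  have "\<A> t (x - x') y = (\<lambda>w. \<A> t x y w - \<A> t x' y w)"
    using bilinear_lsub[OF bilinear_\<A>] by (intro ext) simp
  then show ?thesis by (auto intro!: gradient_eqI GDERIV_diff gderiv_gradient differentiable_\<A>)
qed

lemma gradient_\<A>_diff_right: "gradient (\<A> t x (y - y')) w = gradient (\<A> t x y) w - gradient (\<A> t x y') w"
proof -
  have "\<A> t x (y - y') = (\<lambda>w. \<A> t x y w - \<A> t x y' w)"
    using bilinear_rsub[OF bilinear_\<A>] by (intro ext) simp
  then show ?thesis by (auto intro!: gradient_eqI GDERIV_diff gderiv_gradient differentiable_\<A>)
qed

lemma gradient_\<B>_diff: "gradient (\<B> t (y - y')) w = gradient (\<B> t y) w - gradient (\<B> t y') w"
proof -
  have "\<B> t (y - y') = (\<lambda>w. \<B> t y w - \<B> t y' w)"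
    using linear_diff[OF linear_\<B>] by (intro ext) simp
  then show ?thesis by (auto intro!: gradient_eqI GDERIV_diff gderiv_gradient differentiable_\<B>)
qed

lemma gradient_\<A>_scale_left: "gradient (\<A> t (c *\<^sub>R x) y) w = c *\<^sub>R gradient (\<A> t x y) w"
proof -
  have "\<A> t (c *\<^sub>R x) y = (\<lambda>w. c * \<A> t x y w)"
    using bilinear_lmul[OF bilinear_\<A>] by (intro ext) simp
  then show ?thesis by (auto intro!: gradient_eqI GDERIV_cmult gderiv_gradient differentiable_\<A>)
qed

lemma gradient_\<A>_scale_right: "gradient (\<A> t x (c *\<^sub>R y)) w = c *\<^sub>R gradient (\<A> t x y) w"
proof -
  have "\<A> t x (c *\<^sub>R y) = (\<lambda>w. c * \<A> t x y w)"
    using bilinear_rmul[OF bilinear_\<A>] by (intro ext) simp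
  then show ?thesis by (auto intro!: gradient_eqI GDERIV_cmult gderiv_gradient differentiable_\<A>)
qed

lemma gradient_\<B>_scale: "gradient (\<B> t (c *\<^sub>R y)) w = c *\<^sub>R gradient (\<B> t y) w"
proof -
  have "\<B> t (c *\<^sub>R y) = (\<lambda>w. c * \<B> t y w)"
    using linear_scale[OF linear_\<B>] by (intro ext) simp
  then show ?thesis by (auto intro!: gradient_eqI GDERIV_cmult gderiv_gradient differentiable_\<B>)
qed

lemma gradient_F_lipschitz_control:
  obtains K where "0 \<le> K" "\<And>t x v w. t \<in> {0..T} \<Longrightarrow> norm x \<le> R \<Longrightarrow>
    norm (gradient (\<lambda>u. F t u x) v - gradient (\<lambda>u. F t u x) w) \<le> K * norm (v - w)"
proof -
  obtain k :: "real \<Rightarrow> real" where k: "mono_on {0..} k"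
      "\<And>t v x. t \<in> {0..T} \<Longrightarrow> norm (fderiv (fderiv (\<lambda>w. F t w x)) v) \<le> k (norm x)"
    using second_derivative_F_bounded by (elim exE conjE) blast
  show ?thesis
  proof (rule that[of "max 0 (k R)"])
    fix t x v w assume t: "t \<in> {0..T}" and x: "norm (x::'v) \<le> R"
    have "0 \<le> R" using x norm_ge_zero order_trans by blast
    then have "k (norm x) \<le> k R" using x mono_onD[OF k(1), of "norm x" R] by simp
    then have "norm (fderiv (fderiv (\<lambda>w. F t w x)) z) \<le> max 0 (k R)" for z
      using k(2)[OF t, of x z] by linarith
    then show "norm (gradient (\<lambda>u. F t u x) v - gradient (\<lambda>u. F t u x) w) \<le> max 0 (k R) * norm (v - w)"
      by (rule gradient_lipschitz[OF C2_F])
  qed simp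
qed

lemma gradient_F_lipschitz_state:
  obtains K where "0 \<le> K" "\<And>t v x x'. t \<in> {0..T} \<Longrightarrow> norm v \<le> R \<Longrightarrow> norm x \<le> R \<Longrightarrow> norm x' \<le> R \<Longrightarrow>
    norm (gradient (\<lambda>u. F t u x) v - gradient (\<lambda>u. F t u x') v) \<le> K * norm (x - x')"
proof -
  from first_derivatives_bounded obtain M where
    "\<forall>t\<in>{0..T}. \<forall>x y v. norm x \<le> R \<longrightarrow> norm y \<le> R \<longrightarrow> norm v \<le> R \<longrightarrow>
           norm (fderiv (\<lambda>w. \<A> t x y w) v) \<le> M \<and> norm (fderiv (\<lambda>w. \<B> t y w) v) \<le> M \<and>
           norm (fderiv (\<lambda>z. gradient (\<lambda>w. F t w z) v) x) \<le> M" ..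
  then have M: "norm (fderiv (\<lambda>z. gradient (\<lambda>w. F t w z) v) x) \<le> M"
    if "t \<in> {0..T}" "norm x \<le> R" "norm v \<le> R" for t x v
    using that by blast
  show ?thesis
  proof (rule that[of "max 0 M"])
    fix t v x x' assume *: "t \<in> {0..T}" "norm (v::'e) \<le> R" "norm (x::'v) \<le> R" "norm (x'::'v) \<le> R"
    show "norm (gradient (\<lambda>u. F t u x) v - gradient (\<lambda>u. F t u x') v) \<le> max 0 M * norm (x - x')"
      by (rule class_C1_lipschitz[OF C1_gradient_F convex_cball[of 0 R]])
        (use M[OF *(1)] * in \<open>auto simp: le_max_iff_disj\<close>)
  qed simp
qed

text \<open>Continuity in time comes from the joint differentiability of \<open>F\<close> and the uniform bound on
  \<open>D\<^sub>v\<^sub>v F\<close>. It is the source of the measurability and of the boundedness of \<open>\<nabla>\<^sub>v F\<close> on the time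
  interval.\<close>

lemma gradient_F_continuous_time: "continuous_on {0..T} (\<lambda>t. gradient (\<lambda>w. F t w x) v)"
  unfolding continuous_on_def
proof
  fix t assume "t \<in> {0..T}"
  obtain K where K0: "0 \<le> K" "\<And>t z v w. t \<in> {0..T} \<Longrightarrow> norm z \<le> norm x \<Longrightarrow>
      norm (gradient (\<lambda>u. F t u z) v - gradient (\<lambda>u. F t u z) w) \<le> K * norm (v - w)"
    by (fact gradient_F_lipschitz_control[of "norm x"])
  note K = K0(1) K0(2)[OF _ order_refl]
  show "((\<lambda>t. gradient (\<lambda>w. F t w x) v) \<longlongrightarrow> gradient (\<lambda>w. F t w x) v) (at t within {0..T})"
    by (rule gradient_tendsto_parameter[where f="\<lambda>t w. F t w x", OF differentiable_partial[OF F_differentiable] differentiable_F K])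
qed

text \<open>Compactness of the time interval bounds the gradient at the origin, and the Lipschitz estimates carry
  the bound to balls.\<close>

lemma gradient_F_bounded:
  obtains M where "0 \<le> M" "\<And>t v x. t \<in> {0..T} \<Longrightarrow> norm v \<le> R \<Longrightarrow> norm x \<le> R \<Longrightarrow>
    norm (gradient (\<lambda>u. F t u x) v) \<le> M"
proof -
  have "bounded ((\<lambda>t. gradient (\<lambda>w. F t w 0) 0) ` {0..T})"
    by (intro compact_imp_bounded compact_continuous_image gradient_F_continuous_time compact_Icc)
  then obtain M0 where M0: "M0 > 0" "\<And>t. t \<in> {0..T} \<Longrightarrow> norm (gradient (\<lambda>w. F t w 0) 0) \<le> M0"
    unfolding bounded_pos by blast
  obtain K where K: "0 \<le> K" "\<And>t x v w. t \<in> {0..T} \<Longrightarrow> norm x \<le> R \<Longrightarrow>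
      norm (gradient (\<lambda>u. F t u x) v - gradient (\<lambda>u. F t u x) w) \<le> K * norm (v - w)"
    by (fact gradient_F_lipschitz_control[of R])
  obtain L where L: "0 \<le> L" "\<And>t v x x'. t \<in> {0..T} \<Longrightarrow> norm v \<le> R \<Longrightarrow> norm x \<le> R \<Longrightarrow> norm x' \<le> R \<Longrightarrow>
      norm (gradient (\<lambda>u. F t u x) v - gradient (\<lambda>u. F t u x') v) \<le> L * norm (x - x')"
    by (fact gradient_F_lipschitz_state[of R])
  show ?thesis
  proof (rule that[of "M0 + L * \<bar>R\<bar> + K * \<bar>R\<bar>"])
    show "0 \<le> M0 + L * \<bar>R\<bar> + K * \<bar>R\<bar>" using M0 K L by simp
    fix t v x assume *: "t \<in> {0..T}" "norm (v::'e) \<le> R" "norm (x::'v) \<le> R"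
    have R: "0 \<le> R" using *(2) norm_ge_zero order_trans by blast
    let ?g = "\<lambda>x v. gradient (\<lambda>u. F t u x) v"
    have "norm (?g x v - ?g x 0) \<le> K * \<bar>R\<bar>"
      using K(2)[OF *(1,3), of v 0] mult_left_mono[OF *(2) K(1)] R by simp
    moreover have "norm (?g x 0 - ?g 0 0) \<le> L * \<bar>R\<bar>"
      using L(2)[OF *(1) _ *(3), of 0 0] mult_left_mono[OF *(3) L(1)] R by simp
    ultimately show "norm (?g x v) \<le> M0 + L * \<bar>R\<bar> + K * \<bar>R\<bar>"
      using M0(2)[OF *(1)] norm_triangle_sub[of "?g x v" "?g x 0"] norm_triangle_sub[of "?g x 0" "?g 0 0"]
      by linarith
  qed
qed

lemma gradient_pairings_bounded:
  obtains M where "0 \<le> M" "\<And>t x y v. t \<in> {0..T} \<Longrightarrow> norm x \<le> R \<Longrightarrow> norm y \<le> R \<Longrightarrow> norm v \<le> R \<Longrightarrow>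
    norm (gradient (\<A> t x y) v) \<le> M" "\<And>t y v. t \<in> {0..T} \<Longrightarrow> norm y \<le> R \<Longrightarrow> norm v \<le> R \<Longrightarrow>
    norm (gradient (\<B> t y) v) \<le> M"
proof -
  from first_derivatives_bounded obtain M where
    "\<forall>t\<in>{0..T}. \<forall>x y v. norm x \<le> R \<longrightarrow> norm y \<le> R \<longrightarrow> norm v \<le> R \<longrightarrow>
           norm (fderiv (\<lambda>w. \<A> t x y w) v) \<le> M \<and> norm (fderiv (\<lambda>w. \<B> t y w) v) \<le> M \<and>
           norm (fderiv (\<lambda>z. gradient (\<lambda>w. F t w z) v) x) \<le> M" ..
  then have M: "norm (fderiv (\<A> t x y) v) \<le> M \<and> norm (fderiv (\<B> t y) v) \<le> M"
    if "t \<in> {0..T}" "norm x \<le> R" "norm y \<le> R" "norm v \<le> R" for t x y v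
    using that by simp
  show ?thesis
  proof (rule that[of "max 0 M"])
    fix t x y v assume *: "t \<in> {0..T}" "norm (x::'v) \<le> R" "norm (y::'v) \<le> R" "norm (v::'e) \<le> R"
    show "norm (gradient (\<A> t x y) v) \<le> max 0 M"
      using norm_gradient_le_fderiv[OF differentiable_\<A>[of t x y v]] M[OF *] by linarith
  next
    fix t y v assume *: "t \<in> {0..T}" "norm (y::'v) \<le> R" "norm (v::'e) \<le> R"
    show "norm (gradient (\<B> t y) v) \<le> max 0 M"
      using norm_gradient_le_fderiv[OF differentiable_\<B>[of t y v]] M[OF *(1,2,2,3)] by linarith
  qed simp
qed

lemma slope_bounded:
  obtains M where "0 \<le> M" "\<And>t x y v. t \<in> {0..T} \<Longrightarrow> norm x \<le> R \<Longrightarrow> norm y \<le> R \<Longrightarrow> norm v \<le> R \<Longrightarrow>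
    norm (slope t x y v) \<le> M"
proof -
  obtain M where M: "0 \<le> M" "\<And>t x y v. t \<in> {0..T} \<Longrightarrow> norm x \<le> R \<Longrightarrow> norm y \<le> R \<Longrightarrow> norm v \<le> R \<Longrightarrow>
    norm (gradient (\<A> t x y) v) \<le> M" "\<And>t y v. t \<in> {0..T} \<Longrightarrow> norm y \<le> R \<Longrightarrow> norm v \<le> R \<Longrightarrow>
    norm (gradient (\<B> t y) v) \<le> M"
    by (fact gradient_pairings_bounded[of R])
  obtain N where N: "0 \<le> N" "\<And>t v x. t \<in> {0..T} \<Longrightarrow> norm v \<le> R \<Longrightarrow> norm x \<le> R \<Longrightarrow>
    norm (gradient (\<lambda>u. F t u x) v) \<le> N"
    by (fact gradient_F_bounded[of R])
  show ?thesis
  proof (rule that[of "M + M + N"])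
    fix t x y v assume *: "t \<in> {0..T}" "norm (x::'v) \<le> R" "norm (y::'v) \<le> R" "norm (v::'e) \<le> R"
    show "norm (slope t x y v) \<le> M + M + N"
      unfolding slope_split using M(2)[OF *] M(3)[OF *(1,3,4)] N(2)[OF *(1,4,2)]
      by (intro order_trans[OF norm_triangle_ineq] add_mono order_trans[OF norm_triangle_ineq4]) auto
  qed (use M N in simp)
qed

lemma slope_lipschitz_state:
  obtains L where "0 \<le> L" "\<And>t x x' y y' v. t \<in> {0..T} \<Longrightarrow> norm x \<le> R \<Longrightarrow> norm x' \<le> R \<Longrightarrow>
    norm y \<le> R \<Longrightarrow> norm y' \<le> R \<Longrightarrow> norm v \<le> R \<Longrightarrow>
    norm (slope t x y v - slope t x' y' v) \<le> L * (norm (x - x') + norm (y - y'))"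
proof -
  \<comment> \<open>Unit vectors must belong to the ball in which the pairings are bounded.\<close>
  let ?R = "max 1 R"
  obtain M where M: "0 \<le> M" "\<And>t x y v. t \<in> {0..T} \<Longrightarrow> norm x \<le> ?R \<Longrightarrow> norm y \<le> ?R \<Longrightarrow> norm v \<le> ?R \<Longrightarrow>
    norm (gradient (\<A> t x y) v) \<le> M" "\<And>t y v. t \<in> {0..T} \<Longrightarrow> norm y \<le> ?R \<Longrightarrow> norm v \<le> ?R \<Longrightarrow>
    norm (gradient (\<B> t y) v) \<le> M"
    by (fact gradient_pairings_bounded[of ?R])
  obtain K where K: "0 \<le> K" "\<And>t v x x'. t \<in> {0..T} \<Longrightarrow> norm v \<le> R \<Longrightarrow> norm x \<le> R \<Longrightarrow> norm x' \<le> R \<Longrightarrow>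
      norm (gradient (\<lambda>u. F t u x) v - gradient (\<lambda>u. F t u x') v) \<le> K * norm (x - x')"
    by (fact gradient_F_lipschitz_state[of R])
  show ?thesis
  proof (rule that[of "2 * M + K"])
    fix t x x' y y' v
    assume *: "t \<in> {0..T}" "norm (x::'v) \<le> R" "norm (x'::'v) \<le> R" "norm (y::'v) \<le> R" "norm (y'::'v) \<le> R" "norm (v::'e) \<le> R"
    have 1: "norm (gradient (\<A> t (x - x') y) v) \<le> M * norm (x - x')"
      by (rule linear_bound_from_ball[of "\<lambda>z. gradient (\<A> t z y) v"])
        (use M(2)[OF *(1)] * in \<open>auto simp: gradient_\<A>_scale_left\<close>)
    have 2: "norm (gradient (\<A> t x' (y - y')) v) \<le> M * norm (y - y')"
      by (rule linear_bound_from_ball[of "\<lambda>z. gradient (\<A> t x' z) v"])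
        (use M(2)[OF *(1)] * in \<open>auto simp: gradient_\<A>_scale_right\<close>)
    have 3: "norm (gradient (\<B> t (y - y')) v) \<le> M * norm (y - y')"
      by (rule linear_bound_from_ball[of "\<lambda>z. gradient (\<B> t z) v"])
        (use M(3)[OF *(1)] * in \<open>auto simp: gradient_\<B>_scale\<close>)
    have "slope t x y v - slope t x' y' v = gradient (\<B> t (y - y')) v
        - gradient (\<A> t (x - x') y) v - gradient (\<A> t x' (y - y')) v
        + (gradient (\<lambda>u. F t u x) v - gradient (\<lambda>u. F t u x') v)"
      by (simp add: slope_split gradient_\<A>_diff_left gradient_\<A>_diff_right gradient_\<B>_diff)
    also have "norm \<dots> \<le> M * norm (y - y') + M * norm (x - x') + M * norm (y - y') + K * norm (x - x')"
      by (intro order_trans[OF norm_triangle_ineq] add_mono order_trans[OF norm_triangle_ineq4] 1 2 3 K(2)[OF *(1,6,2,3)])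
    also have "\<dots> \<le> (2 * M + K) * (norm (x - x') + norm (y - y'))"
      using M(1) K(1) by (simp add: algebra_simps)
    finally show "norm (slope t x y v - slope t x' y' v) \<le> (2 * M + K) * (norm (x - x') + norm (y - y'))" .
  qed (use M K in simp)
qed

text \<open>Global in the controls \<open>v\<close>, \<open>w\<close>, because the second derivatives are bounded uniformly in the control.
  The uniqueness of updates depends on this.\<close>

lemma slope_lipschitz_control:
  obtains L where "0 \<le> L" "\<And>t x y v w. t \<in> {0..T} \<Longrightarrow> norm x \<le> R \<Longrightarrow> norm y \<le> R \<Longrightarrow>
    norm (slope t x y v - slope t x y w) \<le> L * norm (v - w)"
proof -
  from second_derivatives_bounded obtain M where
    "\<forall>t\<in>{0..T}. \<forall>x y v. norm x \<le> R \<longrightarrow> norm y \<le> R \<longrightarrow>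
           norm (fderiv (fderiv (\<lambda>w. \<A> t x y w)) v) \<le> M \<and>
           norm (fderiv (fderiv (\<lambda>w. \<B> t y w)) v) \<le> M" ..
  then have M: "norm (fderiv (fderiv (\<A> t x y)) v) \<le> M \<and> norm (fderiv (fderiv (\<B> t y)) v) \<le> M"
    if "t \<in> {0..T}" "norm x \<le> R" "norm y \<le> R" for t x y v
    using that by simp
  obtain K where K: "0 \<le> K" "\<And>t x v w. t \<in> {0..T} \<Longrightarrow> norm x \<le> R \<Longrightarrow>
      norm (gradient (\<lambda>u. F t u x) v - gradient (\<lambda>u. F t u x) w) \<le> K * norm (v - w)"
    by (fact gradient_F_lipschitz_control[of R])
  show ?thesis
  proof (rule that[of "max 0 M + max 0 M + K"])
    fix t x y v w assume *: "t \<in> {0..T}" "norm (x::'v) \<le> R" "norm (y::'v) \<le> R"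
    have 1: "norm (gradient (\<A> t x y) v - gradient (\<A> t x y) w) \<le> max 0 M * norm (v - w)"
      by (rule gradient_lipschitz[OF C2_\<A>]) (use M[OF *] in \<open>auto simp: le_max_iff_disj\<close>)
    have 2: "norm (gradient (\<B> t y) v - gradient (\<B> t y) w) \<le> max 0 M * norm (v - w)"
      by (rule gradient_lipschitz[OF C2_\<B>]) (use M[OF *] in \<open>auto simp: le_max_iff_disj\<close>)
    have "slope t x y v - slope t x y w = (gradient (\<B> t y) v - gradient (\<B> t y) w)
        - (gradient (\<A> t x y) v - gradient (\<A> t x y) w)
        + (gradient (\<lambda>u. F t u x) v - gradient (\<lambda>u. F t u x) w)"
      by (simp add: slope_split)
    also have "norm \<dots> \<le> max 0 M * norm (v - w) + max 0 M * norm (v - w) + K * norm (v - w)"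
      by (intro order_trans[OF norm_triangle_ineq] add_mono order_trans[OF norm_triangle_ineq4] 1 2 K(2)[OF *(1,2)])
    finally show "norm (slope t x y v - slope t x y w) \<le> (max 0 M + max 0 M + K) * norm (v - w)"
      by (simp add: algebra_simps)
  qed (use K in simp)
qed

lemma slope_measurable: "strongly_measurable T (\<lambda>t. slope t x y v)"
  unfolding slope_split
  by (intro strongly_measurable_add strongly_measurable_diff measurable_gradient_\<A> measurable_gradient_\<B>
      strongly_measurable_continuous gradient_F_continuous_time)

lemma slope_continuous:
  assumes t: "t \<in> {0..T}"
  shows "continuous_on UNIV (\<lambda>(x, y, v). slope t x y v)"
proof -
  have "isCont (\<lambda>(x, y, v). slope t x y v) (x, y, v)" for x y v
    unfolding isCont_def tendsto_iff eventually_at dist_norm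
  proof (intro allI impI)
    fix e :: real assume e: "e > 0"
    define R where "R = norm x + norm y + norm v + 1"
    obtain L where L: "0 \<le> L" "\<And>t x x' y y' v. t \<in> {0..T} \<Longrightarrow> norm x \<le> R \<Longrightarrow> norm x' \<le> R \<Longrightarrow>
      norm y \<le> R \<Longrightarrow> norm y' \<le> R \<Longrightarrow> norm v \<le> R \<Longrightarrow>
      norm (slope t x y v - slope t x' y' v) \<le> L * (norm (x - x') + norm (y - y'))"
      by (fact slope_lipschitz_state[of R])
    obtain M where M: "0 \<le> M" "\<And>t x y v w. t \<in> {0..T} \<Longrightarrow> norm x \<le> R \<Longrightarrow> norm y \<le> R \<Longrightarrow>
      norm (slope t x y v - slope t x y w) \<le> M * norm (v - w)"
      by (fact slope_lipschitz_control[of R])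
    define d where "d = min 1 (e / (2 * L + M + 1))"
    have q: "0 < 2 * L + M + 1" using L(1) M(1) by simp
    have d: "d > 0" "d \<le> 1" "(2 * L + M) * d < e"
    proof -
      show d0: "d > 0" using e q by (simp add: d_def)
      show "d \<le> 1" by (simp add: d_def)
      have "(2 * L + M + 1) * d \<le> (2 * L + M + 1) * (e / (2 * L + M + 1))"
        unfolding d_def using q by (intro mult_left_mono min.cobounded2) simp
      also have "\<dots> = e" using q by simp
      finally show "(2 * L + M) * d < e" using d0 by (simp add: algebra_simps)
    qed
    have "norm (slope t x' y' v' - slope t x y v) < e" if "norm ((x', y', v') - (x, y, v)) < d" for x' y' v'
    proof -
      have n: "norm (x' - x) < d" "norm (y' - y) < d" "norm (v' - v) < d"
        using that norm_fst_le[of "x' - x" "(y' - y, v' - v)"] norm_snd_le[of "(y' - y, v' - v)" "x' - x"]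
          norm_fst_le[of "y' - y" "v' - v"] norm_snd_le[of "v' - v" "y' - y"] by simp_all
      have R: "norm x \<le> R" "norm y \<le> R" "norm v \<le> R" "norm x' \<le> R" "norm y' \<le> R"
        using n d norm_triangle_sub[of x' x] norm_triangle_sub[of y' y]
          norm_ge_zero[of x] norm_ge_zero[of y] norm_ge_zero[of v] unfolding R_def by linarith+
      have "norm (slope t x' y' v' - slope t x y v)
          \<le> norm (slope t x' y' v' - slope t x' y' v) + norm (slope t x' y' v - slope t x y v)"
        using norm_triangle_ineq[of "slope t x' y' v' - slope t x' y' v" "slope t x' y' v - slope t x y v"] by simp
      also have "\<dots> \<le> M * norm (v' - v) + L * (norm (x' - x) + norm (y' - y))"
        by (intro add_mono M(2)[OF t] L(2)[OF t] R)
      also have "\<dots> \<le> M * d + L * (d + d)"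
        using n L(1) M(1) by (intro add_mono mult_left_mono) auto
      also have "\<dots> < e" using d(3) by (simp add: algebra_simps)
      finally show ?thesis .
    qed
    then show "\<exists>d>0. \<forall>p\<in>UNIV. p \<noteq> (x, y, v) \<and> norm (p - (x, y, v)) < d \<longrightarrow>
        norm ((case p of (x, y, v) \<Rightarrow> slope t x y v) - (case (x, y, v) of (x, y, v) \<Rightarrow> slope t x y v)) < e"
      using d(1) by (intro exI[of _ d]) auto
  qed
  then show ?thesis by (simp add: continuous_on_eq_continuous_at split_paired_all)
qed

lemma slope_segment_continuous: "t \<in> {0..T} \<Longrightarrow> continuous_on {0..1} (\<lambda>l. slope t x y (v + l *\<^sub>R (v' - v)))"
  by (rule continuous_on_compose2[OF slope_continuous, of t "{0..1}" "\<lambda>l. (x, y, v + l *\<^sub>R (v' - v))", simplified])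
    (auto intro!: continuous_intros)

section \<open>The averaged control gradient\<close>

abbreviation \<Delta> where "\<Delta> \<equiv> Delta \<A> \<B> F"

lemma Delta_eq: "\<Delta> v' v t x y = integral {0..1} (\<lambda>l. slope t x y (v + l *\<^sub>R (v' - v)))"
  unfolding Delta_def slope_def ..

lemma has_integral_Delta:
  "t \<in> {0..T} \<Longrightarrow> ((\<lambda>l. slope t x y (v + l *\<^sub>R (v' - v))) has_integral \<Delta> v' v t x y) {0..1}"
  unfolding Delta_eq by (intro integrable_integral integrable_continuous_hilbert slope_segment_continuous)

text \<open>The fundamental theorem of calculus along the segment from \<open>v\<close> to \<open>v'\<close>: the average of the gradient
  recovers the increment of the Hamiltonian.\<close>

lemma inner_Delta:
  assumes "t \<in> {0..T}"
  shows "(v' - v) \<bullet> \<Delta> v' v t x y = hamiltonian t x y v' - hamiltonian t x y v"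
proof (rule has_integral_unique)
  show "((\<lambda>l. (v' - v) \<bullet> slope t x y (v + l *\<^sub>R (v' - v))) has_integral (v' - v) \<bullet> \<Delta> v' v t x y) {0..1}"
    using has_integral_linear[OF has_integral_Delta[OF assms] bounded_linear_inner_right[of "v' - v"]]
    by (simp add: o_def)
  show "((\<lambda>l. (v' - v) \<bullet> slope t x y (v + l *\<^sub>R (v' - v))) has_integral hamiltonian t x y v' - hamiltonian t x y v) {0..1}"
    using has_integral_gradient_segment[OF differentiable_hamiltonian, of v' v t x y] by (simp add: gradient_hamiltonian)
qed

lemma Delta_same: "\<Delta> v v t x y = slope t x y v"
  by (simp add: Delta_eq)

lemma Delta_bounded:
  obtains M where "0 \<le> M" "\<And>t x y v v'. t \<in> {0..T} \<Longrightarrow> norm x \<le> R \<Longrightarrow> norm y \<le> R \<Longrightarrow> norm v \<le> R \<Longrightarrow>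
    norm v' \<le> R \<Longrightarrow> norm (\<Delta> v' v t x y) \<le> M"
proof -
  obtain M where M: "0 \<le> M" "\<And>t x y v. t \<in> {0..T} \<Longrightarrow> norm x \<le> R \<Longrightarrow> norm y \<le> R \<Longrightarrow> norm v \<le> R \<Longrightarrow>
    norm (slope t x y v) \<le> M" by (fact slope_bounded[of R])
  show ?thesis
  proof (rule that[OF M(1)])
    fix t x y v v' assume *: "t \<in> {0..T}" "norm (x::'v) \<le> R" "norm (y::'v) \<le> R" "norm (v::'e) \<le> R" "norm (v'::'e) \<le> R"
    have "norm (\<Delta> v' v t x y) \<le> M * measure lborel {0..1::real}"
      by (rule has_integral_bound_real[OF M(1) _ has_integral_Delta[OF *(1)], of "{}"])
        (use M(2) * norm_segment_le[where 'a='e] in auto)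
    then show "norm (\<Delta> v' v t x y) \<le> M" by simp
  qed
qed

lemma Delta_lipschitz_control:
  obtains L where "0 \<le> L" "\<And>t x y v v' w w'. t \<in> {0..T} \<Longrightarrow> norm x \<le> R \<Longrightarrow> norm y \<le> R \<Longrightarrow>
    norm (\<Delta> v' v t x y - \<Delta> w' w t x y) \<le> L * (norm (v' - w') + norm (v - w))"
proof -
  obtain L where L: "0 \<le> L" "\<And>t x y v w. t \<in> {0..T} \<Longrightarrow> norm x \<le> R \<Longrightarrow> norm y \<le> R \<Longrightarrow>
    norm (slope t x y v - slope t x y w) \<le> L * norm (v - w)" by (fact slope_lipschitz_control[of R])
  show ?thesis
  proof (rule that[OF L(1)])
    fix t x y v v' w w' assume *: "t \<in> {0..T}" "norm (x::'v) \<le> R" "norm (y::'v) \<le> R"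
    have "norm (\<Delta> v' v t x y - \<Delta> w' w t x y) \<le> L * (norm (v' - w') + norm (v - w)) * measure lborel {0..1::real}"
    proof (rule has_integral_bound_real[OF _ _ has_integral_diff[OF has_integral_Delta[OF *(1)] has_integral_Delta[OF *(1)]], of _ "{}"])
      fix l :: real assume l: "l \<in> {0..1} - {}"
      have "(v + l *\<^sub>R (v' - v)) - (w + l *\<^sub>R (w' - w)) = l *\<^sub>R (v' - w') + (1 - l) *\<^sub>R (v - w)"
        by (simp add: algebra_simps)
      also have "norm \<dots> \<le> norm (v' - w') + norm (v - w)"
        using l by (intro order_trans[OF norm_triangle_ineq] add_mono) (auto simp: mult_left_le_one_le)
      finally have "norm ((v + l *\<^sub>R (v' - v)) - (w + l *\<^sub>R (w' - w))) \<le> norm (v' - w') + norm (v - w)" .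
      from order_trans[OF L(2)[OF *] mult_left_mono[OF this L(1)]]
      show "norm (slope t x y (v + l *\<^sub>R (v' - v)) - slope t x y (w + l *\<^sub>R (w' - w)))
        \<le> L * (norm (v' - w') + norm (v - w))" .
    qed (use L(1) in auto)
    then show "norm (\<Delta> v' v t x y - \<Delta> w' w t x y) \<le> L * (norm (v' - w') + norm (v - w))" by simp
  qed
qed

text \<open>Only one of the two segments is required to lie in the ball: the states are changed along the segment
  from \<open>v\<close> to \<open>v'\<close>, and the segments are exchanged by the global estimate.\<close>

lemma Delta_lipschitz:
  obtains L where "0 \<le> L" "\<And>t x x' y y' v v' w w'. t \<in> {0..T} \<Longrightarrow> norm x \<le> R \<Longrightarrow> norm x' \<le> R \<Longrightarrow>
    norm y \<le> R \<Longrightarrow> norm y' \<le> R \<Longrightarrow> norm v \<le> R \<Longrightarrow> norm v' \<le> R \<Longrightarrow>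
    norm (\<Delta> v' v t x y - \<Delta> w' w t x' y') \<le> L * (norm (x - x') + norm (y - y') + norm (v' - w') + norm (v - w))"
proof -
  obtain L where L: "0 \<le> L" "\<And>t x x' y y' v. t \<in> {0..T} \<Longrightarrow> norm x \<le> R \<Longrightarrow> norm x' \<le> R \<Longrightarrow>
    norm y \<le> R \<Longrightarrow> norm y' \<le> R \<Longrightarrow> norm v \<le> R \<Longrightarrow>
    norm (slope t x y v - slope t x' y' v) \<le> L * (norm (x - x') + norm (y - y'))"
    by (fact slope_lipschitz_state[of R])
  obtain M where M: "0 \<le> M" "\<And>t x y v v' w w'. t \<in> {0..T} \<Longrightarrow> norm x \<le> R \<Longrightarrow> norm y \<le> R \<Longrightarrow>
    norm (\<Delta> v' v t x y - \<Delta> w' w t x y) \<le> M * (norm (v' - w') + norm (v - w))"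
    by (fact Delta_lipschitz_control[of R])
  show ?thesis
  proof (rule that[of "L + M"])
    fix t x x' y y' v v' w w' assume *: "t \<in> {0..T}" "norm (x::'v) \<le> R" "norm (x'::'v) \<le> R" "norm (y::'v) \<le> R" "norm (y'::'v) \<le> R"
      and v: "norm (v::'e) \<le> R" "norm (v'::'e) \<le> R"
    have "norm (\<Delta> v' v t x y - \<Delta> v' v t x' y') \<le> L * (norm (x - x') + norm (y - y')) * measure lborel {0..1::real}"
      by (rule has_integral_bound_real[OF _ _ has_integral_diff[OF has_integral_Delta[OF *(1)] has_integral_Delta[OF *(1)]], of _ "{}"])
        (use L * v norm_segment_le[where 'a='e] in auto)
    moreover have "norm (\<Delta> v' v t x' y' - \<Delta> w' w t x' y') \<le> M * (norm (v' - w') + norm (v - w))"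
      by (rule M(2)[OF *(1,3,5)])
    ultimately have "norm (\<Delta> v' v t x y - \<Delta> w' w t x' y')
        \<le> L * (norm (x - x') + norm (y - y')) + M * (norm (v' - w') + norm (v - w))"
      using norm_triangle_ineq[of "\<Delta> v' v t x y - \<Delta> v' v t x' y'" "\<Delta> v' v t x' y' - \<Delta> w' w t x' y'"] by simp
    also have "\<dots> \<le> (L + M) * (norm (x - x') + norm (y - y') + norm (v' - w') + norm (v - w))"
      using L(1) M(1) by (simp add: algebra_simps)
    finally show "norm (\<Delta> v' v t x y - \<Delta> w' w t x' y') \<le> \<dots>" .
  qed (use L M in simp)
qed

lemma Delta_measurable:
  assumes "strongly_measurable T u" "strongly_measurable T v" "strongly_measurable T x" "strongly_measurable T y"
  shows "strongly_measurable T (\<lambda>t. \<Delta> (u t) (v t) t (x t) (y t))"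
proof (rule strongly_measurable_AE_limit[where f="\<lambda>n t. \<Sum>i<Suc n. (1 / real (Suc n)) *\<^sub>R
      slope t (x t) (y t) (v t + (real i / real (Suc n)) *\<^sub>R (u t - v t))"])
  have sl: "strongly_measurable T (\<lambda>t. slope t (x t) (y t) (v t + l *\<^sub>R (u t - v t)))" for l
  proof -
    have "strongly_measurable T (\<lambda>t. case (x t, y t, v t + l *\<^sub>R (u t - v t)) of (x, y, v) \<Rightarrow> slope t x y v)"
    proof (rule strongly_measurable_caratheodory[where g="\<lambda>t (x, y, v). slope t x y v"
          and p="\<lambda>t. (x t, y t, v t + l *\<^sub>R (u t - v t))"])
      show "strongly_measurable T (\<lambda>t. case p of (x, y, v) \<Rightarrow> slope t x y v)" for p
        using slope_measurable by (simp add: split_def)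
      show "strongly_measurable T (\<lambda>t. (x t, y t, v t + l *\<^sub>R (u t - v t)))"
        by (intro strongly_measurable_Pair strongly_measurable_add strongly_measurable_scaleR strongly_measurable_diff assms)
    qed (rule slope_continuous)
    then show ?thesis by simp
  qed
  have sum: "strongly_measurable T (\<lambda>t. \<Sum>i<k. c *\<^sub>R slope t (x t) (y t) (v t + (real i / n) *\<^sub>R (u t - v t)))" for k c n
    by (induction k) (auto intro!: strongly_measurable_add strongly_measurable_scaleR sl strongly_measurable_const)
  show "strongly_measurable T (\<lambda>t. \<Sum>i<Suc n. (1 / real (Suc n)) *\<^sub>R
      slope t (x t) (y t) (v t + (real i / real (Suc n)) *\<^sub>R (u t - v t)))" for n
    by (rule sum)
  show "AE t in time_measure T. (\<lambda>n. \<Sum>i<Suc n. (1 / real (Suc n)) *\<^sub>R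
      slope t (x t) (y t) (v t + (real i / real (Suc n)) *\<^sub>R (u t - v t))) \<longlonglongrightarrow> \<Delta> (u t) (v t) t (x t) (y t)"
    unfolding Delta_eq
  proof (rule AE_I2)
    fix t assume "t \<in> space (time_measure T)"
    then have "t \<in> {0..T}" by simp
    from riemann_sums_tendsto[OF slope_segment_continuous[OF this]]
    show "(\<lambda>n. \<Sum>i<Suc n. (1 / real (Suc n)) *\<^sub>R
      slope t (x t) (y t) (v t + (real i / real (Suc n)) *\<^sub>R (u t - v t)))
      \<longlonglongrightarrow> integral {0..1} (\<lambda>l. slope t (x t) (y t) (v t + l *\<^sub>R (u t - v t)))" .
  qed
qed

end

section \<open>Comparison of the costs of two controls\<close>

locale control_problem = control_pairings T \<A> \<B> F
  for T :: real
    and \<A> :: "real \<Rightarrow> 'v::{real_inner, complete_space} \<Rightarrow> 'v \<Rightarrow> 'e::{real_inner, complete_space} \<Rightarrow> real"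
    and \<B> :: "real \<Rightarrow> 'v \<Rightarrow> 'e \<Rightarrow> real"
    and F :: "real \<Rightarrow> 'e \<Rightarrow> 'v \<Rightarrow> real" +
  fixes G :: "'v \<Rightarrow> real" and X0 :: 'v
    and X Y :: "(real \<Rightarrow> 'e) \<Rightarrow> (real \<Rightarrow> 'v)"
  assumes T_pos: "T > 0"
    and concave_G: "\<And>x x'. G x' - G x \<le> gradient G x \<bullet> (x' - x)"
    and concave_F: "\<And>t v x x'. F t v x' - F t v x \<le> gradient (\<lambda>z. F t v z) x \<bullet> (x' - x)"
    and state: "\<And>v. v \<in> Linf T \<Longrightarrow> state_solution T \<A> \<B> X0 v (X v)"
    and adjoint: "\<And>v. v \<in> Linf T \<Longrightarrow> adjoint_solution T \<A> F G v (X v) (Y v)"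
    and lipschitz_X: "Linf_locally_lipschitz T X" and lipschitz_Y: "Linf_locally_lipschitz T Y"
    and integrable_F: "\<And>v. v \<in> Linf T \<Longrightarrow> integrable (time_measure T) (\<lambda>t. F t (v t) (X v t))"
begin

abbreviation J where "J \<equiv> cost T F G X"

lemma X_Linf: "v \<in> Linf T \<Longrightarrow> X v \<in> Linf T" and Y_Linf: "v \<in> Linf T \<Longrightarrow> Y v \<in> Linf T"
  using lipschitz_X lipschitz_Y by (auto simp: Linf_locally_lipschitz_def)

text \<open>The state equations of \<open>v\<close> and \<open>v'\<close> are tested with \<open>Y v t\<close>, the adjoint equation of \<open>v\<close> with the
  difference of the states. Subtracting \<open>F\<close> from the Hamiltonian leaves the pairings \<open>-\<A> + \<B>\<close>, whose
  variation from \<open>v\<close> to \<open>v'\<close> at the state of \<open>v'\<close> is all that survives besides the gradient of \<open>F\<close>.\<close>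

lemma duality_derivative:
  assumes v: "v \<in> Linf T" and v': "v' \<in> Linf T"
  shows "AE t in time_measure T. ((\<lambda>t. Y v t \<bullet> (X v' t - X v t)) has_vector_derivative
      (hamiltonian t (X v' t) (Y v t) (v' t) - F t (v' t) (X v' t)) - (hamiltonian t (X v' t) (Y v t) (v t) - F t (v t) (X v' t))
      - gradient (F t (v t)) (X v t) \<bullet> (X v' t - X v t)) (at t within {0..T})"
proof -
  have "AE t in time_measure T. \<exists>X'. (X v has_vector_derivative X') (at t within {0..T}) \<and>
       (\<forall>Z. Z \<bullet> X' + \<A> t (X v t) Z (v t) = \<B> t Z (v t))"
    using state[OF v] by (simp add: state_solution_def)
  moreover have "AE t in time_measure T. \<exists>X'. (X v' has_vector_derivative X') (at t within {0..T}) \<and>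
       (\<forall>Z. Z \<bullet> X' + \<A> t (X v' t) Z (v' t) = \<B> t Z (v' t))"
    using state[OF v'] by (simp add: state_solution_def)
  moreover have "AE t in time_measure T. \<exists>Y'. (Y v has_vector_derivative Y') (at t within {0..T}) \<and>
       (\<forall>Z. Z \<bullet> Y' - \<A> t Z (Y v t) (v t) + Z \<bullet> gradient (\<lambda>x. F t (v t) x) (X v t) = 0)"
    using adjoint[OF v] by (simp add: adjoint_solution_def)
  ultimately show ?thesis
  proof eventually_elim
    fix t
    let ?y = "Y v t" and ?d = "X v' t - X v t"
    assume "\<exists>X'. (X v has_vector_derivative X') (at t within {0..T}) \<and>
       (\<forall>Z. Z \<bullet> X' + \<A> t (X v t) Z (v t) = \<B> t Z (v t))"
    then obtain X1 where X1: "(X v has_vector_derivative X1) (at t within {0..T})"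
       "?y \<bullet> X1 + \<A> t (X v t) ?y (v t) = \<B> t ?y (v t)" by blast
    assume "\<exists>X'. (X v' has_vector_derivative X') (at t within {0..T}) \<and>
       (\<forall>Z. Z \<bullet> X' + \<A> t (X v' t) Z (v' t) = \<B> t Z (v' t))"
    then obtain X2 where X2: "(X v' has_vector_derivative X2) (at t within {0..T})"
       "?y \<bullet> X2 + \<A> t (X v' t) ?y (v' t) = \<B> t ?y (v' t)" by blast
    assume "\<exists>Y'. (Y v has_vector_derivative Y') (at t within {0..T}) \<and>
       (\<forall>Z. Z \<bullet> Y' - \<A> t Z (Y v t) (v t) + Z \<bullet> gradient (\<lambda>x. F t (v t) x) (X v t) = 0)"
    then obtain Y1 where Y1: "(Y v has_vector_derivative Y1) (at t within {0..T})"
       "?d \<bullet> Y1 - \<A> t ?d ?y (v t) + ?d \<bullet> gradient (F t (v t)) (X v t) = 0" by blast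
    have "\<A> t ?d ?y (v t) = \<A> t (X v' t) ?y (v t) - \<A> t (X v t) ?y (v t)"
      using bilinear_lsub[OF bilinear_\<A>] by simp
    then have "?y \<bullet> (X2 - X1) + Y1 \<bullet> ?d =
      (hamiltonian t (X v' t) ?y (v' t) - F t (v' t) (X v' t)) - (hamiltonian t (X v' t) ?y (v t) - F t (v t) (X v' t))
      - gradient (F t (v t)) (X v t) \<bullet> ?d"
      using X1(2) X2(2) Y1(2) unfolding hamiltonian_def inner_commute[of Y1] inner_commute[of "gradient (F t (v t)) (X v t)"]
        inner_diff_right[of ?y] by linarith
    with bounded_bilinear.has_vector_derivative[OF bounded_bilinear_inner Y1(1) has_vector_derivative_diff[OF X2(1) X1(1)]]
    show "((\<lambda>t. Y v t \<bullet> (X v' t - X v t)) has_vector_derivative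
      (hamiltonian t (X v' t) ?y (v' t) - F t (v' t) (X v' t)) - (hamiltonian t (X v' t) ?y (v t) - F t (v t) (X v' t))
      - gradient (F t (v t)) (X v t) \<bullet> ?d) (at t within {0..T})"
      by simp
  qed
qed

text \<open>The central inequality. The derivative of the duality product \<open>\<phi>\<close> is added to the variation of \<open>F\<close>, so
  that the concavity of \<open>F\<close> can be used pointwise and only the sum is compared with \<open>q\<close>. The derivative of
  \<open>\<phi>\<close> is integrated in the sense of Henstock and Kurzweil, by the fundamental theorem of calculus; its
  separate terms, such as \<open>F\<close> at the control \<open>v\<close> and the state of \<open>v'\<close>, never have to be integrated.\<close>

lemma cost_difference_le:
  assumes v: "v \<in> Linf T" and v': "v' \<in> Linf T" and q: "integrable (time_measure T) q"
    and le: "AE t in time_measure T. (v' t - v t) \<bullet> \<Delta> (v' t) (v t) t (X v' t) (Y v t) \<le> q t"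
  shows "J v' - J v \<le> (LINT t|time_measure T. q t)"
proof -
  define \<phi> where "\<phi> t = Y v t \<bullet> (X v' t - X v t)" for t
  define \<psi> where "\<psi> t = (hamiltonian t (X v' t) (Y v t) (v' t) - F t (v' t) (X v' t)) - (hamiltonian t (X v' t) (Y v t) (v t) - F t (v t) (X v' t))
      - gradient (F t (v t)) (X v t) \<bullet> (X v' t - X v t)" for t
  have "AE t in time_measure T. (\<phi> has_vector_derivative \<psi> t) (at t within {0..T}) \<and>
      (v' t - v t) \<bullet> \<Delta> (v' t) (v t) t (X v' t) (Y v t) \<le> q t"
    using duality_derivative[OF v v'] le unfolding \<phi>_def[abs_def] \<psi>_def by eventually_elim simp
  then obtain N where N: "negligible N" "\<And>t. t \<in> {0..T} - N \<Longrightarrow> (\<phi> has_vector_derivative \<psi> t) (at t within {0..T})"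
      "\<And>t. t \<in> {0..T} - N \<Longrightarrow> (v' t - v t) \<bullet> \<Delta> (v' t) (v t) t (X v' t) (Y v t) \<le> q t"
    using AE_time_negligible by (metis (no_types, lifting))
  have "absolutely_continuous_on {0..T} \<phi>"
    unfolding \<phi>_def[abs_def]
    using state[OF v] state[OF v'] adjoint[OF v]
    by (intro absolutely_continuous_on_inner absolutely_continuous_on_diff) (simp_all add: state_solution_def adjoint_solution_def)
  then have "(\<psi> has_integral \<phi> T - \<phi> 0) {0..T}"
    using fundamental_theorem_of_calculus_absolutely_continuous[of 0 T \<phi> N \<psi>] N(1,2) T_pos by simp
  moreover have "\<phi> 0 = 0"
    using state[OF v] state[OF v'] by (simp add: \<phi>_def state_solution_def)
  ultimately have \<psi>: "(\<psi> has_integral \<phi> T) {0..T}" by simp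
  have meas: "{0..T} \<in> sets lebesgue" by simp
  note F = has_integral_integral_lebesgue_on[OF integrable_F meas]
  have int: "((\<lambda>t. F t (v' t) (X v' t) - F t (v t) (X v t) + \<psi> t) has_integral
      (LINT t|time_measure T. F t (v' t) (X v' t)) - (LINT t|time_measure T. F t (v t) (X v t)) + \<phi> T) {0..T}"
    by (intro has_integral_add has_integral_diff F v v' \<psi>)
  have pointwise: "F t (v' t) (X v' t) - F t (v t) (X v t) + \<psi> t \<le> q t" if t: "t \<in> {0..T} - N" for t
    using N(3)[OF t] inner_Delta[of t "v' t" "v t" "X v' t" "Y v t"] t concave_F[of t "v t" "X v' t" "X v t"]
    unfolding \<psi>_def by simp
  have "(LINT t|time_measure T. F t (v' t) (X v' t)) - (LINT t|time_measure T. F t (v t) (X v t)) + \<phi> T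
      \<le> (LINT t|time_measure T. q t)"
  proof (rule has_integral_le)
    show "((\<lambda>t. if t \<in> N then 0 else F t (v' t) (X v' t) - F t (v t) (X v t) + \<psi> t) has_integral
      (LINT t|time_measure T. F t (v' t) (X v' t)) - (LINT t|time_measure T. F t (v t) (X v t)) + \<phi> T) {0..T}"
      by (rule has_integral_spike[OF N(1) _ int]) simp
    show "((\<lambda>t. if t \<in> N then 0 else q t) has_integral (LINT t|time_measure T. q t)) {0..T}"
      by (rule has_integral_spike[OF N(1) _ has_integral_integral_lebesgue_on[OF q meas]]) simp
  qed (use pointwise in auto)
  moreover have "G (X v' T) - G (X v T) \<le> \<phi> T"
    using concave_G[of "X v' T" "X v T"] adjoint[OF v] by (simp add: \<phi>_def adjoint_solution_def)
  ultimately show ?thesis unfolding cost_def by linarith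
qed

section \<open>Existence of updates\<close>

text \<open>The fixed point map \<open>u \<mapsto> v - \<Delta>(u,v;t,X\<^sub>u,Y\<^sub>v)/\<theta>\<close> stays in a ball on which \<open>X\<close> is Lipschitz when \<open>\<theta>\<close>
  exceeds the bound of \<open>\<Delta>\<close> divided by the radius, and contracts by \<open>1/2\<close> when \<open>\<theta>\<close> exceeds twice the
  Lipschitz constant of \<open>u \<mapsto> \<Delta>(u,v;t,X\<^sub>u,Y\<^sub>v)\<close>. Uniqueness of the pointwise equation needs \<open>\<theta>\<close> above the global Lipschitz constant
  of \<open>\<Delta>\<close> in the control. The threshold \<open>\<theta>\<^sub>0\<close> is the sum of these three numbers and \<open>1\<close>.\<close>

lemma exists_update:
  assumes v: "v \<in> Linf T"
  shows "\<exists>\<theta>\<^sub>0>0. \<forall>\<theta>>\<theta>\<^sub>0. \<exists>v'\<in>Linf T. AE t in time_measure T. is_update \<A> \<B> F \<theta> t (v t) (X v' t) (Y v t) (v' t)"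
proof -
  obtain r L where r: "r > 0" and L: "0 \<le> L"
    "\<And>u w. u \<in> Linf T \<Longrightarrow> w \<in> Linf T \<Longrightarrow> Linf_norm T (\<lambda>t. u t - v t) < r \<Longrightarrow> Linf_norm T (\<lambda>t. w t - v t) < r \<Longrightarrow>
       AE t in time_measure T. norm (X u t - X w t) \<le> L * Linf_norm T (\<lambda>t. u t - w t)"
    by (rule Linf_locally_lipschitzE[OF lipschitz_X T_pos v]) blast
  define \<rho> where "\<rho> = r / 2"
  have \<rho>: "\<rho> > 0" "\<rho> < r" using r by (simp_all add: \<rho>_def)
  \<comment> \<open>A common bound for the values of \<open>v\<close>, \<open>u\<close>, \<open>X u\<close>, \<open>Y v\<close>, for all \<open>u\<close> in the ball of radius \<open>\<rho>\<close>.\<close>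
  define R where "R = Linf_norm T v + \<rho> + Linf_norm T (X v) + L * \<rho> + Linf_norm T (Y v)"
  have nn: "0 \<le> Linf_norm T v" "0 \<le> Linf_norm T (X v)" "0 \<le> Linf_norm T (Y v)" "0 \<le> L * \<rho>"
    using Linf_norm_nonneg[OF T_pos] v X_Linf Y_Linf L(1) \<rho> by auto
  have v0: "Linf_norm T (\<lambda>t. v t - v t) \<le> 0"
    by (rule Linf_norm_le[OF T_pos Linf_diff[OF v v]]) simp
  define S where "S = {u \<in> Linf T. Linf_norm T (\<lambda>t. u t - v t) \<le> \<rho>}"
  have bounds: "AE t in time_measure T. t \<in> {0..T} \<and> norm (u t) \<le> R \<and> norm (X u t) \<le> R \<and> norm (Y v t) \<le> R \<and> norm (v t) \<le> R"
    if "u \<in> S" for u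
  proof -
    have u: "u \<in> Linf T" "Linf_norm T (\<lambda>t. u t - v t) \<le> \<rho>" using that by (auto simp: S_def)
    have "AE t in time_measure T. norm (X u t - X v t) \<le> L * Linf_norm T (\<lambda>t. u t - v t)"
      by (rule L(2)[OF u(1) v]) (use u(2) v0 \<rho> in auto)
    then show ?thesis
      using AE_Linf_norm[OF T_pos v] AE_Linf_norm[OF T_pos X_Linf[OF v]] AE_Linf_norm[OF T_pos Y_Linf[OF v]]
        AE_Linf_norm[OF T_pos Linf_diff[OF u(1) v]] AE_space
    proof eventually_elim
      fix t
      assume *: "norm (X u t - X v t) \<le> L * Linf_norm T (\<lambda>t. u t - v t)" "norm (v t) \<le> Linf_norm T v"
        "norm (X v t) \<le> Linf_norm T (X v)" "norm (Y v t) \<le> Linf_norm T (Y v)"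
        "norm (u t - v t) \<le> Linf_norm T (\<lambda>t. u t - v t)" "t \<in> space (time_measure T)"
      have "L * Linf_norm T (\<lambda>t. u t - v t) \<le> L * \<rho>" using u(2) L(1) by (rule mult_left_mono)
      then have "norm (X u t) \<le> R" "norm (u t) \<le> R" "norm (Y v t) \<le> R" "norm (v t) \<le> R"
        using * u(2) nn \<rho> norm_triangle_sub[of "X u t" "X v t"] norm_triangle_sub[of "u t" "v t"]
        unfolding R_def by linarith+
      then show "t \<in> {0..T} \<and> norm (u t) \<le> R \<and> norm (X u t) \<le> R \<and> norm (Y v t) \<le> R \<and> norm (v t) \<le> R"
        using *(6) by simp
    qed
  qed
  obtain M where M: "0 \<le> M" "\<And>t x y v v'. t \<in> {0..T} \<Longrightarrow> norm x \<le> R \<Longrightarrow> norm y \<le> R \<Longrightarrow> norm v \<le> R \<Longrightarrow>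
    norm v' \<le> R \<Longrightarrow> norm (\<Delta> v' v t x y) \<le> M" by (fact Delta_bounded[of R])
  obtain K where K: "0 \<le> K" "\<And>t x y v v' w w'. t \<in> {0..T} \<Longrightarrow> norm x \<le> R \<Longrightarrow> norm y \<le> R \<Longrightarrow>
    norm (\<Delta> v' v t x y - \<Delta> w' w t x y) \<le> K * (norm (v' - w') + norm (v - w))"
    by (fact Delta_lipschitz_control[of R])
  obtain C where C: "0 \<le> C" "\<And>t x x' y y' v v' w w'. t \<in> {0..T} \<Longrightarrow> norm x \<le> R \<Longrightarrow> norm x' \<le> R \<Longrightarrow>
    norm y \<le> R \<Longrightarrow> norm y' \<le> R \<Longrightarrow> norm v \<le> R \<Longrightarrow> norm v' \<le> R \<Longrightarrow>
    norm (\<Delta> v' v t x y - \<Delta> w' w t x' y') \<le> C * (norm (x - x') + norm (y - y') + norm (v' - w') + norm (v - w))"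
    by (fact Delta_lipschitz[of R])
  define \<theta>\<^sub>0 where "\<theta>\<^sub>0 = 1 + M / \<rho> + K + 2 * C * (L + 1)"
  have parts: "0 \<le> M / \<rho>" "0 \<le> K" "0 \<le> 2 * C * (L + 1)" using M K C L \<rho> by auto
  have "\<exists>v'\<in>Linf T. AE t in time_measure T. is_update \<A> \<B> F \<theta> t (v t) (X v' t) (Y v t) (v' t)" if \<theta>: "\<theta> > \<theta>\<^sub>0" for \<theta>
  proof -
    have th: "\<theta> > 0" "M / \<rho> < \<theta>" "K < \<theta>" "2 * C * (L + 1) < \<theta>" using \<theta> parts unfolding \<theta>\<^sub>0_def by linarith+
    define \<Phi> where "\<Phi> u = (\<lambda>t. v t - (1 / \<theta>) *\<^sub>R \<Delta> (u t) (v t) t (X u t) (Y v t))" for u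
    have "\<Phi> u \<in> Linf T \<and> Linf_norm T (\<lambda>t. \<Phi> u t - v t) \<le> \<rho>" if "u \<in> S" for u
    proof -
      have u: "u \<in> Linf T" using that by (simp add: S_def)
      have meas: "strongly_measurable T (\<lambda>t. \<Phi> u t - v t)" "strongly_measurable T (\<Phi> u)"
        unfolding \<Phi>_def by (intro strongly_measurable_diff strongly_measurable_scaleR Delta_measurable LinfD u v X_Linf Y_Linf)+
      have ae: "AE t in time_measure T. norm (\<Phi> u t - v t) \<le> \<rho>"
        using bounds[OF that]
      proof eventually_elim
        fix t assume "t \<in> {0..T} \<and> norm (u t) \<le> R \<and> norm (X u t) \<le> R \<and> norm (Y v t) \<le> R \<and> norm (v t) \<le> R"
        then have "norm (\<Delta> (u t) (v t) t (X u t) (Y v t)) \<le> M" using M(2) by blast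
        also have "M \<le> \<theta> * \<rho>" using th(2) \<rho> by (simp add: pos_divide_less_eq less_imp_le)
        finally show "norm (\<Phi> u t - v t) \<le> \<rho>"
          using th(1) by (simp add: \<Phi>_def pos_divide_le_eq mult.commute)
      qed
      have d: "(\<lambda>t. \<Phi> u t - v t) \<in> Linf T" by (rule LinfI[OF meas(1) ae])
      with Linf_norm_le[OF T_pos d ae] Linf_add[OF d v] show ?thesis by simp
    qed
    note self = this
    have contr: "Linf_norm T (\<lambda>t. \<Phi> u t - \<Phi> w t) \<le> 1/2 * Linf_norm T (\<lambda>t. u t - w t)" if "u \<in> S" "w \<in> S" for u w
    proof (rule Linf_norm_le[OF T_pos])
      have uw: "u \<in> Linf T" "w \<in> Linf T" "Linf_norm T (\<lambda>t. u t - v t) < r" "Linf_norm T (\<lambda>t. w t - v t) < r"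
        using that \<rho> by (auto simp: S_def)
      let ?n = "Linf_norm T (\<lambda>t. u t - w t)"
      show "(\<lambda>t. \<Phi> u t - \<Phi> w t) \<in> Linf T" using self that by (intro Linf_diff) auto
      show "AE t in time_measure T. norm (\<Phi> u t - \<Phi> w t) \<le> 1/2 * ?n"
        using bounds[OF that(1)] bounds[OF that(2)] L(2)[OF uw] AE_Linf_norm[OF T_pos Linf_diff[OF uw(1,2)]]
      proof eventually_elim
        fix t
        assume *: "t \<in> {0..T} \<and> norm (u t) \<le> R \<and> norm (X u t) \<le> R \<and> norm (Y v t) \<le> R \<and> norm (v t) \<le> R"
          "t \<in> {0..T} \<and> norm (w t) \<le> R \<and> norm (X w t) \<le> R \<and> norm (Y v t) \<le> R \<and> norm (v t) \<le> R"
          "norm (X u t - X w t) \<le> L * ?n" "norm (u t - w t) \<le> ?n"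
        have n: "0 \<le> ?n" using *(4) norm_ge_zero order_trans by blast
        have "norm (\<Phi> u t - \<Phi> w t) = (1 / \<theta>) * norm (\<Delta> (u t) (v t) t (X u t) (Y v t) - \<Delta> (w t) (v t) t (X w t) (Y v t))"
        proof -
          have "\<Phi> u t - \<Phi> w t = - ((1 / \<theta>) *\<^sub>R (\<Delta> (u t) (v t) t (X u t) (Y v t) - \<Delta> (w t) (v t) t (X w t) (Y v t)))"
            by (simp add: \<Phi>_def scaleR_diff_right)
          then show ?thesis using th(1) by (simp add: norm_minus_cancel del: minus_diff_eq)
        qed
        also have "\<dots> \<le> (1 / \<theta>) * (C * ((L + 1) * ?n))"
        proof (rule mult_left_mono)
          have "norm (\<Delta> (u t) (v t) t (X u t) (Y v t) - \<Delta> (w t) (v t) t (X w t) (Y v t))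
            \<le> C * (norm (X u t - X w t) + norm (Y v t - Y v t) + norm (u t - w t) + norm (v t - v t))"
            using * by (intro C(2)) auto
          also have "\<dots> \<le> C * ((L + 1) * ?n)"
            using *(3,4) C(1) by (intro mult_left_mono) (auto simp: algebra_simps)
          finally show "norm (\<Delta> (u t) (v t) t (X u t) (Y v t) - \<Delta> (w t) (v t) t (X w t) (Y v t)) \<le> C * ((L + 1) * ?n)" .
        qed (use th in simp)
        also have "\<dots> = (2 * C * (L + 1)) / \<theta> * (1/2 * ?n)" by simp
        also have "\<dots> \<le> 1 * (1/2 * ?n)"
          using th n by (intro mult_right_mono) (auto simp: pos_divide_le_eq less_imp_le)
        finally show "norm (\<Phi> u t - \<Phi> w t) \<le> 1/2 * ?n" by simp
      qed
    qed
    obtain u where u: "u \<in> Linf T" "Linf_norm T (\<lambda>t. u t - v t) \<le> \<rho>" "AE t in time_measure T. u t = \<Phi> u t"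
      by (rule Linf_contraction_fixpoint[OF T_pos v less_imp_le[OF \<rho>(1)], of \<Phi>]) (use self contr in \<open>auto simp: S_def\<close>)
    then have "u \<in> S" by (simp add: S_def)
    have "AE t in time_measure T. is_update \<A> \<B> F \<theta> t (v t) (X u t) (Y v t) (u t)"
      using bounds[OF \<open>u \<in> S\<close>] u(3)
    proof eventually_elim
      fix t assume b: "t \<in> {0..T} \<and> norm (u t) \<le> R \<and> norm (X u t) \<le> R \<and> norm (Y v t) \<le> R \<and> norm (v t) \<le> R"
        and fp: "u t = \<Phi> u t"
      let ?D = "\<lambda>w. \<Delta> w (v t) t (X u t) (Y v t)"
      have "u t - v t = \<Phi> u t - v t" by (subst fp) (rule refl)
      also have "\<dots> = - ((1 / \<theta>) *\<^sub>R ?D (u t))" by (simp add: \<Phi>_def)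
      finally have "u t - v t = - ((1 / \<theta>) *\<^sub>R ?D (u t))" .
      then have sol: "?D (u t) = - (\<theta> *\<^sub>R (u t - v t))" using th(1) by simp
      have uniq: "w = u t" if w: "?D w = - (\<theta> *\<^sub>R (w - v t))" for w
      proof (rule ccontr)
        assume "w \<noteq> u t"
        have "\<theta> * norm (w - u t) = norm (?D w - ?D (u t))"
        proof -
          have "?D w - ?D (u t) = - (\<theta> *\<^sub>R (w - u t))" unfolding w sol by (simp add: algebra_simps)
          then show ?thesis using th(1) by (simp del: scaleR_right_diff_distrib minus_diff_eq)
        qed
        also have "\<dots> \<le> K * (norm (w - u t) + norm (v t - v t))" using b by (intro K(2)) auto
        finally have "\<theta> * norm (w - u t) \<le> K * norm (w - u t)" by simp
        then show False using th(3) \<open>w \<noteq> u t\<close> by simp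
      qed
      have ex1: "\<exists>!w. ?D w = - (\<theta> *\<^sub>R (w - v t))" using sol uniq by blast
      show "is_update \<A> \<B> F \<theta> t (v t) (X u t) (Y v t) (u t)"
        unfolding is_update_def using ex1 the1_equality[OF ex1 sol] by simp
    qed
    with u(1) show ?thesis by blast
  qed
  then show ?thesis using parts by (intro exI[of _ \<theta>\<^sub>0]) (auto simp: \<theta>\<^sub>0_def)
qed

section \<open>Decrease of the cost and stationary controls\<close>

lemma is_updateD: "is_update \<A> \<B> F \<theta> t v x y v' \<Longrightarrow> \<Delta> v' v t x y = - (\<theta> *\<^sub>R (v' - v))"
proof -
  assume up: "is_update \<A> \<B> F \<theta> t v x y v'"
  then have "\<exists>!u. \<Delta> u v t x y = - (\<theta> *\<^sub>R (u - v))" by (simp add: is_update_def)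
  from theI'[OF this] show "\<Delta> v' v t x y = - (\<theta> *\<^sub>R (v' - v))"
    using up by (simp add: is_update_def)
qed

lemma exists_run:
  assumes "v0 \<in> Linf T"
  shows "\<exists>\<theta>::nat \<Rightarrow> real. (\<forall>k. \<theta> k > 0) \<and> (\<exists>v. algorithm_run T \<A> \<B> F X Y \<theta> v0 v)"
proof -
  have "\<exists>p. v \<in> Linf T \<longrightarrow> fst p > 0 \<and> snd p \<in> Linf T \<and>
      (AE t in time_measure T. is_update \<A> \<B> F (fst p) t (v t) (X (snd p) t) (Y v t) (snd p t))" for v
  proof (cases "v \<in> Linf T")
    case True
    then obtain \<theta>\<^sub>0 where t0: "\<theta>\<^sub>0 > 0" "\<And>\<theta>. \<theta> > \<theta>\<^sub>0 \<Longrightarrow> \<exists>v'\<in>Linf T. AE t in time_measure T. is_update \<A> \<B> F \<theta> t (v t) (X v' t) (Y v t) (v' t)"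
      using exists_update by blast
    from t0(2)[of "\<theta>\<^sub>0 + 1"] obtain v' where "v' \<in> Linf T"
      "AE t in time_measure T. is_update \<A> \<B> F (\<theta>\<^sub>0 + 1) t (v t) (X v' t) (Y v t) (v' t)" by auto
    then show ?thesis using t0(1) by (intro exI[of _ "(\<theta>\<^sub>0 + 1, v')"]) simp
  qed simp
  then obtain p where p: "\<And>v. v \<in> Linf T \<Longrightarrow> fst (p v) > (0::real) \<and> snd (p v) \<in> Linf T \<and>
      (AE t in time_measure T. is_update \<A> \<B> F (fst (p v)) t (v t) (X (snd (p v)) t) (Y v t) (snd (p v) t))"
    by metis
  define v where "v k = ((\<lambda>v. snd (p v)) ^^ k) v0" for k
  have v: "v 0 = v0" "\<And>k. v (Suc k) = snd (p (v k))" by (simp_all add: v_def)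
  have L: "v k \<in> Linf T" for k by (induction k) (use assms p in \<open>auto simp: v\<close>)
  have "algorithm_run T \<A> \<B> F X Y (\<lambda>k. fst (p (v k))) v0 v"
    unfolding algorithm_run_def using L p[OF L] by (simp add: v)
  then show ?thesis using p[OF L] by (intro exI[of _ "\<lambda>k. fst (p (v k))"]) blast
qed

lemma norm_sq_integrable:
  assumes "h \<in> Linf T"
  shows "integrable (time_measure T) (\<lambda>t. (norm (h t))\<^sup>2)"
proof (rule integrable_time_bounded)
  show "AE t in time_measure T. \<bar>(norm (h t))\<^sup>2\<bar> \<le> (Linf_norm T h)\<^sup>2"
    using AE_Linf_norm[OF T_pos assms] by eventually_elim (simp add: power_mono)
  show "(\<lambda>t. (norm (h t))\<^sup>2) \<in> borel_measurable (time_measure T)"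
    using strongly_measurable_norm_diff[OF LinfD[OF assms], of 0] by simp
qed

lemma update_decreases_cost:
  assumes v: "v \<in> Linf T" and v': "v' \<in> Linf T"
    and up: "AE t in time_measure T. is_update \<A> \<B> F \<theta> t (v t) (X v' t) (Y v t) (v' t)"
  shows "J v' - J v \<le> - \<theta> * (L2_norm T (\<lambda>t. v' t - v t))\<^sup>2"
proof -
  let ?q = "\<lambda>t. - \<theta> * (norm (v' t - v t))\<^sup>2"
  have "J v' - J v \<le> (LINT t|time_measure T. ?q t)"
  proof (rule cost_difference_le[OF v v'])
    show "integrable (time_measure T) ?q"
      by (intro integrable_mult_right norm_sq_integrable Linf_diff v v')
    show "AE t in time_measure T. (v' t - v t) \<bullet> \<Delta> (v' t) (v t) t (X v' t) (Y v t) \<le> ?q t"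
      using up by eventually_elim (simp add: is_updateD power2_norm_eq_inner)
  qed
  also have "\<dots> = - \<theta> * (LINT t|time_measure T. (norm (v' t - v t))\<^sup>2)"
    by (rule integral_mult_right_zero)
  also have "(LINT t|time_measure T. (norm (v' t - v t))\<^sup>2) = (L2_norm T (\<lambda>t. v' t - v t))\<^sup>2"
    by (simp add: L2_norm_def)
  finally show ?thesis .
qed

text \<open>The comparison inequality is applied to \<open>(v, v + h)\<close> and to \<open>(v + h, v)\<close>. In both cases \<open>\<Delta>\<close> is compared
  with its value \<open>0\<close> at \<open>(v, v; X v, Y v)\<close>; its distance to that value is \<open>O(\<parallel>h\<parallel>)\<close> by the Lipschitz
  estimates, and the inner product with \<open>h\<close> contributes the second factor.\<close>

lemma cost_difference_quadratic:
  assumes v: "v \<in> Linf T" and crit: "AE t in time_measure T. slope t (X v t) (Y v t) (v t) = 0"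
  obtains r K where "r > 0" "0 \<le> K"
    "\<And>h. h \<in> Linf T \<Longrightarrow> Linf_norm T h < r \<Longrightarrow> \<bar>J (\<lambda>t. v t + h t) - J v\<bar> \<le> K * (Linf_norm T h)\<^sup>2"
proof -
  obtain rX LX where X: "rX > 0" "0 \<le> LX"
    "\<And>u w. u \<in> Linf T \<Longrightarrow> w \<in> Linf T \<Longrightarrow> Linf_norm T (\<lambda>t. u t - v t) < rX \<Longrightarrow> Linf_norm T (\<lambda>t. w t - v t) < rX \<Longrightarrow>
       AE t in time_measure T. norm (X u t - X w t) \<le> LX * Linf_norm T (\<lambda>t. u t - w t)"
    by (rule Linf_locally_lipschitzE[OF lipschitz_X T_pos v]) blast
  obtain rY LY where Y: "rY > 0" "0 \<le> LY"
    "\<And>u w. u \<in> Linf T \<Longrightarrow> w \<in> Linf T \<Longrightarrow> Linf_norm T (\<lambda>t. u t - v t) < rY \<Longrightarrow> Linf_norm T (\<lambda>t. w t - v t) < rY \<Longrightarrow>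
       AE t in time_measure T. norm (Y u t - Y w t) \<le> LY * Linf_norm T (\<lambda>t. u t - w t)"
    by (rule Linf_locally_lipschitzE[OF lipschitz_Y T_pos v]) blast
  define r where "r = min rX rY"
  define R where "R = Linf_norm T v + r + Linf_norm T (X v) + LX * r + Linf_norm T (Y v) + LY * r"
  have r: "r > 0" "r \<le> rX" "r \<le> rY" using X Y by (auto simp: r_def)
  have nn: "0 \<le> Linf_norm T v" "0 \<le> Linf_norm T (X v)" "0 \<le> Linf_norm T (Y v)" "0 \<le> LX * r" "0 \<le> LY * r"
    using Linf_norm_nonneg[OF T_pos] v X_Linf Y_Linf X(2) Y(2) r by auto
  have v0: "Linf_norm T (\<lambda>t. v t - v t) < r"
    using Linf_norm_le[OF T_pos Linf_diff[OF v v], of 0] r by simp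
  obtain C where C: "0 \<le> C" "\<And>t x x' y y' v v' w w'. t \<in> {0..T} \<Longrightarrow> norm x \<le> R \<Longrightarrow> norm x' \<le> R \<Longrightarrow>
    norm y \<le> R \<Longrightarrow> norm y' \<le> R \<Longrightarrow> norm v \<le> R \<Longrightarrow> norm v' \<le> R \<Longrightarrow>
    norm (\<Delta> v' v t x y - \<Delta> w' w t x' y') \<le> C * (norm (x - x') + norm (y - y') + norm (v' - w') + norm (v - w))"
    by (fact Delta_lipschitz[of R])
  have "\<bar>J (\<lambda>t. v t + h t) - J v\<bar> \<le> C * (LX + LY + 1) * T * (Linf_norm T h)\<^sup>2"
    if h: "h \<in> Linf T" "Linf_norm T h < r" for h
  proof -
    let ?n = "Linf_norm T h" and ?w = "\<lambda>t. v t + h t"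
    let ?c = "C * (LX + LY + 1) * ?n\<^sup>2"
    have w: "?w \<in> Linf T" by (rule Linf_add[OF v h(1)])
    have n0: "0 \<le> ?n" by (rule Linf_norm_nonneg[OF T_pos h(1)])
    have "AE t in time_measure T. norm (X ?w t - X v t) \<le> LX * Linf_norm T (\<lambda>t. ?w t - v t)"
      by (rule X(3)[OF w v]) (use h(2) r v0 in auto)
    moreover have "AE t in time_measure T. norm (Y ?w t - Y v t) \<le> LY * Linf_norm T (\<lambda>t. ?w t - v t)"
      by (rule Y(3)[OF w v]) (use h(2) r v0 in auto)
    ultimately have "AE t in time_measure T. h t \<bullet> \<Delta> (?w t) (v t) t (X ?w t) (Y v t) \<le> ?c \<and>
        - (h t \<bullet> \<Delta> (v t) (?w t) t (X v t) (Y ?w t)) \<le> ?c"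
      using AE_Linf_norm[OF T_pos v] AE_Linf_norm[OF T_pos X_Linf[OF v]] AE_Linf_norm[OF T_pos Y_Linf[OF v]]
        AE_Linf_norm[OF T_pos h(1)] crit AE_space
    proof eventually_elim
      fix t
      assume *: "norm (X ?w t - X v t) \<le> LX * Linf_norm T (\<lambda>t. ?w t - v t)"
        "norm (Y ?w t - Y v t) \<le> LY * Linf_norm T (\<lambda>t. ?w t - v t)"
        "norm (v t) \<le> Linf_norm T v"
        "norm (X v t) \<le> Linf_norm T (X v)" "norm (Y v t) \<le> Linf_norm T (Y v)"
        "norm (h t) \<le> ?n" "slope t (X v t) (Y v t) (v t) = 0" "t \<in> space (time_measure T)"
      have XY: "norm (X ?w t - X v t) \<le> LX * ?n" "norm (Y ?w t - Y v t) \<le> LY * ?n" using *(1,2) by simp_all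
      have t: "t \<in> {0..T}" using *(8) by simp
      have "LX * ?n \<le> LX * r" "LY * ?n \<le> LY * r" using h(2) X(2) Y(2) by (auto intro!: mult_left_mono)
      then have R: "norm (X v t) \<le> R" "norm (Y v t) \<le> R" "norm (v t) \<le> R" "norm (?w t) \<le> R" "norm (X ?w t) \<le> R" "norm (Y ?w t) \<le> R"
        using * XY h(2) nn r norm_triangle_sub[of "X ?w t" "X v t"] norm_triangle_sub[of "Y ?w t" "Y v t"]
          norm_triangle_ineq[of "v t" "h t"]
        unfolding R_def by linarith+
      have Lle: "C * (LX * ?n + ?n) \<le> C * (LX + LY + 1) * ?n" "C * (LY * ?n + ?n) \<le> C * (LX + LY + 1) * ?n"
        using C(1) X(2) Y(2) n0 unfolding mult.assoc by (auto intro!: mult_left_mono simp: algebra_simps)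
      have zero: "\<Delta> (v t) (v t) t (X v t) (Y v t) = 0" by (simp add: Delta_same *(7))
      have "norm (\<Delta> (?w t) (v t) t (X ?w t) (Y v t)) \<le> C * (norm (X ?w t - X v t) + norm (Y v t - Y v t) + norm (?w t - v t) + norm (v t - v t))"
        using C(2)[OF t, of "X ?w t" "X v t" "Y v t" "Y v t" "v t" "?w t" "v t" "v t"] R zero by simp
      also have "\<dots> \<le> C * (LX * ?n + ?n)" using XY *(6) C(1) by (intro mult_left_mono) auto
      finally have 1: "norm (\<Delta> (?w t) (v t) t (X ?w t) (Y v t)) \<le> C * (LX + LY + 1) * ?n" using Lle by linarith
      have "norm (\<Delta> (v t) (?w t) t (X v t) (Y ?w t)) \<le> C * (norm (X v t - X v t) + norm (Y ?w t - Y v t) + norm (v t - v t) + norm (?w t - v t))"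
        using C(2)[OF t, of "X v t" "X v t" "Y ?w t" "Y v t" "?w t" "v t" "v t" "v t"] R zero by simp
      also have "\<dots> \<le> C * (LY * ?n + ?n)" using XY *(6) C(1) by (intro mult_left_mono) auto
      finally have 2: "norm (\<Delta> (v t) (?w t) t (X v t) (Y ?w t)) \<le> C * (LX + LY + 1) * ?n" using Lle by linarith
      have cs: "\<bar>h t \<bullet> z\<bar> \<le> ?c" if "norm z \<le> C * (LX + LY + 1) * ?n" for z
      proof -
        have "\<bar>h t \<bullet> z\<bar> \<le> norm (h t) * norm z" by (rule Cauchy_Schwarz_ineq2)
        also have "\<dots> \<le> ?n * (C * (LX + LY + 1) * ?n)" using that *(6) n0 by (intro mult_mono) auto
        finally show ?thesis by (simp add: power2_eq_square mult_ac)
      qed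
      show "h t \<bullet> \<Delta> (?w t) (v t) t (X ?w t) (Y v t) \<le> ?c \<and> - (h t \<bullet> \<Delta> (v t) (?w t) t (X v t) (Y ?w t)) \<le> ?c"
        using cs[OF 1] cs[OF 2] by linarith
    qed
    note ae = this
    have const: "integrable (time_measure T) (\<lambda>t. ?c)" by (rule integrable_time_bounded[where C="\<bar>?c\<bar>"]) auto
    have lint: "(LINT t|time_measure T. ?c) = ?c * T"
      using T_pos by (simp add: measure_restrict_space)
    have "J ?w - J v \<le> ?c * T"
      unfolding lint[symmetric]
      by (rule cost_difference_le[OF v w const]) (use ae in \<open>auto elim!: eventually_mono\<close>)
    moreover have "J v - J ?w \<le> ?c * T"
      unfolding lint[symmetric]
      by (rule cost_difference_le[OF w v const]) (use ae in \<open>auto elim!: eventually_mono\<close>)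
    ultimately show ?thesis by (simp add: abs_le_iff mult_ac)
  qed
  then show ?thesis using r(1) C(1) X(2) Y(2) T_pos by (intro that[of r "C * (LX + LY + 1) * T"]) auto
qed

text \<open>A quadratic bound on the increments of the cost is stronger than a vanishing derivative.\<close>

lemma stationary_is_critical:
  assumes v: "v \<in> Linf T" and v': "v' \<in> Linf T"
    and up: "AE t in time_measure T. is_update \<A> \<B> F \<theta> t (v t) (X v' t) (Y v t) (v' t)"
    and eq: "AE t in time_measure T. v' t = v t"
  shows "has_control_gradient T J v (\<lambda>t. 0)"
proof -
  obtain r0 L where r0: "r0 > 0" "0 \<le> L"
    "\<And>u w. u \<in> Linf T \<Longrightarrow> w \<in> Linf T \<Longrightarrow> Linf_norm T (\<lambda>t. u t - v t) < r0 \<Longrightarrow> Linf_norm T (\<lambda>t. w t - v t) < r0 \<Longrightarrow>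
       AE t in time_measure T. norm (X u t - X w t) \<le> L * Linf_norm T (\<lambda>t. u t - w t)"
    by (rule Linf_locally_lipschitzE[OF lipschitz_X T_pos v]) blast
  have n: "Linf_norm T (\<lambda>t. v' t - v t) = 0"
  proof (rule antisym)
    show "Linf_norm T (\<lambda>t. v' t - v t) \<le> 0"
      by (rule Linf_norm_le[OF T_pos Linf_diff[OF v' v]]) (use eq in \<open>auto elim: eventually_mono\<close>)
  qed (rule Linf_norm_nonneg[OF T_pos Linf_diff[OF v' v]])
  have n': "Linf_norm T (\<lambda>t. v t - v t) < r0"
    using Linf_norm_le[OF T_pos Linf_diff[OF v v], of 0] r0 by simp
  have "AE t in time_measure T. norm (X v' t - X v t) \<le> L * Linf_norm T (\<lambda>t. v' t - v t)"
    by (rule r0(3)[OF v' v _ n']) (use n r0 in simp)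
  then have "AE t in time_measure T. slope t (X v t) (Y v t) (v t) = 0"
    using up eq
  proof eventually_elim
    fix t assume *: "norm (X v' t - X v t) \<le> L * Linf_norm T (\<lambda>t. v' t - v t)"
      "is_update \<A> \<B> F \<theta> t (v t) (X v' t) (Y v t) (v' t)" "v' t = v t"
    have "X v' t = X v t" using *(1) n by simp
    then show "slope t (X v t) (Y v t) (v t) = 0"
      using is_updateD[OF *(2)] *(3) by (simp add: Delta_same)
  qed
  then obtain r K where K: "r > 0" "0 \<le> K"
    "\<And>h. h \<in> Linf T \<Longrightarrow> Linf_norm T h < r \<Longrightarrow> \<bar>J (\<lambda>t. v t + h t) - J v\<bar> \<le> K * (Linf_norm T h)\<^sup>2"
    using cost_difference_quadratic[OF v] by blast
  show ?thesis
    unfolding has_control_gradient_def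
  proof (intro allI impI)
    fix \<epsilon> :: real assume \<epsilon>: "\<epsilon> > 0"
    have "\<bar>J (\<lambda>t. v t + h t) - J v - (LINT t|time_measure T. 0 \<bullet> h t)\<bar> \<le> \<epsilon> * Linf_norm T h"
      if h: "h \<in> Linf T" "Linf_norm T h < min r (\<epsilon> / (K + 1))" for h
    proof -
      have n0: "0 \<le> Linf_norm T h" by (rule Linf_norm_nonneg[OF T_pos h(1)])
      have "Linf_norm T h * (K + 1) < \<epsilon>" using h(2) K(2) by (simp add: pos_less_divide_eq)
      then have "K * Linf_norm T h \<le> \<epsilon>" using n0 by (simp add: algebra_simps)
      then have "K * Linf_norm T h * Linf_norm T h \<le> \<epsilon> * Linf_norm T h" using n0 by (rule mult_right_mono)
      then show ?thesis using K(3)[OF h(1)] h(2) by (simp add: power2_eq_square mult_ac)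
    qed
    then show "\<exists>\<delta>>0. \<forall>h\<in>Linf T. Linf_norm T h < \<delta> \<longrightarrow>
       \<bar>J (\<lambda>t. v t + h t) - J v - (LINT t|time_measure T. 0 \<bullet> h t)\<bar> \<le> \<epsilon> * Linf_norm T h"
      using K \<epsilon> by (intro exI[of _ "min r (\<epsilon> / (K + 1))"]) auto
  qed
qed

end

section \<open>The monotonic algorithm\<close>

theorem theorem3p5:
  fixes T :: real
    and emb :: "'v::{real_inner, complete_space} \<Rightarrow> 'h::{real_inner, complete_space}"
    and A :: "real \<Rightarrow> 'e::{real_inner, complete_space} \<Rightarrow> ('h \<times> 'h) set"
    and \<A> :: "real \<Rightarrow> 'v \<Rightarrow> 'v \<Rightarrow> 'e \<Rightarrow> real"
    and \<B> :: "real \<Rightarrow> 'v \<Rightarrow> 'e \<Rightarrow> real"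
    and F :: "real \<Rightarrow> 'e \<Rightarrow> 'v \<Rightarrow> real"
    and G :: "'v \<Rightarrow> real"
    and X0 :: 'v
    and X Y :: "(real \<Rightarrow> 'e) \<Rightarrow> (real \<Rightarrow> 'v)"
  assumes "T > 0"
    \<comment> \<open>\<open>V\<close> is densely included in \<open>H\<close>\<close>
    and "linear emb" and "inj emb" and "closure (range emb) = UNIV"
    \<comment> \<open>the operators and the pairings\<close>
    and "\<And>t v. linear_operator (A t v)"
    and "\<And>v. AE t in time_measure T. \<exists>S. operator_sqrt (A t v) S \<and> range emb \<subseteq> Domain S"
    and "\<And>t v. bilinear (\<lambda>x y. \<A> t x y v)"
    and "\<And>t v x y z. (emb x, emb z) \<in> A t v \<Longrightarrow> \<A> t x y v = y \<bullet> z"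
    and "\<And>t v. linear (\<lambda>y. \<B> t y v)"
    \<comment> \<open>differentiability and concavity\<close>
    and "\<And>p. (\<lambda>(t, v, x). F t v x) differentiable (at p)"
    and "\<And>x. G differentiable (at x)"
    and "\<And>x x'. G x' - G x \<le> gradient G x \<bullet> (x' - x)"
    and "\<And>t v x x'. F t v x' - F t v x \<le> gradient (\<lambda>z. F t v z) x \<bullet> (x' - x)"
    \<comment> \<open>regularity with respect to the control\<close>
    and "\<And>t x y. class_C2 (\<lambda>v. \<A> t x y v)"
    and "\<And>t y. class_C2 (\<lambda>v. \<B> t y v)"
    and "\<And>t x. class_C2 (\<lambda>v. F t v x)"
    and "\<And>R. \<exists>M. \<forall>t\<in>{0..T}. \<forall>x y v. norm x \<le> R \<longrightarrow> norm y \<le> R \<longrightarrow>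
           norm (fderiv (fderiv (\<lambda>w. \<A> t x y w)) v) \<le> M \<and>
           norm (fderiv (fderiv (\<lambda>w. \<B> t y w)) v) \<le> M"
    \<comment> \<open>regularity of the control gradient with respect to the state\<close>
    and "\<And>t v. class_C1 (\<lambda>x. gradient (\<lambda>w. F t w x) v)"
    and "\<exists>k::real \<Rightarrow> real. (\<forall>r\<ge>0. k r > 0) \<and> continuous_on {0..} k \<and> mono_on {0..} k \<and>
           (\<forall>t\<in>{0..T}. \<forall>v x. norm (fderiv (fderiv (\<lambda>w. F t w x)) v) \<le> k (norm x))"
    \<comment> \<open>technical: the control gradients of the pairings are measurable in time, and the
        derivatives below are uniform in time on bounded sets\<close>
    and "\<And>x y v. strongly_measurable T (\<lambda>t. gradient (\<lambda>w. \<A> t x y w) v)"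
    and "\<And>y v. strongly_measurable T (\<lambda>t. gradient (\<lambda>w. \<B> t y w) v)"
    and "\<And>R. \<exists>M. \<forall>t\<in>{0..T}. \<forall>x y v. norm x \<le> R \<longrightarrow> norm y \<le> R \<longrightarrow> norm v \<le> R \<longrightarrow>
           norm (fderiv (\<lambda>w. \<A> t x y w) v) \<le> M \<and> norm (fderiv (\<lambda>w. \<B> t y w) v) \<le> M \<and>
           norm (fderiv (\<lambda>z. gradient (\<lambda>w. F t w z) v) x) \<le> M"
    \<comment> \<open>well-posedness, with solution operators \<open>X\<close> and \<open>Y\<close>; the integral in the cost exists\<close>
    and "\<And>v. v \<in> Linf T \<Longrightarrow> state_solution T \<A> \<B> X0 v (X v)"
    and "\<And>v. v \<in> Linf T \<Longrightarrow> adjoint_solution T \<A> F G v (X v) (Y v)"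
    and "Linf_locally_lipschitz T X" and "Linf_locally_lipschitz T Y"
    and "\<And>v. v \<in> Linf T \<Longrightarrow> integrable (time_measure T) (\<lambda>t. F t (v t) (X v t))"
  shows "(\<forall>v\<in>Linf T. \<exists>\<theta>\<^sub>0>0. \<forall>\<theta>>\<theta>\<^sub>0. \<exists>v'\<in>Linf T.
            state_solution T \<A> \<B> X0 v' (X v') \<and>
            (AE t in time_measure T. is_update \<A> \<B> F \<theta> t (v t) (X v' t) (Y v t) (v' t))) \<and>
         (\<forall>v0\<in>Linf T. \<exists>\<theta>::nat \<Rightarrow> real. (\<forall>k. \<theta> k > 0) \<and>
            (\<exists>v. algorithm_run T \<A> \<B> F X Y \<theta> v0 v) \<and>
            (\<forall>v. algorithm_run T \<A> \<B> F X Y \<theta> v0 v \<longrightarrow>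
              (\<forall>k. cost T F G X (v (Suc k)) \<le> cost T F G X (v k)) \<and>
              (\<forall>k. cost T F G X (v (Suc k)) - cost T F G X (v k)
                     \<le> - \<theta> k * (L2_norm T (\<lambda>t. v (Suc k) t - v k t))\<^sup>2) \<and>
              (\<forall>k. (AE t in time_measure T. v (Suc k) t = v k t) \<longrightarrow>
                     has_control_gradient T (cost T F G X) (v k) (\<lambda>t. 0))))"
proof -
  obtain k :: "real \<Rightarrow> real" where "mono_on {0..} k"
      "\<forall>t\<in>{0..T}. \<forall>v x. norm (fderiv (fderiv (\<lambda>w. F t w x)) v) \<le> k (norm x)"
    using assms(19) by (elim exE conjE)
  then have k: "\<exists>k::real \<Rightarrow> real. mono_on {0..} k \<and>
      (\<forall>t\<in>{0..T}. \<forall>v x. norm (fderiv (fderiv (\<lambda>w. F t w x)) v) \<le> k (norm x))"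
    by (intro exI[of _ k] conjI)
  interpret control_problem T \<A> \<B> F G X0 X Y
    by (rule control_problem.intro[of T \<A> \<B> F,
          OF control_pairings.intro[where T=T and \<A>=\<A> and \<B>=\<B> and F=F, OF assms(7,9,10,14-18) k assms(20-22)]
            control_problem_axioms.intro[OF assms(1,12,13,23-27)]])
  show ?thesis
  proof (intro conjI ballI)
    fix v :: "real \<Rightarrow> 'e" assume v: "v \<in> Linf T"
    show "\<exists>\<theta>\<^sub>0>0. \<forall>\<theta>>\<theta>\<^sub>0. \<exists>v'\<in>Linf T. state_solution T \<A> \<B> X0 v' (X v') \<and>
            (AE t in time_measure T. is_update \<A> \<B> F \<theta> t (v t) (X v' t) (Y v t) (v' t))"
    proof -
      obtain \<theta>\<^sub>0 where \<theta>\<^sub>0: "\<theta>\<^sub>0 > 0" "\<And>\<theta>. \<theta> > \<theta>\<^sub>0 \<Longrightarrow> \<exists>v'\<in>Linf T.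
          AE t in time_measure T. is_update \<A> \<B> F \<theta> t (v t) (X v' t) (Y v t) (v' t)"
        using exists_update[OF v] by blast
      show ?thesis
      proof (intro exI[of _ \<theta>\<^sub>0] conjI allI impI \<theta>\<^sub>0(1))
        fix \<theta> assume "\<theta>\<^sub>0 < \<theta>"
        from \<theta>\<^sub>0(2)[OF this] obtain v' where "v' \<in> Linf T"
          "AE t in time_measure T. is_update \<A> \<B> F \<theta> t (v t) (X v' t) (Y v t) (v' t)" ..
        with state show "\<exists>v'\<in>Linf T. state_solution T \<A> \<B> X0 v' (X v') \<and>
            (AE t in time_measure T. is_update \<A> \<B> F \<theta> t (v t) (X v' t) (Y v t) (v' t))"
          by (intro bexI[of _ v'] conjI)
      qed
    qed
  next
    fix v0 :: "real \<Rightarrow> 'e" assume "v0 \<in> Linf T"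
    then obtain \<theta> :: "nat \<Rightarrow> real" and w where \<theta>: "\<And>k. \<theta> k > 0"
      and run: "algorithm_run T \<A> \<B> F X Y \<theta> v0 w"
      using exists_run by blast
    have "J (v (Suc k)) \<le> J (v k) \<and>
        J (v (Suc k)) - J (v k) \<le> - \<theta> k * (L2_norm T (\<lambda>t. v (Suc k) t - v k t))\<^sup>2 \<and>
        ((AE t in time_measure T. v (Suc k) t = v k t) \<longrightarrow> has_control_gradient T J (v k) (\<lambda>t. 0))"
      if v: "algorithm_run T \<A> \<B> F X Y \<theta> v0 v" for v k
    proof -
      have L: "v k \<in> Linf T" "v (Suc k) \<in> Linf T"
        and up: "AE t in time_measure T. is_update \<A> \<B> F (\<theta> k) t (v k t) (X (v (Suc k)) t) (Y (v k) t) (v (Suc k) t)"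
        using v by (auto simp: algorithm_run_def)
      have dec: "J (v (Suc k)) - J (v k) \<le> - \<theta> k * (L2_norm T (\<lambda>t. v (Suc k) t - v k t))\<^sup>2"
        by (rule update_decreases_cost[OF L up])
      moreover have "0 \<le> \<theta> k * (L2_norm T (\<lambda>t. v (Suc k) t - v k t))\<^sup>2"
        using \<theta>[of k] by simp
      ultimately have "J (v (Suc k)) \<le> J (v k)" by linarith
      with dec stationary_is_critical[OF L up] show ?thesis by blast
    qed
    note step = this
    show "\<exists>\<theta>::nat \<Rightarrow> real. (\<forall>k. \<theta> k > 0) \<and>
            (\<exists>v. algorithm_run T \<A> \<B> F X Y \<theta> v0 v) \<and>
            (\<forall>v. algorithm_run T \<A> \<B> F X Y \<theta> v0 v \<longrightarrow>
              (\<forall>k. J (v (Suc k)) \<le> J (v k)) \<and>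
              (\<forall>k. J (v (Suc k)) - J (v k) \<le> - \<theta> k * (L2_norm T (\<lambda>t. v (Suc k) t - v k t))\<^sup>2) \<and>
              (\<forall>k. (AE t in time_measure T. v (Suc k) t = v k t) \<longrightarrow>
                     has_control_gradient T J (v k) (\<lambda>t. 0)))"
    proof (intro exI[of _ \<theta>] conjI allI impI)
      show "\<exists>v. algorithm_run T \<A> \<B> F X Y \<theta> v0 v" using run by blast
    qed (use \<theta> step in blast)+
  qed
qed

end
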